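(* Let $\rho\in\mathcal P^\infty_+(M)$, let $f\in C^\infty(M)$, let $T_1,\ldots,T_m\in C^\infty(M)$ and let $$\mathcal O_T(\rho)=\left(\int_M T_1\rho\,d\mathrm{vol},\ldots,\int_M T_m\rho\,d\mathrm{vol}\right)\in\mathbf R^m.$$ If the linear map $R_\rho:\mathbf R^m\to\mathbf R^m$ is represented by the matrix $(R_{ij}(\rho))$, then $$D\mathcal O_T(\rho)[K^S_\rho f]=R_\rho\,D\mathcal O_T(\rho)[K^W_\rho f]$$ holds exactly when $$\int_M\rho\langle\operatorname{grad}T_i,M_\rho\operatorname{grad}f\rangle_g\,d\mathrm{vol}=\sum_{j=1}^m R_{ij}(\rho)\int_M\rho\langle\operatorname{grad}T_j,\operatorname{grad}f\rangle_g\,d\mathrm{vol}$$ for every $i$. Consequently, equality of the observed moment evolutions ($R_\rho=\mathrm{id}$) means that $(M_\rho-\mathrm{id})\operatorname{grad}f$ is orthogonal in $L^2(\rho;TM)$ to the gradients of the chosen observables $T_1,\dots,T_m$.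
   Context: $M$ is a connected, closed, oriented Riemannian manifold with metric $g$ and volume $\mathrm{vol}$; $\mathcal P^\infty_+(M)$ is the set of smooth strictly positive $\rho$ with $\int_M\rho\,d\mathrm{vol}=1$, with tangent space the smooth functions of zero integral. $\mathcal H_k$ is the reproducing kernel Hilbert space of vector fields of a smooth positive definite kernel $k(x,y):T_xM\to T_yM$, assumed continuously included in $C^1(M;TM)$; $I_\rho:\mathcal H_k\to L^2(\rho;TM)$ is the inclusion (target inner product $\int_M\langle u,v\rangle_g\rho\,d\mathrm{vol}$), $I_\rho^*$ its adjoint. $K^W_\rho f=-\operatorname{div}(\rho\operatorname{grad}f)$, $K^S_\rho f=-\operatorname{div}(\rho I_\rho^*\operatorname{grad}f)$. $H^W_\rho$ is the $L^2(\rho;TM)$-closure of smooth gradients, $P^{\mathrm{hor}}_\rho$ the orthogonal projection onto it, and $M_\rho=P^{\mathrm{hor}}_\rho I_\rho I_\rho^*|_{H^W_\rho}$. *)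

theory Defs
  imports "HOL-Analysis.Analysis"
begin

section \<open>Smooth maps between open subsets of Euclidean spaces\<close>

text \<open>Only used for open \<open>S\<close>, where the unrestricted filter \<open>at x\<close> is the right one.\<close>

primrec Ck_on :: "nat \<Rightarrow> 'a::euclidean_space set \<Rightarrow> ('a \<Rightarrow> 'b::real_normed_vector) \<Rightarrow> bool" where
  "Ck_on 0 S f \<longleftrightarrow> continuous_on S f"
| "Ck_on (Suc k) S f \<longleftrightarrow>
     (\<forall>x\<in>S. f differentiable (at x)) \<and>
     (\<forall>v. Ck_on k S (\<lambda>x. frechet_derivative f (at x) v))"

definition smooth_on :: "'a::euclidean_space set \<Rightarrow> ('a \<Rightarrow> 'b::real_normed_vector) \<Rightarrow> bool" where
  "smooth_on S f \<longleftrightarrow> (\<forall>k. Ck_on k S f)"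


section \<open>Oriented manifolds and tangent vectors\<close>

text \<open>The manifold is the whole type \<open>'m\<close> with its class topology. A chart is a domain together
  with a coordinate map; the values of the latter outside the domain are irrelevant.\<close>

type_synonym ('m, 'n) chart = "'m set \<times> ('m \<Rightarrow> (real, 'n) vec)"

abbreviation cdom :: "('m, 'n) chart \<Rightarrow> 'm set" where
  "cdom c \<equiv> fst c"

abbreviation coord :: "('m, 'n) chart \<Rightarrow> 'm \<Rightarrow> (real, 'n) vec" where
  "coord c \<equiv> snd c"

abbreviation cimg :: "('m, 'n) chart \<Rightarrow> (real, 'n) vec set" where
  "cimg c \<equiv> coord c ` cdom c"

definition cinv :: "('m, 'n) chart \<Rightarrow> (real, 'n) vec \<Rightarrow> 'm" where
  "cinv c = inv_into (cdom c) (coord c)"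

definition is_chart :: "('m::topological_space, 'n::finite) chart \<Rightarrow> bool" where
  "is_chart c \<longleftrightarrow> open (cdom c) \<and> open (cimg c) \<and>
     homeomorphism (cdom c) (cimg c) (coord c) (cinv c)"

text \<open>The atlas need not be maximal: any atlas with orientation preserving smooth changes of
  charts determines the smooth structure and the orientation.\<close>

definition oriented_atlas :: "('m::topological_space, 'n::finite) chart set \<Rightarrow> bool" where
  "oriented_atlas A \<longleftrightarrow>
     (\<forall>c\<in>A. is_chart c) \<and> (\<Union>c\<in>A. cdom c) = UNIV \<and>
     (\<forall>c\<in>A. \<forall>d\<in>A.
        smooth_on (coord c ` (cdom c \<inter> cdom d)) (coord d \<circ> cinv c) \<and>
        (\<forall>p\<in>cdom c \<inter> cdom d.
           det (matrix (frechet_derivative (coord d \<circ> cinv c) (at (coord c p)))) > 0))"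

definition closed_oriented_manifold ::
  "('m::{t2_space,second_countable_topology}, 'n::finite) chart set \<Rightarrow> bool" where
  "closed_oriented_manifold A \<longleftrightarrow>
     oriented_atlas A \<and> compact (UNIV :: 'm set) \<and> connected (UNIV :: 'm set)"

text \<open>A tangent vector at \<open>p\<close> is the family of its components in all charts around \<open>p\<close>, related by
  the Jacobians of the changes of charts. Components in charts not containing \<open>p\<close> are set to \<open>0\<close>, so
  that equality of tangent vectors is equality of families. The linear structure is componentwise.\<close>

type_synonym ('m, 'n) tangent = "('m, 'n) chart \<Rightarrow> (real, 'n) vec"

definition tangent_space :: "('m, 'n::finite) chart set \<Rightarrow> 'm \<Rightarrow> ('m, 'n) tangent set" where
  "tangent_space A p = {v.
     (\<forall>c. \<not> (c \<in> A \<and> p \<in> cdom c) \<longrightarrow> v c = 0) \<and>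
     (\<forall>c\<in>A. \<forall>d\<in>A. p \<in> cdom c \<inter> cdom d \<longrightarrow>
        v d = frechet_derivative (coord d \<circ> cinv c) (at (coord c p)) (v c))}"

text \<open>The tangent vector at \<open>p\<close> whose component in the chart \<open>c\<close> is \<open>w\<close>.\<close>

definition tangent_of ::
  "('m, 'n::finite) chart set \<Rightarrow> ('m, 'n) chart \<Rightarrow> 'm \<Rightarrow> (real, 'n) vec \<Rightarrow> ('m, 'n) tangent" where
  "tangent_of A c p w = (\<lambda>d. if d \<in> A \<and> p \<in> cdom d
     then frechet_derivative (coord d \<circ> cinv c) (at (coord c p)) w else 0)"

type_synonym ('m, 'n) vfield = "'m \<Rightarrow> ('m, 'n) tangent"

definition vector_field :: "('m, 'n::finite) chart set \<Rightarrow> ('m, 'n) vfield \<Rightarrow> bool" where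
  "vector_field A X \<longleftrightarrow> (\<forall>p. X p \<in> tangent_space A p)"

definition vzero :: "('m, 'n::finite) vfield" where
  "vzero = (\<lambda>p c. 0)"

definition vadd :: "('m, 'n::finite) vfield \<Rightarrow> ('m, 'n) vfield \<Rightarrow> ('m, 'n) vfield" where
  "vadd X Y = (\<lambda>p c. X p c + Y p c)"

definition vdiff :: "('m, 'n::finite) vfield \<Rightarrow> ('m, 'n) vfield \<Rightarrow> ('m, 'n) vfield" where
  "vdiff X Y = (\<lambda>p c. X p c - Y p c)"

definition vscale :: "('m \<Rightarrow> real) \<Rightarrow> ('m, 'n::finite) vfield \<Rightarrow> ('m, 'n) vfield" where
  "vscale a X = (\<lambda>p c. a p *\<^sub>R X p c)"

definition C1_vector_field ::
  "('m, 'n::finite) chart set \<Rightarrow> ('m, 'n) vfield \<Rightarrow> bool" where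
  "C1_vector_field A X \<longleftrightarrow>
     vector_field A X \<and> (\<forall>c\<in>A. Ck_on 1 (cimg c) (\<lambda>x. X (cinv c x) c))"

definition smooth_fun :: "('m, 'n::finite) chart set \<Rightarrow> ('m \<Rightarrow> real) \<Rightarrow> bool" where
  "smooth_fun A f \<longleftrightarrow> (\<forall>c\<in>A. smooth_on (cimg c) (f \<circ> cinv c))"

text \<open>Some chart around \<open>p\<close>, for quantities that do not depend on the chart.\<close>

definition chart_at :: "('m, 'n) chart set \<Rightarrow> 'm \<Rightarrow> ('m, 'n) chart" where
  "chart_at A p = (SOME c. c \<in> A \<and> p \<in> cdom c)"

definition differential ::
  "('m, 'n::finite) chart set \<Rightarrow> ('m \<Rightarrow> real) \<Rightarrow> 'm \<Rightarrow> ('m, 'n) tangent \<Rightarrow> real" where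
  "differential A f p v = (let c = chart_at A p in
     frechet_derivative (f \<circ> cinv c) (at (coord c p)) (v c))"


section \<open>Riemannian metric, volume, gradient, divergence\<close>

type_synonym ('m, 'n) metric = "'m \<Rightarrow> ('m, 'n) tangent \<Rightarrow> ('m, 'n) tangent \<Rightarrow> real"

definition gram ::
  "('m, 'n::finite) chart set \<Rightarrow> ('m, 'n) metric \<Rightarrow> ('m, 'n) chart \<Rightarrow> 'm \<Rightarrow> real^'n^'n" where
  "gram A g c p = (\<chi> i j. g p (tangent_of A c p (axis i 1)) (tangent_of A c p (axis j 1)))"

definition riemannian_metric ::
  "('m, 'n::finite) chart set \<Rightarrow> ('m, 'n) metric \<Rightarrow> bool" where
  "riemannian_metric A g \<longleftrightarrow>
     (\<forall>p. \<forall>u\<in>tangent_space A p. \<forall>v\<in>tangent_space A p. \<forall>w\<in>tangent_space A p. \<forall>a.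
        g p u v = g p v u \<and>
        g p (\<lambda>c. u c + v c) w = g p u w + g p v w \<and>
        g p (\<lambda>c. a *\<^sub>R u c) w = a * g p u w \<and>
        (u \<noteq> (\<lambda>c. 0) \<longrightarrow> g p u u > 0)) \<and>
     (\<forall>c\<in>A. \<forall>i j. smooth_on (cimg c) (\<lambda>x. gram A g c (cinv c x) $ i $ j))"

text \<open>The Riemannian volume is the unique Borel measure with density \<open>sqrt (det g)\<close> in every chart.\<close>

definition riemannian_volume ::
  "('m::topological_space, 'n::finite) chart set \<Rightarrow> ('m, 'n) metric \<Rightarrow> 'm measure \<Rightarrow> bool" where
  "riemannian_volume A g vol \<longleftrightarrow> sets vol = sets borel \<and>
     (\<forall>c\<in>A. \<forall>B\<in>sets borel. B \<subseteq> cdom c \<longrightarrow>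
        emeasure vol B =
          (\<integral>\<^sup>+ x \<in> coord c ` B. ennreal (sqrt (det (gram A g c (cinv c x)))) \<partial>lborel))"

definition grad ::
  "('m, 'n::finite) chart set \<Rightarrow> ('m, 'n) metric \<Rightarrow> ('m \<Rightarrow> real) \<Rightarrow> ('m, 'n) vfield" where
  "grad A g f p = (THE v. v \<in> tangent_space A p \<and>
     (\<forall>w\<in>tangent_space A p. g p v w = differential A f p w))"

definition divergence ::
  "('m, 'n::finite) chart set \<Rightarrow> ('m, 'n) metric \<Rightarrow> ('m, 'n) vfield \<Rightarrow> 'm \<Rightarrow> real" where
  "divergence A g X p = (let c = chart_at A p; s = (\<lambda>x. sqrt (det (gram A g c (cinv c x)))) in
     (\<Sum>i\<in>UNIV. frechet_derivative (\<lambda>x. s x * X (cinv c x) c $ i) (at (coord c p)) (axis i 1))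
       / s (coord c p))"


section \<open>Smooth positive densities and moments\<close>

definition smooth_positive_densities ::
  "('m, 'n::finite) chart set \<Rightarrow> 'm measure \<Rightarrow> ('m \<Rightarrow> real) set" where
  "smooth_positive_densities A vol = {\<rho>. smooth_fun A \<rho> \<and> (\<forall>p. \<rho> p > 0) \<and> (\<integral>p. \<rho> p \<partial>vol) = 1}"

definition moments ::
  "'m measure \<Rightarrow> ('k::finite \<Rightarrow> 'm \<Rightarrow> real) \<Rightarrow> ('m \<Rightarrow> real) \<Rightarrow> real^'k" where
  "moments vol T \<rho> = (\<chi> i. \<integral>p. T i p * \<rho> p \<partial>vol)"

text \<open>The derivative of \<open>moments vol T\<close> at \<open>\<rho>\<close> in the direction \<open>\<eta>\<close>. For smooth \<open>\<eta>\<close> of zero integral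
  the curve \<open>\<rho> + t \<eta>\<close> stays in the smooth positive densities for small \<open>t\<close>.\<close>

definition moments_deriv ::
  "'m measure \<Rightarrow> ('k::finite \<Rightarrow> 'm \<Rightarrow> real) \<Rightarrow> ('m \<Rightarrow> real) \<Rightarrow> ('m \<Rightarrow> real) \<Rightarrow> real^'k" where
  "moments_deriv vol T \<rho> \<eta> = vector_derivative (\<lambda>t. moments vol T (\<lambda>p. \<rho> p + t * \<eta> p)) (at 0)"


section \<open>Square integrable vector fields\<close>

text \<open>Elements of \<open>L\<^sup>2(\<rho>; TM)\<close> are given by representatives; fields that agree almost everywhere
  are not identified.\<close>

definition L2_inner ::
  "('m, 'n::finite) metric \<Rightarrow> 'm measure \<Rightarrow> ('m \<Rightarrow> real) \<Rightarrow>
    ('m, 'n) vfield \<Rightarrow> ('m, 'n) vfield \<Rightarrow> real" where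
  "L2_inner g vol \<rho> u v = (\<integral>p. \<rho> p * g p (u p) (v p) \<partial>vol)"

definition L2_fields ::
  "('m::topological_space, 'n::finite) chart set \<Rightarrow> ('m, 'n) metric \<Rightarrow> 'm measure \<Rightarrow>
    ('m \<Rightarrow> real) \<Rightarrow> ('m, 'n) vfield set" where
  "L2_fields A g vol \<rho> = {u. vector_field A u \<and>
     (\<forall>c\<in>A. (\<lambda>p. u p c) \<in> borel_measurable borel) \<and>
     integrable vol (\<lambda>p. \<rho> p * g p (u p) (u p))}"

definition horizontal_space ::
  "('m::topological_space, 'n::finite) chart set \<Rightarrow> ('m, 'n) metric \<Rightarrow> 'm measure \<Rightarrow>
    ('m \<Rightarrow> real) \<Rightarrow> ('m, 'n) vfield set" where
  "horizontal_space A g vol \<rho> = {u \<in> L2_fields A g vol \<rho>.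
     \<forall>e>0. \<exists>\<phi>. smooth_fun A \<phi> \<and>
       sqrt (L2_inner g vol \<rho> (vdiff u (grad A g \<phi>)) (vdiff u (grad A g \<phi>))) < e}"

text \<open>A representative of the orthogonal projection, which is unique almost everywhere.\<close>

definition horizontal_projection ::
  "('m::topological_space, 'n::finite) chart set \<Rightarrow> ('m, 'n) metric \<Rightarrow> 'm measure \<Rightarrow>
    ('m \<Rightarrow> real) \<Rightarrow> ('m, 'n) vfield \<Rightarrow> ('m, 'n) vfield" where
  "horizontal_projection A g vol \<rho> u = (SOME v. v \<in> horizontal_space A g vol \<rho> \<and>
     (\<forall>w\<in>horizontal_space A g vol \<rho>. L2_inner g vol \<rho> (vdiff u v) w = 0))"


section \<open>Kernels and reproducing kernel Hilbert spaces of vector fields\<close>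

type_synonym ('m, 'n) kernel = "'m \<Rightarrow> 'm \<Rightarrow> ('m, 'n) tangent \<Rightarrow> ('m, 'n) tangent"

definition smooth_kernel ::
  "('m, 'n::finite) chart set \<Rightarrow> ('m, 'n) kernel \<Rightarrow> bool" where
  "smooth_kernel A k \<longleftrightarrow>
     (\<forall>x y. \<forall>u\<in>tangent_space A x. \<forall>v\<in>tangent_space A x. \<forall>a.
        k x y u \<in> tangent_space A y \<and>
        k x y (\<lambda>c. u c + v c) = (\<lambda>c. k x y u c + k x y v c) \<and>
        k x y (\<lambda>c. a *\<^sub>R u c) = (\<lambda>c. a *\<^sub>R k x y u c)) \<and>
     (\<forall>c\<in>A. \<forall>d\<in>A. \<forall>i. smooth_on (cimg c \<times> cimg d)
        (\<lambda>(a, b). k (cinv c a) (cinv d b) (tangent_of A c (cinv c a) (axis i 1)) d))"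

definition positive_definite_kernel ::
  "('m, 'n::finite) chart set \<Rightarrow> ('m, 'n) metric \<Rightarrow> ('m, 'n) kernel \<Rightarrow> bool" where
  "positive_definite_kernel A g k \<longleftrightarrow>
     (\<forall>x y. \<forall>u\<in>tangent_space A x. \<forall>v\<in>tangent_space A y. g y (k x y u) v = g x u (k y x v)) \<and>
     (\<forall>N::nat. \<forall>x v. (\<forall>i<N. v i \<in> tangent_space A (x i)) \<longrightarrow>
        0 \<le> (\<Sum>i<N. \<Sum>j<N. g (x j) (k (x i) (x j) (v i)) (v j)))"

definition hilbert_space_of_fields ::
  "('m, 'n::finite) chart set \<Rightarrow> ('m, 'n) vfield set \<Rightarrow>
    (('m, 'n) vfield \<Rightarrow> ('m, 'n) vfield \<Rightarrow> real) \<Rightarrow> bool" where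
  "hilbert_space_of_fields A H ip \<longleftrightarrow>
     (\<forall>h\<in>H. vector_field A h) \<and> vzero \<in> H \<and>
     (\<forall>u\<in>H. \<forall>v\<in>H. vadd u v \<in> H) \<and> (\<forall>u\<in>H. \<forall>a. vscale (\<lambda>_. a) u \<in> H) \<and>
     (\<forall>u\<in>H. \<forall>v\<in>H. \<forall>w\<in>H. \<forall>a. ip u v = ip v u \<and> ip (vadd u v) w = ip u w + ip v w \<and>
        ip (vscale (\<lambda>_. a) u) w = a * ip u w) \<and>
     (\<forall>u\<in>H. u \<noteq> vzero \<longrightarrow> ip u u > 0) \<and>
     (\<forall>s::nat \<Rightarrow> ('m, 'n) vfield. (\<forall>n. s n \<in> H) \<longrightarrow>
        (\<forall>e>0. \<exists>N. \<forall>i\<ge>N. \<forall>j\<ge>N. sqrt (ip (vdiff (s i) (s j)) (vdiff (s i) (s j))) < e) \<longrightarrow>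
        (\<exists>u\<in>H. (\<lambda>n. sqrt (ip (vdiff (s n) u) (vdiff (s n) u))) \<longlonglongrightarrow> 0))"

text \<open>By the Moore--Aronszajn theorem \<open>H\<close>, and \<open>ip\<close> on \<open>H\<close>, are uniquely determined by the kernel.\<close>

definition rkhs ::
  "('m, 'n::finite) chart set \<Rightarrow> ('m, 'n) metric \<Rightarrow> ('m, 'n) kernel \<Rightarrow> ('m, 'n) vfield set \<Rightarrow>
    (('m, 'n) vfield \<Rightarrow> ('m, 'n) vfield \<Rightarrow> real) \<Rightarrow> bool" where
  "rkhs A g k H ip \<longleftrightarrow> hilbert_space_of_fields A H ip \<and>
     (\<forall>x. \<forall>v\<in>tangent_space A x. (\<lambda>y. k x y v) \<in> H \<and>
        (\<forall>h\<in>H. ip h (\<lambda>y. k x y v) = g x (h x) v))"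

text \<open>The topology of \<open>C\<^sup>1(M; TM)\<close> is that of uniform convergence of the components and their first
  derivatives on compact subsets of chart domains.\<close>

definition continuously_included_in_C1 ::
  "('m::topological_space, 'n::finite) chart set \<Rightarrow> ('m, 'n) vfield set \<Rightarrow>
    (('m, 'n) vfield \<Rightarrow> ('m, 'n) vfield \<Rightarrow> real) \<Rightarrow> bool" where
  "continuously_included_in_C1 A H ip \<longleftrightarrow>
     (\<forall>h\<in>H. C1_vector_field A h) \<and>
     (\<forall>c\<in>A. \<forall>S. compact S \<and> S \<subseteq> cdom c \<longrightarrow>
        (\<exists>C. \<forall>h\<in>H. \<forall>p\<in>S. norm (h p c) \<le> C * sqrt (ip h h) \<and>
           (\<forall>i. norm (frechet_derivative (\<lambda>x. h (cinv c x) c) (at (coord c p)) (axis i 1))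
              \<le> C * sqrt (ip h h))))"


section \<open>The operators\<close>

text \<open>The density only fixes the inner product on the target \<open>L\<^sup>2(\<rho>; TM)\<close>.\<close>

definition inclusion ::
  "('m \<Rightarrow> real) \<Rightarrow> ('m, 'n::finite) vfield \<Rightarrow> ('m, 'n) vfield" where
  "inclusion \<rho> h = h"

definition inclusion_adjoint ::
  "('m, 'n::finite) metric \<Rightarrow> 'm measure \<Rightarrow> ('m, 'n) vfield set \<Rightarrow>
    (('m, 'n) vfield \<Rightarrow> ('m, 'n) vfield \<Rightarrow> real) \<Rightarrow> ('m \<Rightarrow> real) \<Rightarrow>
    ('m, 'n) vfield \<Rightarrow> ('m, 'n) vfield" where
  "inclusion_adjoint g vol H ip \<rho> u =
     (THE w. w \<in> H \<and> (\<forall>h\<in>H. ip w h = L2_inner g vol \<rho> u (inclusion \<rho> h)))"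

definition K_W ::
  "('m, 'n::finite) chart set \<Rightarrow> ('m, 'n) metric \<Rightarrow> ('m \<Rightarrow> real) \<Rightarrow> ('m \<Rightarrow> real) \<Rightarrow> 'm \<Rightarrow> real" where
  "K_W A g \<rho> f = (\<lambda>p. - divergence A g (vscale \<rho> (grad A g f)) p)"

definition K_S ::
  "('m, 'n::finite) chart set \<Rightarrow> ('m, 'n) metric \<Rightarrow> 'm measure \<Rightarrow> ('m, 'n) vfield set \<Rightarrow>
    (('m, 'n) vfield \<Rightarrow> ('m, 'n) vfield \<Rightarrow> real) \<Rightarrow> ('m \<Rightarrow> real) \<Rightarrow> ('m \<Rightarrow> real) \<Rightarrow> 'm \<Rightarrow> real" where
  "K_S A g vol H ip \<rho> f =
     (\<lambda>p. - divergence A g (vscale \<rho> (inclusion_adjoint g vol H ip \<rho> (grad A g f))) p)"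

text \<open>Meant for arguments \<open>u\<close> in \<open>horizontal_space A g vol \<rho>\<close>.\<close>

definition M_op ::
  "('m::topological_space, 'n::finite) chart set \<Rightarrow> ('m, 'n) metric \<Rightarrow> 'm measure \<Rightarrow>
    ('m, 'n) vfield set \<Rightarrow> (('m, 'n) vfield \<Rightarrow> ('m, 'n) vfield \<Rightarrow> real) \<Rightarrow> ('m \<Rightarrow> real) \<Rightarrow>
    ('m, 'n) vfield \<Rightarrow> ('m, 'n) vfield" where
  "M_op A g vol H ip \<rho> u =
     horizontal_projection A g vol \<rho> (inclusion \<rho> (inclusion_adjoint g vol H ip \<rho> u))"

end

theory Submission
  imports Defs
begin

text \<open>
  Both sides of the matrix identity are computed by one formula. For a \<open>C\<^sup>1\<close> field \<open>X\<close>, moving the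
  density by \<open>- div (\<rho> X)\<close> changes the moment of \<open>T\<close> at the rate
  \<open>- \<integral> T div (\<rho> X) = \<integral> \<rho> \<langle>grad T, X\<rangle>\<close>, because \<open>M\<close> is closed (\<open>moments_deriv_neg_divergence\<close>). With
  \<open>X = grad f\<close> this is the rate along \<open>K_W\<close>, and with \<open>X = w\<close>, where \<open>w = I\<^sup>* grad f\<close>, it is the rate
  along \<open>K_S\<close>. Since \<open>M_op\<close> sends \<open>grad f\<close> to the horizontal projection of \<open>w\<close>, and \<open>grad T\<close> is itself
  horizontal, \<open>w\<close> may be replaced by \<open>M_op (grad f)\<close> in the inner product with \<open>grad T\<close>. Both
  equivalences are then comparisons of vectors coordinate by coordinate.

  The work lies in justifying the three operations of this computation.

  \<^item> The integration by parts. In a single chart it reduces to the fact that directional derivatives of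
    compactly supported functions on \<open>R\<^sup>n\<close> integrate to zero, which follows from translation invariance
    of Lebesgue measure. A partition of unity (of class \<open>C\<^sup>1\<close>, which suffices) makes it global. The
    divergence is defined at each point by an arbitrarily chosen chart; that the choice does not
    matter follows from the local integration by parts itself, tested against bump functions, without
    differentiating Jacobian determinants (\<open>divc_independent\<close>).

  \<^item> The existence of \<open>I\<^sup>* grad f\<close>, as an element of the Hilbert space \<open>H\<close> and therefore of class \<open>C\<^sup>1\<close>.
    Continuity of the inclusion of \<open>H\<close> in \<open>C\<^sup>1\<close> bounds the functional \<open>h \<mapsto> \<integral> \<rho> \<langle>grad f, h\<rangle>\<close>, and the Riesz
    representation theorem applies.

  \<^item> The existence of the horizontal projection, as a field of tangent vectors defined at every point.
    The functional \<open>h \<mapsto> \<integral> \<rho> \<langle>w, h\<rangle>\<close> is nearly represented by smooth gradients, and these converge almost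
    everywhere, and in \<open>L\<^sup>2\<close>, by an argument of Riesz--Fischer type.

  The last two items share one lemma on semi-inner product spaces (\<open>approximate_riesz_sequence\<close>): a
  bounded functional is represented up to an error \<open>(1/2)\<^sup>n\<close> by elements \<open>s n\<close>, and such a sequence is
  automatically a rapid Cauchy sequence. Only the reason why it converges differs: completeness of
  \<open>H\<close> in one case, \<open>riesz_fischer\<close> in the other.
\<close>

section \<open>Continuously differentiable maps between Euclidean spaces\<close>

lemma C1_on_iff:
  "Ck_on 1 S f \<longleftrightarrow> (\<forall>x\<in>S. f differentiable (at x)) \<and>
     (\<forall>v. continuous_on S (\<lambda>x. frechet_derivative f (at x) v))"
  by simp

lemma C1_onI:
  assumes "\<And>x. x \<in> S \<Longrightarrow> (f has_derivative f' x) (at x)"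
    and "\<And>v. continuous_on S (\<lambda>x. f' x v)"
  shows "Ck_on 1 S f"
proof -
  have eq: "frechet_derivative f (at x) = f' x" if "x \<in> S" for x
    using frechet_derivative_at[OF assms(1)[OF that]] by simp
  have "continuous_on S (\<lambda>x. frechet_derivative f (at x) v)" for v
    using assms(2)[of v] by (rule continuous_on_eq) (simp add: eq)
  then show ?thesis
    using assms(1) unfolding C1_on_iff differentiable_def by blast
qed

lemma C1_on_has_derivative:
  assumes "Ck_on 1 S f" "x \<in> S"
  shows "(f has_derivative frechet_derivative f (at x)) (at x)"
  using assms by (simp add: frechet_derivative_works[symmetric])

lemma C1_on_continuous_deriv:
  "Ck_on 1 S f \<Longrightarrow> continuous_on S (\<lambda>x. frechet_derivative f (at x) v)"
  by simp

lemma C1_on_imp_continuous_on: "Ck_on 1 S f \<Longrightarrow> continuous_on S f"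
  unfolding C1_on_iff
  by (meson continuous_at_imp_continuous_on differentiable_imp_continuous_within)

text \<open>Continuity of the derivative is required for one fixed direction at a time; expanding a moving
  direction in the standard basis gives joint continuity.\<close>

lemma C1_on_continuous_deriv2:
  fixes f :: "'a::euclidean_space \<Rightarrow> 'b::real_normed_vector"
  assumes f: "Ck_on 1 T f" and g: "continuous_on S g" "g ` S \<subseteq> T" and w: "continuous_on S w"
  shows "continuous_on S (\<lambda>x. frechet_derivative f (at (g x)) (w x))"
proof -
  have "frechet_derivative f (at (g x)) (w x) =
      (\<Sum>b\<in>Basis. (w x \<bullet> b) *\<^sub>R frechet_derivative f (at (g x)) b)" if "x \<in> S" for x
  proof -
    have l: "linear (frechet_derivative f (at (g x)))"
      using f g(2) that by (intro linear_frechet_derivative) auto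
    have "frechet_derivative f (at (g x)) (\<Sum>b\<in>Basis. (w x \<bullet> b) *\<^sub>R b) =
        (\<Sum>b\<in>Basis. (w x \<bullet> b) *\<^sub>R frechet_derivative f (at (g x)) b)"
      by (simp add: linear_sum[OF l] linear_scale[OF l] o_def)
    then show ?thesis by (simp add: euclidean_representation)
  qed
  moreover have "continuous_on S (\<lambda>x. \<Sum>b\<in>Basis. (w x \<bullet> b) *\<^sub>R frechet_derivative f (at (g x)) b)"
    using C1_on_continuous_deriv[OF f] g w
    by (intro continuous_intros continuous_on_compose2[OF _ g(1)])
  ultimately show ?thesis by (simp cong: continuous_on_cong)
qed

lemma C1_on_compose:
  fixes g :: "'a::euclidean_space \<Rightarrow> 'c::euclidean_space"
  assumes f: "Ck_on 1 T f" and g: "Ck_on 1 S g" "g ` S \<subseteq> T"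
  shows "Ck_on 1 S (f \<circ> g)"
proof (rule C1_onI)
  fix x assume "x \<in> S"
  then show "(f \<circ> g has_derivative
      frechet_derivative f (at (g x)) \<circ> frechet_derivative g (at x)) (at x)"
    using C1_on_has_derivative[OF f, of "g x"] C1_on_has_derivative[OF g(1)] g(2)
    by (intro diff_chain_at) auto
next
  fix v
  show "continuous_on S (\<lambda>x. (frechet_derivative f (at (g x)) \<circ> frechet_derivative g (at x)) v)"
    unfolding o_def
    by (intro C1_on_continuous_deriv2[OF f] C1_on_imp_continuous_on g C1_on_continuous_deriv)
qed

lemma Ck_on_cong:
  assumes "open S"
  shows "(\<And>x. x \<in> S \<Longrightarrow> f x = g x) \<Longrightarrow> Ck_on k S f \<Longrightarrow> Ck_on k S g"
proof (induction k arbitrary: f g)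
  case 0
  then show ?case using continuous_on_eq by auto
next
  case (Suc k)
  have d: "(g has_derivative frechet_derivative f (at x)) (at x)" if "x \<in> S" for x
    by (rule has_derivative_transform_within_open[of f])
      (use that Suc.prems assms in \<open>auto simp: frechet_derivative_works[symmetric]\<close>)
  have "frechet_derivative f (at x) v = frechet_derivative g (at x) v" if "x \<in> S" for x v
    using frechet_derivative_at[OF d[OF that]] by simp
  then show ?case
    using Suc.IH[of "\<lambda>x. frechet_derivative f (at x) v" "\<lambda>x. frechet_derivative g (at x) v" for v]
      Suc.prems(2) d by (simp add: differentiable_def) blast
qed

lemma C1_on_Un:
  "open S \<Longrightarrow> open T \<Longrightarrow> Ck_on 1 S f \<Longrightarrow> Ck_on 1 T f \<Longrightarrow> Ck_on 1 (S \<union> T) f"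
  unfolding C1_on_iff by (auto intro!: continuous_on_open_Un)

lemma C1_on_linear:
  fixes f :: "'a::euclidean_space \<Rightarrow> 'b::real_normed_vector"
  shows "bounded_linear f \<Longrightarrow> Ck_on 1 S f"
  by (rule C1_onI) (auto intro: bounded_linear_imp_has_derivative)

lemma C1_on_const: "Ck_on 1 S (\<lambda>x. c)"
  by (rule C1_onI[where f' = "\<lambda>_ _. 0"]) auto

lemma C1_on_mult:
  fixes f g :: "'a::euclidean_space \<Rightarrow> real"
  assumes "Ck_on 1 S f" "Ck_on 1 S g"
  shows "Ck_on 1 S (\<lambda>x. f x * g x)"
proof (rule C1_onI)
  show "((\<lambda>x. f x * g x) has_derivative (\<lambda>v. f x * frechet_derivative g (at x) v +
      frechet_derivative f (at x) v * g x)) (at x)" if "x \<in> S" for x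
    using assms[THEN C1_on_has_derivative, OF that] by (rule has_derivative_mult)
qed (intro continuous_intros C1_on_imp_continuous_on C1_on_continuous_deriv assms)

lemma C1_on_sum:
  assumes "\<And>i. i \<in> I \<Longrightarrow> Ck_on 1 S (f i)"
  shows "Ck_on 1 S (\<lambda>x. \<Sum>i\<in>I. f i x)"
  by (rule C1_onI, rule has_derivative_sum[OF assms[THEN C1_on_has_derivative]])
    (use assms in \<open>auto intro!: continuous_intros\<close>)

lemma C1_on_prod:
  fixes f :: "'i \<Rightarrow> 'a::euclidean_space \<Rightarrow> real"
  shows "(\<And>i. i \<in> I \<Longrightarrow> Ck_on 1 S (f i)) \<Longrightarrow> Ck_on 1 S (\<lambda>x. \<Prod>i\<in>I. f i x)"
  by (induction I rule: infinite_finite_induct)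
    (simp_all add: C1_on_const C1_on_mult del: Ck_on.simps One_nat_def)

lemma C1_on_real_compose:
  fixes f :: "'a::euclidean_space \<Rightarrow> real"
  assumes f: "Ck_on 1 S f" and h: "\<And>x. x \<in> S \<Longrightarrow> (h has_real_derivative h' (f x)) (at (f x))"
    and c: "continuous_on (f ` S) h'"
  shows "Ck_on 1 S (\<lambda>x. h (f x))"
proof (rule C1_onI)
  show "((\<lambda>x. h (f x)) has_derivative (\<lambda>v. h' (f x) * frechet_derivative f (at x) v)) (at x)"
    if "x \<in> S" for x
    using h[OF that] C1_on_has_derivative[OF f that] unfolding has_field_derivative_def
    by (rule has_derivative_compose[rotated, unfolded o_def])
  show "continuous_on S (\<lambda>x. h' (f x) * frechet_derivative f (at x) v)" for v
    by (intro continuous_on_mult C1_on_continuous_deriv[OF f]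
        continuous_on_compose2[OF c C1_on_imp_continuous_on[OF f]]) auto
qed

lemma C1_on_inverse:
  fixes f :: "'a::euclidean_space \<Rightarrow> real"
  assumes "Ck_on 1 S f" "\<And>x. x \<in> S \<Longrightarrow> f x \<noteq> 0"
  shows "Ck_on 1 S (\<lambda>x. inverse (f x))"
  by (rule C1_on_real_compose[OF assms(1), where h' = "\<lambda>y. - (inverse y * inverse y)"])
    (use assms(2) in \<open>auto intro!: derivative_eq_intros continuous_intros\<close>)

lemma C1_on_divide:
  fixes f g :: "'a::euclidean_space \<Rightarrow> real"
  assumes "Ck_on 1 S f" "Ck_on 1 S g" "\<And>x. x \<in> S \<Longrightarrow> g x \<noteq> 0"
  shows "Ck_on 1 S (\<lambda>x. f x / g x)"
  unfolding divide_inverse by (intro C1_on_mult C1_on_inverse assms)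

lemma C1_on_sqrt:
  fixes f :: "'a::euclidean_space \<Rightarrow> real"
  assumes "Ck_on 1 S f" "\<And>x. x \<in> S \<Longrightarrow> f x > 0"
  shows "Ck_on 1 S (\<lambda>x. sqrt (f x))"
  by (rule C1_on_real_compose[OF assms(1), where h' = "\<lambda>y. inverse (sqrt y) / 2"])
    (use assms(2) in \<open>fastforce intro!: DERIV_real_sqrt continuous_intros\<close>)+

lemma C1_on_component:
  fixes f :: "'a::euclidean_space \<Rightarrow> real^'n"
  assumes "Ck_on 1 S f"
  shows "Ck_on 1 S (\<lambda>x. f x $ i)"
  using C1_on_compose[OF C1_on_linear[OF bounded_linear_vec_nth] assms, of UNIV i]
  by (simp add: o_def del: Ck_on.simps)

lemma C1_on_vec:
  fixes f :: "'a::euclidean_space \<Rightarrow> real^'n"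
  assumes "\<And>i. Ck_on 1 S (\<lambda>x. f x $ i)"
  shows "Ck_on 1 S f"
proof (rule C1_onI)
  show "(f has_derivative (\<lambda>v. \<chi> i. frechet_derivative (\<lambda>x. f x $ i) (at x) v)) (at x)"
    if "x \<in> S" for x
    unfolding has_derivative_componentwise_within[of f]
    using C1_on_has_derivative[OF assms that]
    by (auto simp: Basis_vec_def inner_axis)
  show "continuous_on S (\<lambda>x. \<chi> i. frechet_derivative (\<lambda>x. f x $ i) (at x) v)" for v
    by (intro continuous_on_vec_lambda C1_on_continuous_deriv assms)
qed

lemma C1_on_det:
  fixes G :: "'a::euclidean_space \<Rightarrow> real^'n^'n"
  assumes "\<And>i j. Ck_on 1 S (\<lambda>x. G x $ i $ j)"
  shows "Ck_on 1 S (\<lambda>x. det (G x))"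
  unfolding det_def by (intro C1_on_sum C1_on_mult C1_on_prod C1_on_const assms)

lemma smooth_on_imp_C1_on: "smooth_on S f \<Longrightarrow> Ck_on 1 S f"
  unfolding smooth_on_def by blast

lemma smooth_on_deriv_C1_on:
  assumes "smooth_on S f"
  shows "Ck_on 1 S (\<lambda>x. frechet_derivative f (at x) v)"
proof -
  have "Ck_on (Suc 1) S f" using assms unfolding smooth_on_def by blast
  then show ?thesis unfolding Ck_on.simps(2)[of 1] by blast
qed

lemma smooth_on_add_scale:
  fixes f g :: "'a::euclidean_space \<Rightarrow> real"
  assumes "open S" "smooth_on S f" "smooth_on S g"
  shows "smooth_on S (\<lambda>x. f x + a * g x)"
proof -
  have "Ck_on k S f \<Longrightarrow> Ck_on k S g \<Longrightarrow> Ck_on k S (\<lambda>x. f x + a * g x)" for k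
  proof (induction k arbitrary: f g)
    case 0
    then show ?case by (auto intro!: continuous_intros)
  next
    case (Suc k)
    have d: "((\<lambda>x. f x + a * g x) has_derivative
        (\<lambda>v. frechet_derivative f (at x) v + a * frechet_derivative g (at x) v)) (at x)"
      if "x \<in> S" for x
      using Suc.prems that by (auto intro!: derivative_intros simp: frechet_derivative_works[symmetric])
    have "Ck_on k S (\<lambda>x. frechet_derivative (\<lambda>x. f x + a * g x) (at x) v)" for v
    proof (rule Ck_on_cong[OF assms(1)])
      show "Ck_on k S (\<lambda>x. frechet_derivative f (at x) v + a * frechet_derivative g (at x) v)"
        using Suc by simp
    qed (simp add: frechet_derivative_at[OF d, symmetric])
    then show ?case using d by (auto simp: differentiable_def)
  qed
  then show ?thesis using assms unfolding smooth_on_def by blast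
qed

lemma C1_extend_by_zero:
  fixes F :: "'a::euclidean_space \<Rightarrow> real"
  assumes "open U" "compact S" "S \<subseteq> U" "Ck_on 1 U F" "\<And>x. x \<notin> S \<Longrightarrow> F x = 0"
  shows "Ck_on 1 UNIV F"
proof -
  have o: "open (- S)" using assms(2) by (simp add: compact_imp_closed open_Compl)
  have "Ck_on 1 (U \<union> - S) F"
    by (intro C1_on_Un assms o Ck_on_cong[OF o _ C1_on_const[of _ "0::real"]]) (use assms in auto)
  moreover have "U \<union> - S = UNIV" using assms by auto
  ultimately show ?thesis by simp
qed

lemma integrable_compact_support:
  fixes F :: "'a::euclidean_space \<Rightarrow> real"
  assumes "continuous_on S F" "compact S" "\<And>x. x \<notin> S \<Longrightarrow> F x = 0"
  shows "integrable lborel F"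
proof -
  have "integrable lborel (\<lambda>x. indicator S x *\<^sub>R F x)"
    using borel_integrable_compact[OF assms(2,1)] .
  then show ?thesis
    by (rule Bochner_Integration.integrable_cong[THEN iffD1, rotated -1]) (use assms(3) in \<open>auto simp: indicator_def\<close>)
qed

text \<open>Translation invariance of Lebesgue measure makes the integrals of the difference quotients
  vanish; these converge boundedly, on a fixed ball, to the directional derivative.\<close>

lemma integral_deriv_compact_support:
  fixes F :: "'a::euclidean_space \<Rightarrow> real"
  assumes F: "Ck_on 1 UNIV F" and S: "compact S" and zero: "\<And>x. x \<notin> S \<Longrightarrow> F x = 0"
  shows "(\<integral>x. frechet_derivative F (at x) v \<partial>lborel) = 0"
proof -
  define D where "D x = frechet_derivative F (at x) v" for x
  define h where "h n = 1 / real (Suc n)" for n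
  define q where "q n x = (F (x + h n *\<^sub>R v) - F x) / h n" for n x
  have hpos: "0 < h n" "h n \<le> 1" for n by (simp_all add: h_def)
  have h0: "h \<longlonglongrightarrow> 0" unfolding h_def by (rule lim_1_over_n[THEN LIMSEQ_Suc])
  have contF: "continuous_on UNIV F" by (rule C1_on_imp_continuous_on[OF F])
  have contD: "continuous_on UNIV D" unfolding D_def by (rule C1_on_continuous_deriv[OF F])
  have line: "((\<lambda>t. F (x + t *\<^sub>R v)) has_real_derivative D (x + t *\<^sub>R v)) (at t)" for x t
  proof -
    have l: "linear (frechet_derivative F (at (x + t *\<^sub>R v)))"
      using F by (intro linear_frechet_derivative) auto
    have "((\<lambda>t. F (x + t *\<^sub>R v)) has_derivative
        (\<lambda>s. frechet_derivative F (at (x + t *\<^sub>R v)) (s *\<^sub>R v))) (at t)"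
      by (rule has_derivative_compose[OF _ C1_on_has_derivative[OF F UNIV_I], unfolded o_def])
        (auto intro!: derivative_eq_intros)
    then show ?thesis
      by (simp add: has_field_derivative_def linear_scale[OF l] D_def mult.commute[of _ "frechet_derivative _ _ _"])
  qed
  obtain R where R: "\<And>x. x \<in> S \<Longrightarrow> norm x \<le> R"
    using compact_imp_bounded[OF S] unfolding bounded_iff by blast
  define K where "K = cball (0::'a) (R + norm v)"
  have "bounded (D ` cball 0 (R + 2 * norm v))"
    by (intro compact_imp_bounded compact_continuous_image) (auto intro: continuous_on_subset[OF contD])
  then obtain B where B: "\<And>x. norm x \<le> R + 2 * norm v \<Longrightarrow> \<bar>D x\<bar> \<le> B"
    unfolding bounded_iff by fastforce
  \<comment> \<open>The points \<open>x\<close> and \<open>x + h n v\<close> are at distance at most \<open>norm v\<close>, so that for \<open>x\<close> outside \<open>K\<close> both lie off the support.\<close>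
  have bound: "\<bar>q n x\<bar> \<le> indicator K x * B" for n x
  proof (cases "x \<in> K")
    case True
    have "\<exists>z. 0 < z \<and> z < h n \<and> F (x + h n *\<^sub>R v) - F (x + 0 *\<^sub>R v) = (h n - 0) * D (x + z *\<^sub>R v)"
      by (rule MVT2) (use hpos line in auto)
    then obtain z where z: "0 < z" "z < h n" and eq: "q n x = D (x + z *\<^sub>R v)"
      using hpos(1)[of n] by (auto simp: q_def field_simps)
    have "norm (x + z *\<^sub>R v) \<le> norm x + z * norm v"
      using z by (metis abs_of_pos norm_scaleR norm_triangle_ineq)
    also have "\<dots> \<le> norm x + 1 * norm v"
      using z hpos(2)[of n] by (intro add_mono mult_right_mono) auto
    finally show ?thesis using True B[of "x + z *\<^sub>R v"] eq by (simp add: K_def)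
  next
    case False
    have "norm x \<le> norm (x + h n *\<^sub>R v) + norm (h n *\<^sub>R v)"
      by (metis add.commute add_diff_cancel_left' norm_triangle_sub diff_add_cancel norm_minus_commute)
    also have "norm (h n *\<^sub>R v) \<le> 1 * norm v"
      using hpos[of n] by (simp add: mult_left_le_one_le)
    finally have "x + h n *\<^sub>R v \<notin> S" using False R[of "x + h n *\<^sub>R v"] by (auto simp: K_def)
    moreover have "x \<notin> S" using False R[of x] norm_ge_zero[of v] unfolding K_def by fastforce
    ultimately show ?thesis using False zero by (simp add: q_def)
  qed
  have intF: "integrable lborel F"
    by (rule integrable_compact_support[OF _ S zero]) (use contF continuous_on_subset in blast)+
  have [measurable]: "F \<in> borel_measurable borel" "D \<in> borel_measurable borel"
    using contF contD by (simp_all add: borel_measurable_continuous_onI)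
  have int0: "(\<integral>x. q n x \<partial>lborel) = 0" for n
  proof -
    have tr: "distr lborel borel (\<lambda>x. x + h n *\<^sub>R v) = lborel"
      using lborel_distr_plus[of "h n *\<^sub>R v"] by (subst add.commute) simp
    have "(\<integral>x. F (x + h n *\<^sub>R v) \<partial>lborel) = (\<integral>x. F x \<partial>distr lborel borel (\<lambda>x. x + h n *\<^sub>R v))"
      by (rule integral_distr[symmetric]) auto
    then have eq: "(\<integral>x. F (x + h n *\<^sub>R v) \<partial>lborel) = (\<integral>x. F x \<partial>lborel)" unfolding tr .
    have "integrable (distr lborel borel (\<lambda>x. x + h n *\<^sub>R v)) F" using intF unfolding tr .
    then have "integrable lborel (\<lambda>x. F (x + h n *\<^sub>R v))"
      by (subst (asm) integrable_distr_eq) auto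
    then show ?thesis unfolding q_def using intF eq by simp
  qed
  have lim: "(\<lambda>n. q n x) \<longlonglongrightarrow> D x" for x
  proof -
    have "((\<lambda>t. (F (x + t *\<^sub>R v) - F x) / t) \<longlongrightarrow> D x) (at 0)"
      using line[of x 0] by (simp add: has_field_derivative_iff)
    moreover have "filterlim h (at 0) sequentially"
      using h0 hpos(1) by (auto simp: filterlim_at less_imp_neq[symmetric])
    ultimately show ?thesis unfolding q_def by (rule filterlim_compose)
  qed
  have "(\<lambda>n. \<integral>x. q n x \<partial>lborel) \<longlonglongrightarrow> (\<integral>x. D x \<partial>lborel)"
  proof (rule integral_dominated_convergence)
    show "integrable lborel (\<lambda>x. indicator K x * B)"
      using borel_integrable_compact[of K "\<lambda>_. B"] by (simp add: K_def)
    show "AE x in lborel. norm (q n x) \<le> indicator K x * B" for n using bound by simp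
    show "q n \<in> borel_measurable lborel" for n unfolding q_def by simp
  qed (use lim in auto)
  then have "(\<lambda>n. 0) \<longlonglongrightarrow> (\<integral>x. D x \<partial>lborel)" by (simp add: int0)
  then show ?thesis unfolding D_def by (simp add: LIMSEQ_const_iff)
qed

section \<open>Charts, tangent vectors and the volume\<close>

locale closed_riemannian_manifold =
  fixes A :: "('m::{t2_space,second_countable_topology}, 'n::finite) chart set"
    and g :: "('m, 'n) metric"
    and vol :: "'m measure"
  assumes mfd: "closed_oriented_manifold A"
    and metric: "riemannian_metric A g"
    and volume: "riemannian_volume A g vol"
begin

lemma atlas: "oriented_atlas A" and compact_UNIV: "compact (UNIV::'m set)"
  using mfd by (simp_all add: closed_oriented_manifold_def)

lemma chart_homeo:
  assumes "c \<in> A"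
  shows "homeomorphism (cdom c) (cimg c) (coord c) (cinv c)"
    and open_cdom: "open (cdom c)" and open_cimg: "open (cimg c)"
  using atlas assms by (auto simp: oriented_atlas_def is_chart_def)

lemma cinv_coord: "c \<in> A \<Longrightarrow> p \<in> cdom c \<Longrightarrow> cinv c (coord c p) = p"
  and coord_cinv: "c \<in> A \<Longrightarrow> x \<in> cimg c \<Longrightarrow> coord c (cinv c x) = x"
  and cinv_in: "c \<in> A \<Longrightarrow> x \<in> cimg c \<Longrightarrow> cinv c x \<in> cdom c"
  and cont_coord: "c \<in> A \<Longrightarrow> continuous_on (cdom c) (coord c)"
  and cont_cinv: "c \<in> A \<Longrightarrow> continuous_on (cimg c) (cinv c)"
  using chart_homeo[of c] by (auto simp: homeomorphism_def)

lemma chart_ex: "\<exists>c\<in>A. p \<in> cdom c"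
  using atlas by (auto simp: oriented_atlas_def)

lemma chart_at: "chart_at A p \<in> A" "p \<in> cdom (chart_at A p)"
proof -
  have "\<exists>c. c \<in> A \<and> p \<in> cdom c" using chart_ex by blast
  from someI_ex[OF this] show "chart_at A p \<in> A" "p \<in> cdom (chart_at A p)"
    unfolding chart_at_def by blast+
qed

lemma cimg_overlap:
  "c \<in> A \<Longrightarrow> coord c ` (cdom c \<inter> S) = cimg c \<inter> cinv c -` S"
  by (auto simp: cinv_coord cinv_in coord_cinv image_iff)

lemma open_coord_image: "c \<in> A \<Longrightarrow> open S \<Longrightarrow> open (coord c ` (cdom c \<inter> S))"
  unfolding cimg_overlap using continuous_open_preimage[OF cont_cinv open_cimg] by blast

lemma open_coord_preimage: "c \<in> A \<Longrightarrow> open U \<Longrightarrow> open (cdom c \<inter> coord c -` U)"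
  using continuous_open_preimage[OF cont_coord open_cdom] by blast

lemma cinv_image: "c \<in> A \<Longrightarrow> U \<subseteq> cimg c \<Longrightarrow> cinv c ` U = cdom c \<inter> coord c -` U"
  by (auto simp: cinv_in coord_cinv subset_iff) (metis cinv_coord image_eqI)

lemma coord_cinv_image: "c \<in> A \<Longrightarrow> U \<subseteq> cimg c \<Longrightarrow> coord c ` cinv c ` U = U"
  by (force simp: coord_cinv image_iff subset_iff)

lemma transition_C1:
  assumes "c \<in> A" "d \<in> A"
  shows "Ck_on 1 (coord c ` (cdom c \<inter> cdom d)) (coord d \<circ> cinv c)"
proof (rule smooth_on_imp_C1_on)
  show "smooth_on (coord c ` (cdom c \<inter> cdom d)) (coord d \<circ> cinv c)"
    using atlas assms unfolding oriented_atlas_def by blast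
qed

definition jac :: "('m, 'n) chart \<Rightarrow> ('m, 'n) chart \<Rightarrow> 'm \<Rightarrow> real^'n \<Rightarrow> real^'n" where
  "jac c d p = frechet_derivative (coord d \<circ> cinv c) (at (coord c p))"

lemma transition_has_derivative:
  assumes "c \<in> A" "d \<in> A" "p \<in> cdom c" "p \<in> cdom d"
  shows "(coord d \<circ> cinv c has_derivative jac c d p) (at (coord c p))"
  unfolding jac_def by (rule C1_on_has_derivative[OF transition_C1]) (use assms in auto)

lemma linear_jac:
  "c \<in> A \<Longrightarrow> d \<in> A \<Longrightarrow> p \<in> cdom c \<Longrightarrow> p \<in> cdom d \<Longrightarrow> linear (jac c d p)"
  using transition_has_derivative has_derivative_linear by blast

text \<open>The one place where the chain rule meets the atlas: the cocycle rule for the Jacobians and the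
  chart independence of differentials are the instances \<open>f = coord e\<close> and \<open>f\<close> real-valued.\<close>

lemma change_chart_has_derivative:
  assumes "c \<in> A" "d \<in> A" "p \<in> cdom c" "p \<in> cdom d"
    and "(f \<circ> cinv d has_derivative D) (at (coord d p))"
  shows "(f \<circ> cinv c has_derivative D \<circ> jac c d p) (at (coord c p))"
proof (rule has_derivative_transform_within_open)
  have "coord d p = (coord d \<circ> cinv c) (coord c p)" by (simp add: assms cinv_coord)
  then show "((f \<circ> cinv d) \<circ> (coord d \<circ> cinv c) has_derivative D \<circ> jac c d p) (at (coord c p))"
    using assms by (intro diff_chain_at transition_has_derivative) auto
  show "open (coord c ` (cdom c \<inter> cdom d))" by (simp add: assms open_coord_image open_cdom)
qed (use assms in \<open>auto simp: cinv_coord\<close>)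

lemma jac_cocycle:
  assumes "c \<in> A" "d \<in> A" "e \<in> A" "p \<in> cdom c" "p \<in> cdom d" "p \<in> cdom e"
  shows "jac d e p (jac c d p w) = jac c e p w"
proof -
  have "(coord e \<circ> cinv c has_derivative jac d e p \<circ> jac c d p) (at (coord c p))"
    using assms by (intro change_chart_has_derivative transition_has_derivative)
  from frechet_derivative_at[OF this] show ?thesis unfolding jac_def[of c e] by (metis o_apply)
qed

lemma jac_self:
  assumes "c \<in> A" "p \<in> cdom c"
  shows "jac c c p w = w"
proof -
  have "(coord c \<circ> cinv c has_derivative (\<lambda>x. x)) (at (coord c p))"
    by (rule has_derivative_transform_within_open[OF has_derivative_ident open_cimg[OF assms(1)]])
      (use assms in \<open>auto simp: coord_cinv cinv_coord\<close>)
  from frechet_derivative_at[OF this] show ?thesis unfolding jac_def by metis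
qed

lemma tangent_of_eq:
  "tangent_of A c p w = (\<lambda>d. if d \<in> A \<and> p \<in> cdom d then jac c d p w else 0)"
  unfolding tangent_of_def jac_def ..

lemma tangent_of_in:
  "c \<in> A \<Longrightarrow> p \<in> cdom c \<Longrightarrow> tangent_of A c p w \<in> tangent_space A p"
  by (auto simp: tangent_space_def tangent_of_eq jac_cocycle jac_def[symmetric])

lemma tangent_of_self: "c \<in> A \<Longrightarrow> p \<in> cdom c \<Longrightarrow> tangent_of A c p w c = w"
  by (simp add: tangent_of_eq jac_self)

lemma tangent_jac:
  "v \<in> tangent_space A p \<Longrightarrow> c \<in> A \<Longrightarrow> d \<in> A \<Longrightarrow> p \<in> cdom c \<Longrightarrow> p \<in> cdom d \<Longrightarrow>
    v d = jac c d p (v c)"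
  unfolding tangent_space_def jac_def by blast

lemma tangent_repr:
  assumes "v \<in> tangent_space A p" "c \<in> A" "p \<in> cdom c"
  shows "tangent_of A c p (v c) = v"
proof
  fix d
  show "tangent_of A c p (v c) d = v d"
  proof (cases "d \<in> A \<and> p \<in> cdom d")
    case True
    then show ?thesis
      using tangent_jac[OF assms(1,2) _ assms(3), of d] by (simp add: tangent_of_eq)
  next
    case False
    then have "v d = 0" using assms(1) unfolding tangent_space_def by blast
    then show ?thesis using False by (auto simp: tangent_of_eq)
  qed
qed

lemma tangent_outside: "v \<in> tangent_space A p \<Longrightarrow> \<not> (c \<in> A \<and> p \<in> cdom c) \<Longrightarrow> v c = 0"
  unfolding tangent_space_def by blast

lemma tangent_spaceI:
  assumes "\<And>c. \<not> (c \<in> A \<and> p \<in> cdom c) \<Longrightarrow> v c = 0"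
    and "\<And>c d. c \<in> A \<Longrightarrow> d \<in> A \<Longrightarrow> p \<in> cdom c \<Longrightarrow> p \<in> cdom d \<Longrightarrow> v d = jac c d p (v c)"
  shows "v \<in> tangent_space A p"
  using assms unfolding tangent_space_def jac_def by blast

lemma tangent_zero: "(\<lambda>c. 0) \<in> tangent_space A p"
  by (rule tangent_spaceI) (simp_all add: linear_0[OF linear_jac])

lemma tangent_add:
  assumes u: "u \<in> tangent_space A p" and v: "v \<in> tangent_space A p"
  shows "(\<lambda>c. u c + v c) \<in> tangent_space A p"
proof (rule tangent_spaceI)
  show "u c + v c = 0" if "\<not> (c \<in> A \<and> p \<in> cdom c)" for c
    using tangent_outside[OF u that] tangent_outside[OF v that] by simp
  show "u d + v d = jac c d p (u c + v c)"
    if "c \<in> A" "d \<in> A" "p \<in> cdom c" "p \<in> cdom d" for c d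
    unfolding linear_add[OF linear_jac[OF that]] tangent_jac[OF u that] tangent_jac[OF v that] ..
qed

lemma tangent_scale:
  assumes u: "u \<in> tangent_space A p"
  shows "(\<lambda>c. a *\<^sub>R u c) \<in> tangent_space A p"
proof (rule tangent_spaceI)
  show "a *\<^sub>R u c = 0" if "\<not> (c \<in> A \<and> p \<in> cdom c)" for c
    using tangent_outside[OF u that] by simp
  show "a *\<^sub>R u d = jac c d p (a *\<^sub>R u c)"
    if "c \<in> A" "d \<in> A" "p \<in> cdom c" "p \<in> cdom d" for c d
    unfolding linear_scale[OF linear_jac[OF that]] tangent_jac[OF u that] ..
qed

lemma tangent_of_add:
  "c \<in> A \<Longrightarrow> p \<in> cdom c \<Longrightarrow>
    tangent_of A c p (v + w) = (\<lambda>d. tangent_of A c p v d + tangent_of A c p w d)"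
  by (auto simp: tangent_of_eq linear_add[OF linear_jac])

lemma tangent_of_scale:
  "c \<in> A \<Longrightarrow> p \<in> cdom c \<Longrightarrow> tangent_of A c p (a *\<^sub>R v) = (\<lambda>d. a *\<^sub>R tangent_of A c p v d)"
  by (auto simp: tangent_of_eq linear_scale[OF linear_jac])

subsection \<open>The metric in coordinates\<close>

lemma
  assumes "u \<in> tangent_space A p" "v \<in> tangent_space A p"
  shows g_sym: "g p u v = g p v u"
    and g_add: "w \<in> tangent_space A p \<Longrightarrow> g p (\<lambda>c. u c + v c) w = g p u w + g p v w"
    and g_scale: "g p (\<lambda>c. a *\<^sub>R u c) v = a * g p u v"
  using metric assms unfolding riemannian_metric_def by blast+

lemma g_pos: "u \<in> tangent_space A p \<Longrightarrow> u \<noteq> (\<lambda>c. 0) \<Longrightarrow> g p u u > 0"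
  using metric unfolding riemannian_metric_def by blast

lemma g_nonneg: "u \<in> tangent_space A p \<Longrightarrow> g p u u \<ge> 0"
proof (cases "u = (\<lambda>c. 0)")
  case True
  then show ?thesis using g_scale[OF tangent_zero tangent_zero, of p 0] by simp
qed (use g_pos in \<open>auto intro: less_imp_le\<close>)

lemma linear_g_tangent_of:
  assumes "c \<in> A" "p \<in> cdom c" "v \<in> tangent_space A p"
  shows "linear (\<lambda>w. g p (tangent_of A c p w) v)"
  using assms by (intro linearI)
    (simp_all add: tangent_of_add tangent_of_scale g_add g_scale tangent_of_in)

lemma g_coord1:
  assumes "c \<in> A" "p \<in> cdom c" "u \<in> tangent_space A p" "v \<in> tangent_space A p"
  shows "g p u v = (\<Sum>i\<in>UNIV. u c $ i * g p (tangent_of A c p (axis i 1)) v)"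
proof -
  let ?L = "\<lambda>w. g p (tangent_of A c p w) v"
  have l: "linear ?L" by (rule linear_g_tangent_of[OF assms(1,2,4)])
  have "?L (u c) = ?L (\<Sum>i\<in>UNIV. (u c $ i) *\<^sub>R axis i 1)"
    using basis_expansion[of "u c"] by (simp add: scalar_mult_eq_scaleR)
  also have "\<dots> = (\<Sum>i\<in>UNIV. u c $ i * ?L (axis i 1))"
    by (simp add: linear_sum[OF l] linear_scale[OF l, unfolded real_scaleR_def])
  finally show ?thesis by (simp add: tangent_repr assms)
qed

lemma g_coord:
  assumes "c \<in> A" "p \<in> cdom c" "u \<in> tangent_space A p" "v \<in> tangent_space A p"
  shows "g p u v = u c \<bullet> (gram A g c p *v v c)"
proof -
  have *: "g p (tangent_of A c p (axis i 1)) v = (gram A g c p *v v c) $ i" for i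
    using g_sym[OF tangent_of_in[OF assms(1,2)] assms(4), of "axis i 1"]
      g_coord1[OF assms(1,2,4) tangent_of_in[OF assms(1,2)], of "axis i 1"]
      g_sym[OF tangent_of_in[OF assms(1,2)] tangent_of_in[OF assms(1,2)], of "axis i 1"]
    by (simp add: matrix_vector_mult_def gram_def mult.commute)
  show ?thesis unfolding g_coord1[OF assms] * by (simp add: inner_vec_def)
qed

lemma gram_pos:
  assumes "c \<in> A" "p \<in> cdom c" "w \<noteq> 0"
  shows "w \<bullet> (gram A g c p *v w) > 0"
proof -
  let ?u = "tangent_of A c p w"
  have "?u c \<noteq> 0" using assms by (simp add: tangent_of_self)
  then have "g p ?u ?u > 0" using assms tangent_of_in by (intro g_pos) auto
  then show ?thesis by (simp add: g_coord[OF assms(1,2)] assms tangent_of_in tangent_of_self)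
qed

lemma gram_sym: "c \<in> A \<Longrightarrow> p \<in> cdom c \<Longrightarrow> gram A g c p $ i $ j = gram A g c p $ j $ i"
  unfolding gram_def by (simp add: g_sym[OF tangent_of_in tangent_of_in])

text \<open>On the segment from the identity matrix to \<open>G\<close> all matrices are positive definite, hence invertible,
  so the determinant cannot change sign along it.\<close>

lemma det_pos_def_pos:
  fixes G :: "real^'k^'k"
  assumes "\<And>w. w \<noteq> 0 \<Longrightarrow> w \<bullet> (G *v w) > 0"
  shows "det G > 0"
proof (rule ccontr)
  assume "\<not> det G > 0"
  define P where "P t = (1 - t) *\<^sub>R mat 1 + t *\<^sub>R G" for t :: real
  have nz: "det (P t) \<noteq> 0" if "0 \<le> t" "t \<le> 1" for t
  proof
    assume "det (P t) = 0"
    then obtain w where w: "w \<noteq> 0" "P t *v w = 0"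
      using invertible_det_nz[of "P t"] invertible_left_inverse[of "P t"]
        matrix_left_invertible_ker[of "P t"] by auto
    have "P t *v w = (1 - t) *\<^sub>R w + t *\<^sub>R (G *v w)"
      unfolding P_def by (simp add: matrix_vector_mult_add_rdistrib scaleR_matrix_vector_assoc[symmetric])
    then have "w \<bullet> (P t *v w) = (1 - t) * (w \<bullet> w) + t * (w \<bullet> (G *v w))"
      by (simp add: inner_add_right)
    also have "\<dots> > 0"
    proof (cases "t = 0")
      case False
      then have "t * (w \<bullet> (G *v w)) > 0" using that assms[OF w(1)] by simp
      moreover have "(1 - t) * (w \<bullet> w) \<ge> 0" using that by simp
      ultimately show ?thesis by linarith
    qed (use w in simp)
    finally show False using w by simp
  qed
  have "continuous_on {0..1} (\<lambda>t. det (P t))"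
    unfolding det_def P_def by (auto intro!: continuous_intros)
  moreover have "det (P 1) \<le> 0" "0 \<le> det (P 0)" using \<open>\<not> det G > 0\<close> by (simp_all add: P_def)
  ultimately obtain t where "0 \<le> t" "t \<le> 1" "det (P t) = 0"
    using IVT2'[of "\<lambda>t. det (P t)" 1 0 0] by auto
  then show False using nz by blast
qed

lemma det_gram_pos: "c \<in> A \<Longrightarrow> p \<in> cdom c \<Longrightarrow> det (gram A g c p) > 0"
  using gram_pos by (intro det_pos_def_pos)

definition vdens :: "('m, 'n) chart \<Rightarrow> real^'n \<Rightarrow> real" where
  "vdens c x = sqrt (det (gram A g c (cinv c x)))"

lemma gram_C1: "c \<in> A \<Longrightarrow> Ck_on 1 (cimg c) (\<lambda>x. gram A g c (cinv c x) $ i $ j)"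
  using metric unfolding riemannian_metric_def by (blast intro: smooth_on_imp_C1_on)

lemma vdens_pos: "c \<in> A \<Longrightarrow> x \<in> cimg c \<Longrightarrow> vdens c x > 0"
  unfolding vdens_def using det_gram_pos cinv_in by simp

lemma vdens_C1: "c \<in> A \<Longrightarrow> Ck_on 1 (cimg c) (vdens c)"
  unfolding vdens_def[abs_def] using det_gram_pos cinv_in
  by (intro C1_on_sqrt C1_on_det gram_C1) auto

subsection \<open>Continuous functions and the volume\<close>

lemma continuous_cdomI:
  assumes "c \<in> A" "continuous_on (cimg c) (\<lambda>x. f (cinv c x))"
  shows "continuous_on (cdom c) f"
proof -
  have "continuous_on (cdom c) (\<lambda>p. f (cinv c (coord c p)))"
    by (rule continuous_on_compose2[OF assms(2) cont_coord[OF assms(1)]]) auto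
  then show ?thesis using assms(1) by (simp add: cinv_coord cong: continuous_on_cong)
qed

lemma continuous_mfdI:
  assumes "\<And>c. c \<in> A \<Longrightarrow> continuous_on (cimg c) (\<lambda>x. f (cinv c x))"
  shows "continuous_on UNIV f"
proof -
  have "continuous_on (cdom c) f" if "c \<in> A" for c
    using continuous_cdomI assms that by blast
  then have "continuous_on (\<Union>c\<in>A. cdom c) f"
    using open_cdom by (intro continuous_on_open_UN) auto
  moreover have "(\<Union>c\<in>A. cdom c) = UNIV" using chart_ex by blast
  ultimately show ?thesis by simp
qed

text \<open>A finite cover of the manifold by coordinate balls, from which come the finiteness of the volume, the
  uniform bound on the fields of the Hilbert space and the partition of unity. The closed balls are compact and stay in the charts; the open ones already
  cover.\<close>

lemma finite_ball_cover:
  obtains F :: "(('m, 'n) chart \<times> (real^'n) \<times> real) set"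
  where "finite F" "\<And>c a r. (c, a, r) \<in> F \<Longrightarrow> c \<in> A \<and> r > 0 \<and> cball a r \<subseteq> cimg c"
    "\<And>p. \<exists>(c, a, r)\<in>F. p \<in> cinv c ` ball a r"
proof -
  let ?G = "{(c, a, r). c \<in> A \<and> r > 0 \<and> cball a r \<subseteq> cimg c}"
  let ?N = "\<lambda>(c, a, r). cinv c ` ball a r"
  have op: "open (?N t)" if "t \<in> ?G" for t
  proof -
    obtain c a r where t: "t = (c, a, r)" by (cases t)
    then have *: "c \<in> A" "ball a r \<subseteq> cimg c" using that ball_subset_cball[of a r] by auto
    show ?thesis unfolding t by (simp add: cinv_image[OF *] open_coord_preimage *)
  qed
  have cov: "UNIV \<subseteq> (\<Union>t\<in>?G. ?N t)"
  proof
    fix p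
    obtain c where c: "c \<in> A" "p \<in> cdom c" using chart_ex by blast
    then obtain r where r: "r > 0" "cball (coord c p) r \<subseteq> cimg c"
      using open_cimg[OF c(1)] open_contains_cball by blast
    have "(c, coord c p, r) \<in> ?G" using c r by auto
    moreover have "p \<in> ?N (c, coord c p, r)"
      using c r by (auto simp: image_iff cinv_coord intro!: bexI[of _ "coord c p"])
    ultimately show "p \<in> (\<Union>t\<in>?G. ?N t)" by blast
  qed
  obtain F where "F \<subseteq> ?G" "finite F" "UNIV \<subseteq> (\<Union>t\<in>F. ?N t)"
    using compactE_image[OF compact_UNIV op cov] by blast
  then show ?thesis by (intro that[of F]) fastforce+
qed

lemma sets_vol [measurable_cong, simp]: "sets vol = sets borel"
  using volume by (simp add: riemannian_volume_def)

lemma space_vol [simp]: "space vol = UNIV"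
  using sets_eq_imp_space_eq[OF sets_vol] by simp

lemma emeasure_vol_chart:
  assumes "c \<in> A" "B \<in> sets borel" "B \<subseteq> cdom c"
  shows "emeasure vol B = (\<integral>\<^sup>+ x \<in> coord c ` B. ennreal (vdens c x) \<partial>lborel)"
  using volume assms by (auto simp: riemannian_volume_def vdens_def)

lemma measurable_continuous_mfd: "continuous_on UNIV f \<Longrightarrow> f \<in> borel_measurable vol"
  by (subst measurable_cong_sets[OF sets_vol refl]) (rule borel_measurable_continuous_onI)

lemma finite_measure_vol: "finite_measure vol"
proof (rule finite_measureI)
  obtain F where F: "finite F" "\<And>c a r. (c, a, r) \<in> F \<Longrightarrow> c \<in> A \<and> r > 0 \<and> cball a r \<subseteq> cimg c"
    "\<And>p. \<exists>(c, a, r)\<in>F. p \<in> cinv c ` ball a r" by (rule finite_ball_cover) blast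
  let ?K = "\<lambda>(c, a, r). cinv c ` cball a r"
  have fin: "?K t \<in> sets vol \<and> emeasure vol (?K t) < \<infinity>" if "t \<in> F" for t
  proof -
    obtain c a r where t: "t = (c, a, r)" by (cases t)
    have c: "c \<in> A" "cball a r \<subseteq> cimg c" using F(2) that t by auto
    have "compact (cinv c ` cball a r)"
      by (intro compact_continuous_image continuous_on_subset[OF cont_cinv] c compact_cball)
    then have s: "cinv c ` cball a r \<in> sets borel" by (simp add: compact_imp_closed borel_closed)
    have "bounded (vdens c ` cball a r)"
      by (intro compact_imp_bounded compact_continuous_image
          continuous_on_subset[OF C1_on_imp_continuous_on[OF vdens_C1]] c compact_cball)
    then obtain B where "\<forall>y\<in>vdens c ` cball a r. norm y \<le> B" unfolding bounded_iff by blast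
    then have B: "vdens c x \<le> B" if "x \<in> cball a r" for x using that by force
    have "emeasure vol (cinv c ` cball a r) = (\<integral>\<^sup>+ x \<in> cball a r. ennreal (vdens c x) \<partial>lborel)"
      using c s by (subst emeasure_vol_chart) (auto simp: coord_cinv_image cinv_in)
    also have "\<dots> \<le> (\<integral>\<^sup>+ x. ennreal B * indicator (cball a r) x \<partial>lborel)"
      by (intro nn_integral_mono) (auto simp: indicator_def B ennreal_leI)
    also have "\<dots> < \<infinity>" using emeasure_bounded_finite[of "cball a r"]
      by (simp add: nn_integral_cmult_indicator ennreal_mult_less_top)
    finally show ?thesis using s t by simp
  qed
  have "(\<Union>t\<in>F. ?K t) = UNIV"
  proof -
    have "p \<in> (\<Union>t\<in>F. ?K t)" for p
      using F(3)[of p] by (fastforce simp: ball_def cball_def)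
    then show ?thesis by blast
  qed
  moreover have "emeasure vol (\<Union>t\<in>F. ?K t) \<le> (\<Sum>t\<in>F. emeasure vol (?K t))"
    using fin F(1) by (intro emeasure_subadditive_finite) auto
  moreover have "(\<Sum>t\<in>F. emeasure vol (?K t)) < \<infinity>"
    using fin F(1) by (simp add: sum_Inf less_top[symmetric] ennreal_sum_less_top)
  ultimately show "emeasure vol (space vol) \<noteq> \<infinity>" by auto
qed

lemma continuous_mfd_bounded:
  fixes f :: "'m \<Rightarrow> real"
  assumes "continuous_on UNIV f"
  obtains B where "\<And>p. \<bar>f p\<bar> \<le> B"
  using compact_imp_bounded[OF compact_continuous_image[OF assms compact_UNIV]]
  unfolding bounded_iff by fastforce

lemma integrable_continuous_mfd:
  fixes f :: "'m \<Rightarrow> real"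
  assumes "continuous_on UNIV f"
  shows "integrable vol f"
proof -
  interpret finite_measure vol by (rule finite_measure_vol)
  obtain B where "\<And>p. \<bar>f p\<bar> \<le> B" using continuous_mfd_bounded[OF assms] by blast
  then show ?thesis
    by (intro integrable_const_bound[of _ B] measurable_continuous_mfd[OF assms]) auto
qed

text \<open>Outside the image of the chart \<open>cinv c\<close> is constant, being a choice from the empty set, so it is
  measurable on the whole Euclidean space.\<close>

lemma measurable_cinv:
  assumes "c \<in> A"
  shows "cinv c \<in> borel_measurable borel"
proof (rule borel_measurableI)
  fix S :: "'m set" assume "open S"
  have "cinv c x = (SOME y. False)" if "x \<notin> cimg c" for x
  proof -
    have "(\<lambda>y. y \<in> cdom c \<and> coord c y = x) = (\<lambda>y. False)" using that by auto
    then show ?thesis by (simp add: cinv_def inv_into_def)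
  qed
  then have eq: "cinv c -` S = (cimg c \<inter> cinv c -` S) \<union> (if (SOME y. False) \<in> S then - cimg c else {})"
    (is "?L = ?U \<union> ?V") by (auto split: if_splits) metis
  moreover have "open (cimg c \<inter> cinv c -` S)"
    using continuous_open_preimage[OF cont_cinv open_cimg] assms \<open>open S\<close> by blast
  moreover have "(if (SOME y. False) \<in> S then - cimg c else {}) \<in> sets borel"
    using open_cimg[OF assms] by simp
  ultimately have "?U \<union> ?V \<in> sets borel" by (intro sets.Un) auto
  then show "cinv c -` S \<inter> space borel \<in> sets borel" by (subst eq) simp
qed

lemma measurable_vdens:
  assumes "c \<in> A"
  shows "(\<lambda>x. indicator (cimg c) x * vdens c x) \<in> borel_measurable borel"
  using borel_measurable_continuous_on_indicator[OF _ C1_on_imp_continuous_on[OF vdens_C1[OF assms]]]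
    open_cimg[OF assms] by simp

text \<open>The defining property of the volume concerns sets; restated as an equality of measures it transfers
  to integrals.\<close>

lemma vol_chart_measure:
  assumes c: "c \<in> A"
  shows "density vol (indicator (cdom c)) =
    distr (density lborel (\<lambda>x. ennreal (indicator (cimg c) x * vdens c x))) borel (cinv c)"
    (is "?L = ?R")
proof (rule measure_eqI)
  note [measurable] = measurable_cinv[OF c] measurable_vdens[OF c]
  have o [measurable]: "cdom c \<in> sets borel" "cimg c \<in> sets borel"
    using open_cdom[OF c] open_cimg[OF c] by auto
  show "sets ?L = sets ?R" by simp
  fix B assume "B \<in> sets ?L"
  then have B [measurable]: "B \<in> sets borel" by simp
  have "emeasure ?L B = (\<integral>\<^sup>+ p. indicator (cdom c) p * indicator B p \<partial>vol)"
    by (rule emeasure_density) (use o in \<open>auto intro!: borel_measurable_indicator\<close>)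
  also have "\<dots> = (\<integral>\<^sup>+ p. indicator (cdom c \<inter> B) p \<partial>vol)"
    by (simp add: indicator_inter_arith)
  also have "\<dots> = emeasure vol (cdom c \<inter> B)"
    using o B by (intro nn_integral_indicator) auto
  also have "\<dots> = (\<integral>\<^sup>+ x \<in> coord c ` (cdom c \<inter> B). ennreal (vdens c x) \<partial>lborel)"
    by (rule emeasure_vol_chart[OF c]) auto
  also have "\<dots> = (\<integral>\<^sup>+ x \<in> cinv c -` B. ennreal (indicator (cimg c) x * vdens c x) \<partial>lborel)"
    unfolding cimg_overlap[OF c] by (intro nn_integral_cong) (auto simp: indicator_def)
  also have "\<dots> = emeasure (density lborel (\<lambda>x. ennreal (indicator (cimg c) x * vdens c x))) (cinv c -` B)"
    by (rule emeasure_density[symmetric]) (auto intro: measurable_sets_borel[OF measurable_cinv[OF c]])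
  also have "\<dots> = emeasure ?R B"
    by (subst emeasure_distr) auto
  finally show "emeasure ?L B = emeasure ?R B" .
qed

lemma vol_chart_integral:
  fixes f :: "'m \<Rightarrow> real"
  assumes c: "c \<in> A" and [measurable]: "f \<in> borel_measurable borel"
    and zero: "\<And>p. p \<notin> cdom c \<Longrightarrow> f p = 0"
  shows "(\<integral>p. f p \<partial>vol) = (\<integral>x. indicator (cimg c) x * (vdens c x * f (cinv c x)) \<partial>lborel)"
proof -
  note [measurable] = measurable_cinv[OF c] measurable_vdens[OF c]
  have o [measurable]: "cdom c \<in> sets borel" using open_cdom[OF c] by auto
  have "(\<integral>p. f p \<partial>vol) = (\<integral>p. indicator (cdom c) p *\<^sub>R f p \<partial>vol)"
    by (intro Bochner_Integration.integral_cong) (auto simp: indicator_def zero)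
  also have "\<dots> = (\<integral>p. f p \<partial>density vol (\<lambda>p. ennreal (indicator (cdom c) p)))"
    by (subst integral_density) (auto intro!: borel_measurable_indicator)
  also have "\<dots> = (\<integral>p. f p \<partial>density vol (indicator (cdom c)))"
    by (simp add: ennreal_indicator)
  also have "\<dots> = (\<integral>x. f (cinv c x)
      \<partial>density lborel (\<lambda>x. ennreal (indicator (cimg c) x * vdens c x)))"
    unfolding vol_chart_measure[OF c] by (rule integral_distr) auto
  also have "\<dots> = (\<integral>x. indicator (cimg c) x * vdens c x * f (cinv c x) \<partial>lborel)"
  proof -
    have "0 \<le> indicator (cimg c) x * vdens c x" for x
      using vdens_pos[OF c, of x] by (cases "x \<in> cimg c") auto
    then show ?thesis by (subst integral_density) auto
  qed
  finally show ?thesis by (simp add: mult.assoc)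
qed

text \<open>The volume has full support; this turns equality almost everywhere of continuous functions into
  equality everywhere.\<close>

lemma open_vol_zero_empty:
  assumes "open U" "emeasure vol U = 0"
  shows "U = {}"
proof (rule ccontr)
  assume "U \<noteq> {}"
  then obtain p where p: "p \<in> U" by blast
  obtain c where c: "c \<in> A" "p \<in> cdom c" using chart_ex by blast
  let ?V = "cdom c \<inter> U"
  have oi: "open (coord c ` ?V)" using open_coord_image[OF c(1) assms(1)] .
  have "emeasure vol ?V \<le> emeasure vol U" using assms(1) by (intro emeasure_mono) auto
  then have "0 = (\<integral>\<^sup>+ x \<in> coord c ` ?V. ennreal (vdens c x) \<partial>lborel)"
    using emeasure_vol_chart[OF c(1), of ?V] open_cdom[OF c(1)] assms by auto
  moreover have "(\<lambda>x. ennreal (vdens c x) * indicator (coord c ` ?V) x) \<in> borel_measurable lborel"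
  proof -
    have "(\<lambda>x. ennreal (indicator (cimg c) x * vdens c x) * indicator (coord c ` ?V) x)
        \<in> borel_measurable lborel"
      using measurable_vdens[OF c(1)] oi
      by (intro borel_measurable_times_ennreal borel_measurable_indicator) auto
    moreover have "ennreal (indicator (cimg c) x * vdens c x) * indicator (coord c ` ?V) x =
        ennreal (vdens c x) * indicator (coord c ` ?V) x" for x
      by (auto simp: indicator_def)
    ultimately show ?thesis by simp
  qed
  ultimately have "AE x in lborel. ennreal (vdens c x) * indicator (coord c ` ?V) x = 0"
    by (subst (asm) eq_commute, subst (asm) nn_integral_0_iff_AE) auto
  then have "AE x in lborel. x \<notin> coord c ` ?V"
  proof (eventually_elim, clarify)
    fix q assume "ennreal (vdens c (coord c q)) * indicator (coord c ` ?V) (coord c q) = 0"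
      and q: "q \<in> cdom c" "q \<in> U"
    then have "vdens c (coord c q) \<le> 0" by (auto simp: indicator_def ennreal_eq_0_iff split: if_splits)
    then show False using vdens_pos[OF c(1), of "coord c q"] q by auto
  qed
  then have "coord c ` ?V \<in> null_sets lborel" using oi by (subst AE_iff_null_sets) auto
  then have "negligible (coord c ` ?V)"
    by (simp add: negligible_iff_null_sets null_sets_completionI)
  then show False using open_not_negligible oi c p by (metis IntI empty_iff image_is_empty)
qed


section \<open>Differentials and gradients\<close>

definition C1_fun :: "('m \<Rightarrow> real) \<Rightarrow> bool" where
  "C1_fun f \<longleftrightarrow> (\<forall>c\<in>A. Ck_on 1 (cimg c) (f \<circ> cinv c))"

lemma smooth_fun_C1: "smooth_fun A f \<Longrightarrow> C1_fun f"
  unfolding smooth_fun_def C1_fun_def using smooth_on_imp_C1_on by blast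

lemma C1_fun_continuous: "C1_fun f \<Longrightarrow> continuous_on UNIV f"
  by (rule continuous_mfdI) (auto simp: C1_fun_def o_def simp del: Ck_on.simps One_nat_def
      dest: C1_on_imp_continuous_on)

lemma C1_fun_mult: "C1_fun f \<Longrightarrow> C1_fun h \<Longrightarrow> C1_fun (\<lambda>p. f p * h p)"
  using C1_on_mult unfolding C1_fun_def o_def by blast

lemma C1_fun_sum: "(\<And>i. i \<in> I \<Longrightarrow> C1_fun (f i)) \<Longrightarrow> C1_fun (\<lambda>p. \<Sum>i\<in>I. f i p)"
  unfolding C1_fun_def o_def by (intro ballI C1_on_sum) blast

lemma C1_fun_divide: "C1_fun f \<Longrightarrow> C1_fun h \<Longrightarrow> (\<And>p. h p \<noteq> 0) \<Longrightarrow> C1_fun (\<lambda>p. f p / h p)"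
  unfolding C1_fun_def o_def by (intro ballI C1_on_divide) blast+

lemma C1_fun_has_derivative:
  assumes "C1_fun f" "c \<in> A" "p \<in> cdom c"
  shows "(f \<circ> cinv c has_derivative frechet_derivative (f \<circ> cinv c) (at (coord c p))) (at (coord c p))"
  by (rule C1_on_has_derivative) (use assms in \<open>auto simp: C1_fun_def simp del: Ck_on.simps One_nat_def\<close>)

lemma differential_eqI:
  assumes f: "(f \<circ> cinv c has_derivative D) (at (coord c p))"
    and "c \<in> A" "p \<in> cdom c" "v \<in> tangent_space A p"
  shows "differential A f p v = D (v c)"
proof -
  let ?d = "chart_at A p"
  have "(f \<circ> cinv ?d has_derivative D \<circ> jac ?d c p) (at (coord ?d p))"
    using assms chart_at by (intro change_chart_has_derivative) auto
  from frechet_derivative_at[OF this] have "differential A f p v = D (jac ?d c p (v ?d))"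
    by (simp add: differential_def Let_def o_def[of D]) (metis o_apply)
  also have "jac ?d c p (v ?d) = v c"
    using tangent_jac[OF assms(4) chart_at(1) assms(2) chart_at(2) assms(3)] by simp
  finally show ?thesis .
qed

lemma differential_chart:
  assumes "C1_fun f" "c \<in> A" "p \<in> cdom c" "v \<in> tangent_space A p"
  shows "differential A f p v = frechet_derivative (f \<circ> cinv c) (at (coord c p)) (v c)"
  by (rule differential_eqI[OF C1_fun_has_derivative]) (use assms in auto)

lemma differential_sum:
  assumes "\<And>i. i \<in> I \<Longrightarrow> C1_fun (f i)" "v \<in> tangent_space A p"
  shows "differential A (\<lambda>p. \<Sum>i\<in>I. f i p) p v = (\<Sum>i\<in>I. differential A (f i) p v)"
proof -
  let ?c = "chart_at A p"
  have "((\<lambda>p. \<Sum>i\<in>I. f i p) \<circ> cinv ?c has_derivative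
      (\<lambda>w. \<Sum>i\<in>I. frechet_derivative (f i \<circ> cinv ?c) (at (coord ?c p)) w)) (at (coord ?c p))"
    using C1_fun_has_derivative[OF assms(1) chart_at] unfolding o_def
    by (intro has_derivative_sum) auto
  from differential_eqI[OF this chart_at assms(2)] show ?thesis
    by (simp add: differential_def Let_def)
qed

lemma differential_add_scale:
  assumes "C1_fun f" "C1_fun h" "v \<in> tangent_space A p"
  shows "differential A (\<lambda>p. f p + a * h p) p v = differential A f p v + a * differential A h p v"
proof -
  let ?c = "chart_at A p"
  have "((\<lambda>p. f p + a * h p) \<circ> cinv ?c has_derivative
      (\<lambda>w. frechet_derivative (f \<circ> cinv ?c) (at (coord ?c p)) w +
        a * frechet_derivative (h \<circ> cinv ?c) (at (coord ?c p)) w)) (at (coord ?c p))"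
    using C1_fun_has_derivative[OF assms(1) chart_at] C1_fun_has_derivative[OF assms(2) chart_at]
    unfolding o_def by (intro derivative_intros) auto
  from differential_eqI[OF this chart_at assms(3)] show ?thesis
    by (simp add: differential_def Let_def)
qed

lemma tangent_diff:
  "u \<in> tangent_space A p \<Longrightarrow> v \<in> tangent_space A p \<Longrightarrow> (\<lambda>c. u c - v c) \<in> tangent_space A p"
  using tangent_add[OF _ tangent_scale[of v p "-1"], of u] by simp

lemma g_diff:
  assumes "u \<in> tangent_space A p" "v \<in> tangent_space A p" "w \<in> tangent_space A p"
  shows "g p (\<lambda>c. u c - v c) w = g p u w - g p v w"
  using g_add[OF assms(1) tangent_scale[OF assms(2), of "-1"] assms(3)]
    g_scale[OF assms(2,3), of "-1"] by simp

lemma g_nondegenerate: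
  assumes "u \<in> tangent_space A p" "v \<in> tangent_space A p"
    and "\<And>w. w \<in> tangent_space A p \<Longrightarrow> g p u w = g p v w"
  shows "u = v"
proof -
  let ?w = "\<lambda>c. u c - v c"
  have w: "?w \<in> tangent_space A p" using assms tangent_diff by blast
  have "g p ?w ?w = 0" using g_diff[OF assms(1,2) w] assms(3)[OF w] by simp
  then have "?w = (\<lambda>c. 0)" using g_pos[OF w] by auto
  then show ?thesis by (auto simp: fun_eq_iff)
qed

text \<open>In a chart the defining equation of the gradient is the linear system whose matrix is the Gram
  matrix and whose right-hand side consists of the partial derivatives.\<close>

lemma grad_ex:
  assumes "C1_fun f"
  shows "\<exists>v\<in>tangent_space A p. \<forall>w\<in>tangent_space A p. g p v w = differential A f p w"
proof -
  obtain c where c: "c \<in> A" "p \<in> cdom c" using chart_ex by blast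
  let ?D = "frechet_derivative (f \<circ> cinv c) (at (coord c p))" and ?G = "gram A g c p"
  have lin: "linear ?D" using C1_fun_has_derivative[OF assms c] has_derivative_linear by blast
  have "det ?G \<noteq> 0" using det_gram_pos[OF c] by simp
  then obtain u where u: "?G *v u = (\<chi> i. ?D (axis i 1))"
    using cramer[of ?G _ "\<chi> i. ?D (axis i 1)"] by iprover
  have tr: "transpose ?G = ?G"
    by (simp add: vec_eq_iff transpose_def gram_sym[OF c])
  have "g p (tangent_of A c p u) w = differential A f p w" if w: "w \<in> tangent_space A p" for w
  proof -
    have "g p (tangent_of A c p u) w = u \<bullet> (?G *v w c)"
      using g_coord[OF c tangent_of_in[OF c] w] tangent_of_self[OF c] by simp
    also have "\<dots> = (transpose ?G *v u) \<bullet> w c"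
      unfolding transpose_matrix_vector dot_lmul_matrix ..
    also have "\<dots> = (?G *v u) \<bullet> w c" unfolding tr ..
    also have "\<dots> = (\<Sum>i\<in>UNIV. w c $ i * ?D (axis i 1))"
      by (simp add: u inner_vec_def mult.commute)
    also have "\<dots> = ?D (\<Sum>i\<in>UNIV. (w c $ i) *\<^sub>R axis i 1)"
      by (simp add: linear_sum[OF lin] linear_scale[OF lin, unfolded real_scaleR_def])
    also have "(\<Sum>i\<in>UNIV. (w c $ i) *\<^sub>R axis i 1) = w c"
      using basis_expansion[of "w c"] by (simp add: scalar_mult_eq_scaleR)
    finally show ?thesis using differential_chart[OF assms c w] by (simp add: o_def)
  qed
  then show ?thesis using tangent_of_in[OF c] by blast
qed

lemma
  assumes "C1_fun f"
  shows grad_in: "grad A g f p \<in> tangent_space A p"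
    and g_grad: "w \<in> tangent_space A p \<Longrightarrow> g p (grad A g f p) w = differential A f p w"
proof -
  obtain v where v: "v \<in> tangent_space A p" "\<forall>w\<in>tangent_space A p. g p v w = differential A f p w"
    using grad_ex[OF assms] by blast
  have "grad A g f p = v" unfolding grad_def
    by (rule the_equality) (use v g_nondegenerate in auto)
  then show "grad A g f p \<in> tangent_space A p"
    "w \<in> tangent_space A p \<Longrightarrow> g p (grad A g f p) w = differential A f p w" using v by auto
qed

lemma gram_grad:
  assumes "C1_fun f" "c \<in> A" "p \<in> cdom c"
  shows "gram A g c p *v grad A g f p c = (\<chi> i. frechet_derivative (f \<circ> cinv c) (at (coord c p)) (axis i 1))"
proof -
  have "(gram A g c p *v grad A g f p c) $ i = frechet_derivative (f \<circ> cinv c) (at (coord c p)) (axis i 1)" for i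
  proof -
    let ?e = "tangent_of A c p (axis i 1)"
    have e: "?e \<in> tangent_space A p" "?e c = axis i 1" using assms tangent_of_in tangent_of_self by auto
    have "(gram A g c p *v grad A g f p c) $ i = g p ?e (grad A g f p)"
      using assms e by (simp add: g_coord grad_in inner_axis')
    also have "\<dots> = differential A f p ?e" using assms e g_sym grad_in g_grad by metis
    finally show ?thesis using assms e by (simp add: differential_chart)
  qed
  then show ?thesis by (simp add: vec_eq_iff)
qed

text \<open>Cramer's rule writes the components of the gradient as quotients of polynomials in the entries of
  the Gram matrix and the partial derivatives, which are all of class \<open>C\<^sup>1\<close>.\<close>

lemma grad_C1:
  assumes f: "smooth_fun A f"
  shows "C1_vector_field A (grad A g f)"
  unfolding C1_vector_field_def
proof (intro conjI ballI)
  have f1: "C1_fun f" by (rule smooth_fun_C1[OF f])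
  show "vector_field A (grad A g f)" unfolding vector_field_def using grad_in[OF f1] by blast
  fix c assume c: "c \<in> A"
  let ?G = "\<lambda>x. gram A g c (cinv c x)" and ?b = "\<lambda>x i. frechet_derivative (f \<circ> cinv c) (at x) (axis i 1)"
  have b: "Ck_on 1 (cimg c) (\<lambda>x. ?b x i)" for i
    using f c by (intro smooth_on_deriv_C1_on) (simp add: smooth_fun_def)
  have *: "Ck_on 1 (cimg c) (\<lambda>x. det (\<chi> i j. if j = k then ?b x i else ?G x $ i $ j) / det (?G x))" for k
  proof (intro C1_on_divide C1_on_det)
    show "Ck_on 1 (cimg c) (\<lambda>x. (\<chi> i j. if j = k then ?b x i else ?G x $ i $ j) $ i $ j)" for i j
      using b gram_C1[OF c] by (cases "j = k") (simp_all del: Ck_on.simps One_nat_def)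
    show "det (?G x) \<noteq> 0" if "x \<in> cimg c" for x using det_gram_pos c cinv_in that by (metis less_irrefl)
  qed (rule gram_C1[OF c])
  show "Ck_on 1 (cimg c) (\<lambda>x. grad A g f (cinv c x) c)"
  proof (rule Ck_on_cong[OF open_cimg[OF c] _ C1_on_vec])
    show "Ck_on 1 (cimg c) (\<lambda>x. (\<chi> k. det (\<chi> i j. if j = k then ?b x i else ?G x $ i $ j) / det (?G x)) $ k)" for k
      using * by (simp del: Ck_on.simps One_nat_def)
    show "(\<chi> k. det (\<chi> i j. if j = k then ?b x i else ?G x $ i $ j) / det (?G x)) = grad A g f (cinv c x) c"
      if x: "x \<in> cimg c" for x
    proof -
      have "?G x *v grad A g f (cinv c x) c = (\<chi> i. ?b x i)"
        using gram_grad[OF f1 c cinv_in[OF c x]] by (simp add: coord_cinv c x)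
      moreover have "det (?G x) \<noteq> 0" using det_gram_pos c cinv_in x by (metis less_irrefl)
      ultimately have "grad A g f (cinv c x) c =
          (\<chi> k. det (\<chi> i j. if j = k then (\<chi> i. ?b x i) $ i else ?G x $ i $ j) / det (?G x))"
        using cramer by blast
      then show ?thesis unfolding vec_lambda_beta by (rule sym)
    qed
  qed
qed

subsection \<open>Continuous vector fields\<close>

definition cont_field :: "('m, 'n) vfield \<Rightarrow> bool" where
  "cont_field X \<longleftrightarrow> vector_field A X \<and> (\<forall>c\<in>A. continuous_on (cimg c) (\<lambda>x. X (cinv c x) c))"

lemma C1_imp_cont_field: "C1_vector_field A X \<Longrightarrow> cont_field X"
  unfolding C1_vector_field_def cont_field_def using C1_on_imp_continuous_on by blast

lemma vector_field_in: "vector_field A X \<Longrightarrow> X p \<in> tangent_space A p"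
  by (simp add: vector_field_def)

lemma continuous_g:
  assumes X: "cont_field X" and Y: "cont_field Y"
  shows "continuous_on UNIV (\<lambda>p. g p (X p) (Y p))"
proof (rule continuous_mfdI)
  fix c assume c: "c \<in> A"
  have "continuous_on (cimg c) (\<lambda>x. \<Sum>i\<in>UNIV. X (cinv c x) c $ i * (\<Sum>j\<in>UNIV. gram A g c (cinv c x) $ i $ j * Y (cinv c x) c $ j))"
    using X Y c
    by (intro continuous_on_sum continuous_on_mult continuous_on_component
        gram_C1[OF c, THEN C1_on_imp_continuous_on]) (auto simp: cont_field_def)
  moreover have "g (cinv c x) (X (cinv c x)) (Y (cinv c x)) =
     (\<Sum>i\<in>UNIV. X (cinv c x) c $ i * (\<Sum>j\<in>UNIV. gram A g c (cinv c x) $ i $ j * Y (cinv c x) c $ j))"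
    if x: "x \<in> cimg c" for x
    using X Y c x cinv_in[OF c x]
    by (simp add: g_coord cont_field_def vector_field_in inner_vec_def matrix_vector_mult_def)
  ultimately show "continuous_on (cimg c) (\<lambda>x. g (cinv c x) (X (cinv c x)) (Y (cinv c x)))"
    by (simp cong: continuous_on_cong)
qed

lemma continuous_differential:
  assumes f: "C1_fun f" and X: "cont_field X"
  shows "continuous_on UNIV (\<lambda>p. differential A f p (X p))"
proof (rule continuous_mfdI)
  fix c assume c: "c \<in> A"
  have "continuous_on (cimg c) (\<lambda>x. frechet_derivative (f \<circ> cinv c) (at x) (X (cinv c x) c))"
    by (rule C1_on_continuous_deriv2[where g = "\<lambda>x. x" and T = "cimg c"])
      (use f X c in \<open>auto simp: C1_fun_def cont_field_def simp del: Ck_on.simps One_nat_def\<close>)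
  moreover have "differential A f (cinv c x) (X (cinv c x)) =
      frechet_derivative (f \<circ> cinv c) (at x) (X (cinv c x) c)" if "x \<in> cimg c" for x
    using f X c that cinv_in[OF c that]
    by (simp add: differential_chart cont_field_def vector_field_in coord_cinv)
  ultimately show "continuous_on (cimg c) (\<lambda>x. differential A f (cinv c x) (X (cinv c x)))"
    by (simp cong: continuous_on_cong)
qed

lemma C1_field_scale:
  assumes r: "C1_fun r" and X: "C1_vector_field A X"
  shows "C1_vector_field A (vscale r X)"
  unfolding C1_vector_field_def
proof (intro conjI ballI)
  show "vector_field A (vscale r X)"
    using X tangent_scale unfolding vector_field_def vscale_def C1_vector_field_def by blast
  fix c assume c: "c \<in> A"
  show "Ck_on 1 (cimg c) (\<lambda>x. vscale r X (cinv c x) c)"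
  proof (rule C1_on_vec)
    fix i
    have "Ck_on 1 (cimg c) (\<lambda>x. r (cinv c x) * X (cinv c x) c $ i)"
      using r X c unfolding C1_fun_def o_def C1_vector_field_def by (intro C1_on_mult C1_on_component) auto
    then show "Ck_on 1 (cimg c) (\<lambda>x. vscale r X (cinv c x) c $ i)"
      by (simp add: vscale_def del: Ck_on.simps One_nat_def)
  qed
qed

lemma continuous_local:
  assumes "c \<in> A" "continuous_on (cimg c) (\<lambda>x. f (cinv c x))"
    and "compact S" "S \<subseteq> cdom c" "\<And>p. p \<notin> S \<Longrightarrow> f p = (0::real)"
  shows "continuous_on UNIV f"
proof -
  have "continuous_on (- S) f"
    using continuous_on_const[of "- S" 0] by (rule continuous_on_eq) (use assms(5) in auto)
  then have "continuous_on (cdom c \<union> - S) f"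
    using assms by (intro continuous_on_open_Un continuous_cdomI open_cdom)
      (auto simp: compact_imp_closed open_Compl)
  moreover have "cdom c \<union> - S = UNIV" using assms by auto
  ultimately show ?thesis by simp
qed

section \<open>The divergence theorem\<close>

text \<open>The divergence with the chart held fixed. In \<open>divergence\<close> the chart may jump from point to point,
  so that neither continuity nor an integral can be studied in coordinates before \<open>divc_independent\<close>
  identifies the two.\<close>

definition divc :: "('m, 'n) chart \<Rightarrow> ('m, 'n) vfield \<Rightarrow> 'm \<Rightarrow> real" where
  "divc c X p = (\<Sum>i\<in>UNIV. frechet_derivative (\<lambda>x. vdens c x * X (cinv c x) c $ i)
     (at (coord c p)) (axis i 1)) / vdens c (coord c p)"

lemma divergence_divc: "divergence A g X p = divc (chart_at A p) X p"
  by (simp add: divergence_def divc_def Let_def vdens_def)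

lemma dens_field_C1:
  assumes "C1_vector_field A X" "c \<in> A"
  shows "Ck_on 1 (cimg c) (\<lambda>x. vdens c x * X (cinv c x) c $ i)"
  using assms unfolding C1_vector_field_def by (intro C1_on_mult C1_on_component vdens_C1) auto

lemma continuous_divc:
  assumes "C1_vector_field A X" "c \<in> A"
  shows "continuous_on (cimg c) (\<lambda>x. divc c X (cinv c x))"
proof -
  have "continuous_on (cimg c) (\<lambda>x. (\<Sum>i\<in>UNIV. frechet_derivative (\<lambda>x. vdens c x * X (cinv c x) c $ i)
     (at x) (axis i 1)) / vdens c x)"
    using vdens_pos[OF assms(2)]
    by (intro continuous_intros C1_on_continuous_deriv[OF dens_field_C1[OF assms]]
        C1_on_imp_continuous_on[OF vdens_C1[OF assms(2)]]) force
  then show ?thesis using assms by (simp add: divc_def coord_cinv cong: continuous_on_cong)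
qed

text \<open>The density in the integral over the chart cancels the one in the denominator of the divergence.
  By the product rule the sum of both integrands then becomes the sum of the partial derivatives of
  the functions \<open>F i = f s X\<^sup>i\<close>, extended by zero to the whole space, with \<open>s\<close> the volume density.\<close>

lemma local_integration_by_parts:
  assumes X: "C1_vector_field A X" and f: "C1_fun f" and c: "c \<in> A"
    and S: "compact S" "S \<subseteq> cdom c" and zero: "\<And>p. p \<notin> S \<Longrightarrow> f p = 0"
  shows "(\<integral>p. f p * divc c X p \<partial>vol) = - (\<integral>p. differential A f p (X p) \<partial>vol)"
    and "continuous_on UNIV (\<lambda>p. f p * divc c X p)"
proof -
  define s where "s i x = vdens c x * X (cinv c x) c $ i" for i x
  define F where "F i x = (if x \<in> cimg c then f (cinv c x) * s i x else 0)" for i x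
  define K where "K = coord c ` S"
  have K: "compact K" "K \<subseteq> cimg c" unfolding K_def
    using S continuous_on_subset[OF cont_coord[OF c]] by (auto intro: compact_continuous_image)
  have fC1: "Ck_on 1 (cimg c) (\<lambda>x. f (cinv c x))" using f c unfolding C1_fun_def o_def by blast
  have sC1: "Ck_on 1 (cimg c) (s i)" for i using dens_field_C1[OF X c] unfolding s_def .
  have F0: "F i x = 0" if "x \<notin> K" for i x
  proof (cases "x \<in> cimg c")
    case True
    then have "cinv c x \<notin> S" using that coord_cinv[OF c True] unfolding K_def by (metis imageI)
    then show ?thesis using zero by (simp add: F_def)
  qed (simp add: F_def)
  have FC1': "Ck_on 1 (cimg c) (F i)" for i
    by (rule Ck_on_cong[OF open_cimg[OF c] _ C1_on_mult[OF fC1 sC1[of i]]]) (simp add: F_def)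
  have FC1: "Ck_on 1 UNIV (F i)" for i
    by (rule C1_extend_by_zero[OF open_cimg[OF c] K FC1' F0])
  have oK: "open (- K)" using K(1) by (simp add: compact_imp_closed open_Compl)
  have dF0: "frechet_derivative (F i) (at x) = (\<lambda>_. 0)" if "x \<notin> K" for i x
  proof -
    have "(F i has_derivative (\<lambda>_. 0)) (at x)"
      by (rule has_derivative_transform_within_open[OF has_derivative_const[of 0] oK])
        (use that F0 in auto)
    from frechet_derivative_at[OF this] show ?thesis by simp
  qed
  have intF: "integrable lborel (\<lambda>x. frechet_derivative (F i) (at x) (axis i 1))" for i
    by (rule integrable_compact_support[OF _ K(1)])
      (auto intro: continuous_on_subset[OF C1_on_continuous_deriv[OF FC1]] simp: dF0)
  have dF: "(\<Sum>i\<in>UNIV. frechet_derivative (F i) (at x) (axis i 1)) =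
      vdens c x * (f p * divc c X p + differential A f p (X p))"
    if p: "p = cinv c x" "x \<in> cimg c" for x p
  proof -
    have px: "p \<in> cdom c" "coord c p = x" using p c by (auto simp: cinv_in coord_cinv)
    have Xp: "X p \<in> tangent_space A p" using X by (simp add: C1_vector_field_def vector_field_in)
    let ?D = "frechet_derivative (f \<circ> cinv c) (at x)"
    have lin: "linear ?D" using C1_fun_has_derivative[OF f c px(1)] px has_derivative_linear by metis
    have "(F i has_derivative (\<lambda>v. f (cinv c x) * frechet_derivative (s i) (at x) v + ?D v * s i x)) (at x)" for i
      by (rule has_derivative_transform_within_open[OF _ open_cimg[OF c] p(2)])
        (auto simp: F_def o_def intro!: has_derivative_mult C1_on_has_derivative[OF fC1 p(2)]
          C1_on_has_derivative[OF sC1 p(2)])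
    from frechet_derivative_at[OF this]
    have "frechet_derivative (F i) (at x) = (\<lambda>v. f (cinv c x) * frechet_derivative (s i) (at x) v + ?D v * s i x)" for i
      by simp
    then have "(\<Sum>i\<in>UNIV. frechet_derivative (F i) (at x) (axis i 1)) =
      f p * (\<Sum>i\<in>UNIV. frechet_derivative (s i) (at x) (axis i 1)) + (\<Sum>i\<in>UNIV. ?D (axis i 1) * s i x)"
      by (simp add: sum.distrib sum_distrib_left p)
    also have "(\<Sum>i\<in>UNIV. frechet_derivative (s i) (at x) (axis i 1)) = vdens c x * divc c X p"
      using vdens_pos[OF c p(2)] by (simp add: divc_def px s_def[abs_def])
    also have "(\<Sum>i\<in>UNIV. ?D (axis i 1) * s i x) = vdens c x * (\<Sum>i\<in>UNIV. X p c $ i * ?D (axis i 1))"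
      by (simp add: s_def sum_distrib_left p mult_ac)
    also have "(\<Sum>i\<in>UNIV. X p c $ i * ?D (axis i 1)) = ?D (\<Sum>i\<in>UNIV. (X p c $ i) *\<^sub>R axis i 1)"
      by (simp add: linear_sum[OF lin] linear_scale[OF lin, unfolded real_scaleR_def])
    also have "(\<Sum>i\<in>UNIV. (X p c $ i) *\<^sub>R axis i 1) = X p c"
      using basis_expansion[of "X p c"] by (simp add: scalar_mult_eq_scaleR)
    also have "?D (X p c) = differential A f p (X p)"
      using differential_chart[OF f c px(1) Xp] px by simp
    finally show ?thesis by (simp add: algebra_simps)
  qed
  show cont1: "continuous_on UNIV (\<lambda>p. f p * divc c X p)"
    by (rule continuous_local[OF c _ S])
      (use zero in \<open>auto intro!: continuous_intros C1_on_imp_continuous_on[OF fC1] continuous_divc[OF X c]\<close>)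
  have cont2: "continuous_on UNIV (\<lambda>p. differential A f p (X p))"
    by (intro continuous_differential f C1_imp_cont_field X)
  have oS: "open (- S)" using S(1) by (simp add: compact_imp_closed open_Compl)
  have d0: "differential A f p (X p) = 0" if p: "p \<notin> S" for p
  proof -
    let ?d = "chart_at A p"
    have "(f \<circ> cinv ?d has_derivative (\<lambda>_. 0)) (at (coord ?d p))"
    proof (rule has_derivative_transform_within_open[OF has_derivative_const[of 0]])
      show "open (coord ?d ` (cdom ?d \<inter> - S))" by (rule open_coord_image[OF chart_at(1) oS])
      show "coord ?d p \<in> coord ?d ` (cdom ?d \<inter> - S)" using p chart_at by auto
      show "0 = (f \<circ> cinv ?d) x" if "x \<in> coord ?d ` (cdom ?d \<inter> - S)" for x
        using that zero chart_at(1) by (auto simp: cinv_coord)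
    qed
    from differential_eqI[OF this chart_at] show ?thesis
      using X by (simp add: C1_vector_field_def vector_field_in)
  qed
  have int: "integrable vol (\<lambda>p. f p * divc c X p)" "integrable vol (\<lambda>p. differential A f p (X p))"
    using cont1 cont2 integrable_continuous_mfd by auto
  have "(\<integral>p. f p * divc c X p + differential A f p (X p) \<partial>vol) =
     (\<integral>x. indicator (cimg c) x * (vdens c x * (f (cinv c x) * divc c X (cinv c x) +
        differential A f (cinv c x) (X (cinv c x)))) \<partial>lborel)"
  proof (rule vol_chart_integral[OF c])
    show "(\<lambda>p. f p * divc c X p + differential A f p (X p)) \<in> borel_measurable borel"
      by (intro borel_measurable_continuous_onI continuous_on_add cont1 cont2)
    show "f p * divc c X p + differential A f p (X p) = 0" if "p \<notin> cdom c" for p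
    proof -
      have "p \<notin> S" using S(2) that by blast
      then show ?thesis using zero d0 by simp
    qed
  qed
  also have "\<dots> = (\<integral>x. (\<Sum>i\<in>UNIV. frechet_derivative (F i) (at x) (axis i 1)) \<partial>lborel)"
  proof (intro Bochner_Integration.integral_cong refl)
    fix x
    show "indicator (cimg c) x * (vdens c x * (f (cinv c x) * divc c X (cinv c x) +
        differential A f (cinv c x) (X (cinv c x)))) = (\<Sum>i\<in>UNIV. frechet_derivative (F i) (at x) (axis i 1))"
    proof (cases "x \<in> cimg c")
      case True
      then show ?thesis using dF[OF refl True] by simp
    next
      case False
      then have "x \<notin> K" using K(2) by blast
      then show ?thesis using dF0 False by simp
    qed
  qed
  also have "\<dots> = 0"
    by (simp add: Bochner_Integration.integral_sum[OF intF] integral_deriv_compact_support[OF FC1 K(1) F0])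
  finally show "(\<integral>p. f p * divc c X p \<partial>vol) = - (\<integral>p. differential A f p (X p) \<partial>vol)"
    using int by simp
qed

text \<open>The square of the positive part is the cheapest profile for a bump function that is continuously
  differentiable.\<close>

lemma positive_part_square_deriv: "((\<lambda>y. (max 0 y)\<^sup>2) has_real_derivative 2 * max 0 y) (at (y::real))"
proof (cases y "0::real" rule: linorder_cases)
  case less
  have "((\<lambda>y. (max 0 y)\<^sup>2) has_real_derivative 0) (at y)"
    by (rule has_field_derivative_transform_within_open[OF DERIV_const[of 0], where S = "{..<0}"])
      (use less in auto)
  then show ?thesis using less by (simp add: max_def)
next
  case equal
  have "((\<lambda>h::real. (max 0 h)\<^sup>2 / h) \<longlongrightarrow> 0) (at 0)"
  proof (rule Lim_null_comparison)
    show "\<forall>\<^sub>F h in at (0::real). norm ((max 0 h)\<^sup>2 / h) \<le> \<bar>h\<bar>"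
      by (intro always_eventually allI) (auto simp: max_def power2_eq_square)
    show "((\<lambda>h::real. \<bar>h\<bar>) \<longlongrightarrow> 0) (at 0)" by (auto intro!: tendsto_eq_intros)
  qed
  then show ?thesis using equal by (simp add: has_field_derivative_iff)
next
  case greater
  have "((\<lambda>y. (max 0 y)\<^sup>2) has_real_derivative 2 * y) (at y)"
    by (rule has_field_derivative_transform_within_open[where f = "\<lambda>y. y\<^sup>2" and S = "{0<..}"])
      (use greater in \<open>auto intro!: derivative_eq_intros\<close>)
  then show ?thesis using greater by (simp add: max_def)
qed

text \<open>In the chart this is the squared positive part of \<open>r\<^sup>2 - |x - a|\<^sup>2\<close>. In another chart it is of class
  \<open>C\<^sup>1\<close> on the overlap by composition and zero on the complement of a compact set; the two open sets
  cover.\<close>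

lemma bump_exists:
  assumes c: "c \<in> A" and r: "r > 0" "cball a r \<subseteq> cimg c"
  obtains \<phi> where "C1_fun \<phi>" "\<And>p. \<phi> p \<ge> 0" "\<And>p. p \<in> cinv c ` ball a r \<Longrightarrow> \<phi> p > 0"
    "\<And>p. p \<notin> cinv c ` cball a r \<Longrightarrow> \<phi> p = 0"
proof -
  define b where "b x = (max 0 (r\<^sup>2 - (x - a) \<bullet> (x - a)))\<^sup>2" for x
  define \<phi> where "\<phi> p = (if p \<in> cdom c then b (coord c p) else 0)" for p
  let ?S = "cinv c ` cball a r"
  have bC1: "Ck_on 1 UNIV b" unfolding b_def
  proof (rule C1_on_real_compose[where h = "\<lambda>y. (max 0 y)\<^sup>2" and h' = "\<lambda>y. 2 * max 0 y"])
    show "((\<lambda>y. (max 0 y)\<^sup>2) has_real_derivative 2 * max 0 y) (at y)" for y :: real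
      by (rule positive_part_square_deriv)
    show "Ck_on 1 UNIV (\<lambda>x. r\<^sup>2 - (x - a) \<bullet> (x - a))"
      by (rule C1_onI[where f' = "\<lambda>x v. - ((x - a) \<bullet> v + v \<bullet> (x - a))"])
        (auto intro!: derivative_eq_intros continuous_intros)
  qed (intro continuous_intros)
  have inb: "(x - a) \<bullet> (x - a) = (dist a x)\<^sup>2" for x
    by (simp add: dist_norm power2_norm_eq_inner inner_diff inner_commute)
  have b0: "b x = 0" if "x \<notin> cball a r" for x
  proof -
    have "r\<^sup>2 \<le> (dist a x)\<^sup>2" using that r(1) by (intro power_mono) auto
    then show ?thesis by (simp add: b_def inb max_def)
  qed
  have bpos: "b x > 0" if "x \<in> ball a r" for x
  proof -
    have "(dist a x)\<^sup>2 < r\<^sup>2" using that r(1) by (intro power_strict_mono) auto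
    then show ?thesis by (simp add: b_def inb max_def)
  qed
  have S: "compact ?S" "?S \<subseteq> cdom c"
    using r(2) cinv_in[OF c] by (auto intro!: compact_continuous_image continuous_on_subset[OF cont_cinv[OF c]])
  have oS: "open (- ?S)" using S(1) by (simp add: compact_imp_closed open_Compl)
  have z: "\<phi> p = 0" if "p \<notin> ?S" for p
  proof (cases "p \<in> cdom c")
    case True
    then have "coord c p \<notin> cball a r" using that cinv_coord[OF c True] by (metis imageI)
    then show ?thesis using True b0 by (simp add: \<phi>_def)
  qed (simp add: \<phi>_def)
  have "C1_fun \<phi>" unfolding C1_fun_def
  proof
    fix d assume d: "d \<in> A"
    let ?U = "coord d ` (cdom d \<inter> cdom c)" and ?V = "coord d ` (cdom d \<inter> - ?S)"
    have oU: "open ?U" and oV: "open ?V"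
      using open_coord_image[OF d] open_cdom[OF c] oS by auto
    have "Ck_on 1 ?U (b \<circ> (coord c \<circ> cinv d))"
      by (rule C1_on_compose[OF bC1 transition_C1[OF d c]]) simp
    then have 1: "Ck_on 1 ?U (\<phi> \<circ> cinv d)"
      by (rule Ck_on_cong[OF oU, rotated]) (use d in \<open>auto simp: \<phi>_def cinv_coord\<close>)
    have 2: "Ck_on 1 ?V (\<phi> \<circ> cinv d)"
      by (rule Ck_on_cong[OF oV _ C1_on_const[of _ 0]]) (use d z in \<open>auto simp: cinv_coord\<close>)
    have "?U \<union> ?V = coord d ` (cdom d \<inter> (cdom c \<union> - ?S))" by blast
    also have "cdom c \<union> - ?S = UNIV" using S(2) by blast
    finally have "?U \<union> ?V = cimg d" by simp
    then show "Ck_on 1 (cimg d) (\<phi> \<circ> cinv d)" using C1_on_Un[OF oU oV 1 2] by simp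
  qed
  moreover have "\<phi> p \<ge> 0" for p by (simp add: \<phi>_def b_def)
  moreover have "\<phi> p > 0" if "p \<in> cinv c ` ball a r" for p
  proof -
    obtain x where x: "x \<in> ball a r" "p = cinv c x" using \<open>p \<in> cinv c ` ball a r\<close> by blast
    then have "x \<in> cimg c" using r(2) ball_subset_cball by blast
    then show ?thesis using x bpos by (simp add: \<phi>_def cinv_in coord_cinv c)
  qed
  ultimately show thesis using z that by blast
qed

text \<open>Against any function supported in the overlap of the two charts, both coordinate expressions of
  the divergence integrate to the same number, because the other side of the integration by parts
  does not involve the chart. If their difference \<open>u\<close> were nonzero at \<open>p\<close>, a bump function supported
  where \<open>u\<close> has the sign of \<open>u p\<close> would separate them.\<close>

lemma divc_independent:
  assumes X: "C1_vector_field A X" and c: "c \<in> A" "p \<in> cdom c" and d: "d \<in> A" "p \<in> cdom d"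
  shows "divc c X p = divc d X p"
proof (rule ccontr)
  define u where "u q = divc c X q - divc d X q" for q
  assume "divc c X p \<noteq> divc d X p"
  then have up: "u p \<noteq> 0" by (simp add: u_def)
  let ?W = "cdom c \<inter> cdom d"
  have oW: "open ?W" by (intro open_Int open_cdom c d)
  have "continuous_on (cdom e) (\<lambda>q. divc e X q)" if "e \<in> A" for e
    by (rule continuous_cdomI[OF that continuous_divc[OF X that]])
  then have contu: "continuous_on ?W u"
    unfolding u_def using c d by (intro continuous_on_diff) (meson continuous_on_subset Int_lower1 Int_lower2)+
  \<comment> \<open>Where \<open>u\<close> is nonzero and has the sign of \<open>u p\<close>.\<close>
  define W' where "W' = ?W \<inter> (\<lambda>q. u q * u p) -` {0<..}"
  have oW': "open W'" unfolding W'_def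
    by (intro continuous_open_preimage continuous_on_mult contu continuous_on_const oW) auto
  have "u p * u p > 0" using up by (metis not_square_less_zero linorder_neqE_linordered_idom mult_eq_0_iff)
  then have pW': "p \<in> W'" using c d by (simp add: W'_def)
  have "open (coord c ` (cdom c \<inter> W'))" by (rule open_coord_image[OF c(1) oW'])
  moreover have "coord c p \<in> coord c ` (cdom c \<inter> W')" using pW' c by auto
  ultimately obtain r where r: "r > 0" "cball (coord c p) r \<subseteq> coord c ` (cdom c \<inter> W')"
    using open_contains_cball by blast
  let ?S = "cinv c ` cball (coord c p) r"
  have rc: "cball (coord c p) r \<subseteq> cimg c" using r by auto
  obtain \<phi> where \<phi>: "C1_fun \<phi>" "\<And>p. \<phi> p \<ge> 0" "\<And>q. q \<in> cinv c ` ball (coord c p) r \<Longrightarrow> \<phi> q > 0"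
    "\<And>q. q \<notin> ?S \<Longrightarrow> \<phi> q = 0"
    using bump_exists[OF c(1) r(1) rc] by blast
  have "p \<in> cinv c ` ball (coord c p) r" using r(1) cinv_coord[OF c] by (metis centre_in_ball imageI)
  then have \<phi>p: "\<phi> p > 0" using \<phi>(3) by blast
  have S: "compact ?S" using rc
    by (intro compact_continuous_image continuous_on_subset[OF cont_cinv[OF c(1)]]) auto
  have SW: "?S \<subseteq> W'"
  proof
    fix q assume "q \<in> ?S"
    then obtain x where "x \<in> cball (coord c p) r" "q = cinv c x" by blast
    with r(2) obtain q' where "q' \<in> cdom c" "q' \<in> W'" "x = coord c q'" by blast
    then show "q \<in> W'" using \<open>q = cinv c x\<close> cinv_coord[OF c(1)] by simp
  qed
  then have Sc: "?S \<subseteq> cdom c" "?S \<subseteq> cdom d" by (auto simp: W'_def)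
  note ic = local_integration_by_parts[OF X \<phi>(1) c(1) S Sc(1) \<phi>(4)]
  note id = local_integration_by_parts[OF X \<phi>(1) d(1) S Sc(2) \<phi>(4)]
  have contp: "continuous_on UNIV (\<lambda>q. \<phi> q * divc c X q)" "continuous_on UNIV (\<lambda>q. \<phi> q * divc d X q)"
    by (rule ic(2), assumption) (rule id(2), assumption)
  have inteq: "(\<integral>q. \<phi> q * divc c X q \<partial>vol) = (\<integral>q. \<phi> q * divc d X q \<partial>vol)"
    using ic(1) id(1) by simp
  define h where "h q = \<phi> q * u q * u p" for q
  have heq: "h q = (\<phi> q * divc c X q - \<phi> q * divc d X q) * u p" for q
    by (simp add: h_def u_def algebra_simps)
  have hc: "continuous_on UNIV h" unfolding heq[abs_def]
    by (rule continuous_on_mult_right[OF continuous_on_diff[OF contp]])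
  have "(\<integral>q. h q \<partial>vol) = 0"
    unfolding heq using contp[THEN integrable_continuous_mfd] inteq by simp
  moreover have hnn: "h q \<ge> 0" for q
  proof (cases "q \<in> ?S")
    case True
    then have "u q * u p > 0" using SW by (auto simp: W'_def)
    then show ?thesis using \<phi>(2)[of q] by (simp add: h_def mult.assoc)
  qed (simp add: h_def \<phi>(4))
  ultimately have "AE q in vol. h q = 0"
    using integral_nonneg_eq_0_iff_AE[OF integrable_continuous_mfd[OF hc]] by simp
  moreover have oh: "open {q. h q \<noteq> 0}"
    using hc by (intro open_Collect_neq) auto
  ultimately have "emeasure vol {q. h q \<noteq> 0} = 0"
    by (subst (asm) AE_iff_measurable[of "{q. h q \<noteq> 0}"]) auto
  then have "{q. h q \<noteq> 0} = {}" using open_vol_zero_empty[OF oh] by blast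
  moreover have "h p > 0" using \<phi>p \<open>u p * u p > 0\<close> by (simp add: h_def mult.assoc)
  ultimately show False by (metis (mono_tags) empty_iff less_irrefl mem_Collect_eq)
qed

lemma continuous_divergence:
  assumes X: "C1_vector_field A X"
  shows "continuous_on UNIV (divergence A g X)"
proof (rule continuous_mfdI)
  fix c assume c: "c \<in> A"
  have "divergence A g X (cinv c x) = divc c X (cinv c x)" if "x \<in> cimg c" for x
    unfolding divergence_divc by (rule divc_independent[OF X]) (use chart_at c cinv_in that in auto)
  then show "continuous_on (cimg c) (\<lambda>x. divergence A g X (cinv c x))"
    using continuous_divc[OF X c] by (simp cong: continuous_on_cong)
qed

text \<open>The functions \<open>U t = \<phi> t T / \<Phi>\<close> cut \<open>T\<close> into pieces that are each supported in one chart.\<close>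

theorem integration_by_parts:
  assumes X: "C1_vector_field A X" and T: "C1_fun T"
  shows "(\<integral>p. T p * divergence A g X p \<partial>vol) = - (\<integral>p. differential A T p (X p) \<partial>vol)"
proof -
  obtain F where F: "finite F" "\<And>c a r. (c, a, r) \<in> F \<Longrightarrow> c \<in> A \<and> r > 0 \<and> cball a r \<subseteq> cimg c"
    "\<And>p. \<exists>(c, a, r)\<in>F. p \<in> cinv c ` ball a r" by (rule finite_ball_cover) blast
  let ?P = "\<lambda>t \<phi>. C1_fun \<phi> \<and> (\<forall>p. \<phi> p \<ge> 0) \<and> (case t of (c, a, r) \<Rightarrow>
      (\<forall>p\<in>cinv c ` ball a r. \<phi> p > 0) \<and> (\<forall>p. p \<notin> cinv c ` cball a r \<longrightarrow> \<phi> p = 0))"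
  have "\<exists>\<phi>. ?P t \<phi>" if "t \<in> F" for t
  proof -
    obtain c a r where t: "t = (c, a, r)" by (cases t)
    then have "c \<in> A" "r > 0" "cball a r \<subseteq> cimg c" using F(2) that by auto
    then obtain \<phi> where "C1_fun \<phi>" "\<And>p. \<phi> p \<ge> 0" "\<And>p. p \<in> cinv c ` ball a r \<Longrightarrow> \<phi> p > 0"
      "\<And>p. p \<notin> cinv c ` cball a r \<Longrightarrow> \<phi> p = 0" using bump_exists by blast
    then show ?thesis unfolding t by auto
  qed
  then have "\<forall>t\<in>F. \<exists>\<phi>. ?P t \<phi>" by blast
  then obtain \<phi> where P: "\<forall>t\<in>F. ?P t (\<phi> t)" by (rule bchoice[THEN exE])
  have \<phi>: "\<And>t. t \<in> F \<Longrightarrow> C1_fun (\<phi> t)" "\<And>t p. t \<in> F \<Longrightarrow> \<phi> t p \<ge> 0"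
    "\<And>c a r p. (c, a, r) \<in> F \<Longrightarrow> p \<in> cinv c ` ball a r \<Longrightarrow> \<phi> (c, a, r) p > 0"
    "\<And>c a r p. (c, a, r) \<in> F \<Longrightarrow> p \<notin> cinv c ` cball a r \<Longrightarrow> \<phi> (c, a, r) p = 0"
    using P by fastforce+
  define \<Phi> where "\<Phi> p = (\<Sum>t\<in>F. \<phi> t p)" for p
  have pos: "\<Phi> p > 0" for p
  proof -
    obtain c a r where "(c, a, r) \<in> F" "p \<in> cinv c ` ball a r" using F(3)[of p] by auto
    then show ?thesis unfolding \<Phi>_def using \<phi> F(1) by (intro sum_pos2[of F "(c, a, r)"]) auto
  qed
  define U where "U t p = \<phi> t p * T p / \<Phi> p" for t p
  have UC1: "C1_fun (U t)" if "t \<in> F" for t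
    unfolding U_def \<Phi>_def[abs_def] using that \<phi>(1) T pos
    by (intro C1_fun_divide C1_fun_mult C1_fun_sum) (auto simp: \<Phi>_def less_imp_neq[symmetric])
  have sumU: "(\<Sum>t\<in>F. U t p) = T p" for p
    using pos[of p] by (simp add: U_def sum_divide_distrib[symmetric] sum_distrib_right[symmetric] \<Phi>_def[symmetric])
  have Xc: "cont_field X" by (rule C1_imp_cont_field[OF X])
  have loc: "(\<integral>p. U t p * divergence A g X p \<partial>vol) = - (\<integral>p. differential A (U t) p (X p) \<partial>vol)" if t: "t \<in> F" for t
  proof -
    obtain c a r where tt: "t = (c, a, r)" by (cases t)
    then have c: "c \<in> A" "cball a r \<subseteq> cimg c" using F(2) t by auto
    let ?S = "cinv c ` cball a r"
    have S: "compact ?S" "?S \<subseteq> cdom c" using c cinv_in[OF c(1)]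
      by (auto intro!: compact_continuous_image continuous_on_subset[OF cont_cinv[OF c(1)]])
    have z: "U t p = 0" if "p \<notin> ?S" for p using \<phi>(4)[of c a r p] t that by (simp add: tt U_def)
    have "U t p * divergence A g X p = U t p * divc c X p" for p
      using z[of p] S(2) divc_independent[OF X chart_at c(1)] divergence_divc by (cases "p \<in> ?S") auto
    then have "(\<lambda>p. U t p * divergence A g X p) = (\<lambda>p. U t p * divc c X p)" by (rule ext)
    then show ?thesis using local_integration_by_parts(1)[OF X UC1[OF t] c(1) S z] by simp
  qed
  have "(\<integral>p. T p * divergence A g X p \<partial>vol) = (\<integral>p. (\<Sum>t\<in>F. U t p * divergence A g X p) \<partial>vol)"
    by (simp add: sumU sum_distrib_right[symmetric])
  also have "\<dots> = (\<Sum>t\<in>F. \<integral>p. U t p * divergence A g X p \<partial>vol)"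
    by (intro Bochner_Integration.integral_sum integrable_continuous_mfd continuous_on_mult
        C1_fun_continuous UC1 continuous_divergence X)
  also have "\<dots> = - (\<Sum>t\<in>F. \<integral>p. differential A (U t) p (X p) \<partial>vol)"
    by (simp add: loc sum_negf)
  also have "(\<Sum>t\<in>F. \<integral>p. differential A (U t) p (X p) \<partial>vol) = (\<integral>p. (\<Sum>t\<in>F. differential A (U t) p (X p)) \<partial>vol)"
    by (intro Bochner_Integration.integral_sum[symmetric] integrable_continuous_mfd
        continuous_differential UC1 Xc)
  also have "\<dots> = (\<integral>p. differential A T p (X p) \<partial>vol)"
    using differential_sum[of F U, OF UC1] Xc
    by (simp add: sumU cont_field_def vector_field_in)
  finally show ?thesis .
qed

end

section \<open>Spaces of fields with a semi-inner product\<close>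

text \<open>Positive definiteness is replaced by nonnegativity, since fields that agree almost everywhere are
  not identified. The operations are those of fields rather than of a type class because fields
  carry no vector space structure as a type.\<close>

locale semi_inner_fields =
  fixes V :: "('m, 'n::finite) vfield set" and B :: "('m, 'n) vfield \<Rightarrow> ('m, 'n) vfield \<Rightarrow> real"
  assumes vzero_in: "vzero \<in> V"
    and vadd_in: "u \<in> V \<Longrightarrow> v \<in> V \<Longrightarrow> vadd u v \<in> V"
    and vscale_in: "u \<in> V \<Longrightarrow> vscale (\<lambda>_. a) u \<in> V"
    and sym: "u \<in> V \<Longrightarrow> v \<in> V \<Longrightarrow> B u v = B v u"
    and add_left: "u \<in> V \<Longrightarrow> v \<in> V \<Longrightarrow> w \<in> V \<Longrightarrow> B (vadd u v) w = B u w + B v w"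
    and scale_left: "u \<in> V \<Longrightarrow> w \<in> V \<Longrightarrow> B (vscale (\<lambda>_. a) u) w = a * B u w"
    and nonneg: "u \<in> V \<Longrightarrow> B u u \<ge> 0"

lemma vdiff_eq: "vdiff u v = vadd u (vscale (\<lambda>_. -1) v)"
  by (simp add: vdiff_def vadd_def vscale_def)

text \<open>The discriminant bound in a form that also covers the degenerate case \<open>b = 0\<close>.\<close>

lemma quadratic_nonneg_imp:
  fixes a b e :: real
  assumes nn: "\<And>t. 2 * t * a + t\<^sup>2 * b + e \<ge> 0" and b: "b \<ge> 0"
  shows "a\<^sup>2 \<le> e * b"
proof (cases "b = 0")
  case True
  have "a = 0"
  proof (rule ccontr)
    assume "a \<noteq> 0"
    then have "2 * (- (e + 1) / (2 * a)) * a = - (e + 1)" by simp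
    then show False using nn[of "- (e + 1) / (2 * a)"] True by simp
  qed
  then show ?thesis using True by simp
next
  case False
  then have "2 * (- a / b) * a + (- a / b)\<^sup>2 * b = - (a\<^sup>2 / b)"
    by (simp add: field_simps power2_eq_square)
  then have "a\<^sup>2 / b \<le> e" using nn[of "- a / b"] by linarith
  then show ?thesis using b False by (simp add: divide_le_eq)
qed

context semi_inner_fields begin

lemma vdiff_in: "u \<in> V \<Longrightarrow> v \<in> V \<Longrightarrow> vdiff u v \<in> V"
  by (simp add: vdiff_eq vadd_in vscale_in)

lemma diff_left: "u \<in> V \<Longrightarrow> v \<in> V \<Longrightarrow> w \<in> V \<Longrightarrow> B (vdiff u v) w = B u w - B v w"
  by (simp add: vdiff_eq add_left scale_left vscale_in)

lemma expand_line:
  assumes "u \<in> V" "h \<in> V"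
  shows "B (vadd u (vscale (\<lambda>_. t) h)) (vadd u (vscale (\<lambda>_. t) h)) = B u u + 2 * t * B u h + t\<^sup>2 * B h h"
proof -
  let ?w = "vadd u (vscale (\<lambda>_. t) h)"
  have w: "?w \<in> V" using assms vadd_in vscale_in by blast
  have r: "B v ?w = B v u + t * B v h" if "v \<in> V" for v
  proof -
    have "B v ?w = B ?w v" by (rule sym[OF that w])
    also have "\<dots> = B u v + t * B h v" using assms that by (simp add: add_left scale_left vscale_in)
    finally show ?thesis using sym[OF assms(1) that] sym[OF assms(2) that] by simp
  qed
  have "B ?w ?w = B u ?w + t * B h ?w"
    using assms w by (simp add: add_left scale_left vscale_in)
  then show ?thesis using sym[OF assms]
    by (simp add: r assms algebra_simps power2_eq_square)
qed

lemma cauchy_schwarz: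
  assumes "u \<in> V" "v \<in> V"
  shows "\<bar>B u v\<bar> \<le> sqrt (B u u) * sqrt (B v v)"
proof -
  have "(B u v)\<^sup>2 \<le> B u u * B v v"
  proof (rule quadratic_nonneg_imp)
    show "2 * t * B u v + t\<^sup>2 * B v v + B u u \<ge> 0" for t
      using nonneg[of "vadd u (vscale (\<lambda>_. t) v)"] assms
      by (simp add: expand_line vadd_in vscale_in)
  qed (rule nonneg[OF assms(2)])
  then show ?thesis
    by (metis real_sqrt_abs real_sqrt_le_iff real_sqrt_mult)
qed

text \<open>The functional \<open>J h = B h h - 2 L h\<close> is bounded below by \<open>- K\<^sup>2\<close>. If \<open>J s\<close> is within \<open>e\<^sup>2\<close> of the infimum,
  then the quadratic polynomial \<open>t \<mapsto> J (s + t h)\<close> stays above \<open>J s - e\<^sup>2\<close>, and its discriminant bounds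
  the error \<open>B s h - L h\<close>. In general an exact representing element requires completeness, which
  the space of smooth gradients lacks.\<close>

lemma approximate_riesz:
  assumes L_add: "\<And>u v. u \<in> V \<Longrightarrow> v \<in> V \<Longrightarrow> L (vadd u v) = L u + L v"
    and L_scale: "\<And>a u. u \<in> V \<Longrightarrow> L (vscale (\<lambda>_. a) u) = a * L u"
    and L_bound: "\<And>u. u \<in> V \<Longrightarrow> \<bar>L u\<bar> \<le> K * sqrt (B u u)"
    and e: "e > 0"
  shows "\<exists>s\<in>V. \<forall>h\<in>V. \<bar>B s h - L h\<bar> \<le> e * sqrt (B h h)"
proof -
  define J where "J h = B h h - 2 * L h" for h
  have low: "J h \<ge> - K\<^sup>2" if "h \<in> V" for h
  proof -
    have "0 \<le> (sqrt (B h h) - K)\<^sup>2" by simp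
    also have "\<dots> = B h h - 2 * (K * sqrt (B h h)) + K\<^sup>2"
      using nonneg[OF that] by (simp add: power2_diff algebra_simps)
    finally show ?thesis using L_bound[OF that] unfolding J_def by linarith
  qed
  have bdd: "bdd_below (J ` V)" using low by (rule bdd_belowI2)
  obtain s where s: "s \<in> V" "J s < (INF h\<in>V. J h) + e\<^sup>2"
    using cInf_lessD[of "J ` V" "(INF h\<in>V. J h) + e\<^sup>2"] vzero_in e by auto
  have "\<bar>B s h - L h\<bar> \<le> e * sqrt (B h h)" if h: "h \<in> V" for h
  proof -
    have "(B s h - L h)\<^sup>2 \<le> e\<^sup>2 * B h h"
    proof (rule quadratic_nonneg_imp)
      fix t
      let ?w = "vadd s (vscale (\<lambda>_. t) h)"
      have "?w \<in> V" using s h vadd_in vscale_in by blast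
      then have "(INF h\<in>V. J h) \<le> J ?w" using bdd by (rule cINF_lower[rotated])
      moreover have "J ?w = J s + 2 * t * (B s h - L h) + t\<^sup>2 * B h h"
        using s h by (simp add: J_def expand_line L_add L_scale vscale_in algebra_simps)
      ultimately show "2 * t * (B s h - L h) + t\<^sup>2 * B h h + e\<^sup>2 \<ge> 0" using s by linarith
    qed (rule nonneg[OF h])
    from real_sqrt_le_mono[OF this] show ?thesis using e by (simp add: real_sqrt_mult)
  qed
  then show ?thesis using s by blast
qed

text \<open>The difference \<open>h = s i - s j\<close> of two approximate representing elements satisfies
  \<open>B h h = B (s i) h - B (s j) h\<close>, where both terms are close to \<open>L h\<close>; this makes the sequence Cauchy.\<close>

lemma approximate_riesz_sequence:
  assumes L_add: "\<And>u v. u \<in> V \<Longrightarrow> v \<in> V \<Longrightarrow> L (vadd u v) = L u + L v"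
    and L_scale: "\<And>a u. u \<in> V \<Longrightarrow> L (vscale (\<lambda>_. a) u) = a * L u"
    and L_bound: "\<And>u. u \<in> V \<Longrightarrow> \<bar>L u\<bar> \<le> K * sqrt (B u u)"
  obtains s :: "nat \<Rightarrow> ('m, 'n) vfield" where "\<And>n. s n \<in> V"
    "\<And>n h. h \<in> V \<Longrightarrow> \<bar>B (s n) h - L h\<bar> \<le> (1/2)^n * sqrt (B h h)"
    "\<And>i j. sqrt (B (vdiff (s i) (s j)) (vdiff (s i) (s j))) \<le> (1/2)^i + (1/2)^j"
proof -
  have "\<exists>s\<in>V. \<forall>h\<in>V. \<bar>B s h - L h\<bar> \<le> (1/2)^n * sqrt (B h h)" for n :: nat
    by (rule approximate_riesz[OF assms]) auto
  then obtain s where s: "\<And>n. s n \<in> V" "\<And>n h. h \<in> V \<Longrightarrow> \<bar>B (s n) h - L h\<bar> \<le> (1/2)^n * sqrt (B h h)"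
    by metis
  have "sqrt (B (vdiff (s i) (s j)) (vdiff (s i) (s j))) \<le> (1/2)^i + (1/2)^j" for i j
  proof -
    let ?h = "vdiff (s i) (s j)"
    have h: "?h \<in> V" using s vdiff_in by blast
    have "B ?h ?h = (B (s i) ?h - L ?h) - (B (s j) ?h - L ?h)" using s h by (simp add: diff_left)
    also have "\<dots> \<le> ((1/2)^i + (1/2)^j) * sqrt (B ?h ?h)"
      using s(2)[OF h, of i] s(2)[OF h, of j] by (simp add: distrib_right)
    finally have *: "sqrt (B ?h ?h) * sqrt (B ?h ?h) \<le> ((1/2)^i + (1/2)^j) * sqrt (B ?h ?h)"
      using nonneg[OF h] by simp
    show ?thesis
    proof (cases "B ?h ?h = 0")
      case False
      then show ?thesis using mult_right_le_imp_le[OF *] nonneg[OF h] by simp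
    qed simp
  qed
  then show thesis using s that by blast
qed

end

section \<open>Square integrable fields\<close>

locale weighted_manifold = closed_riemannian_manifold A g vol
  for A :: "('m::{t2_space,second_countable_topology}, 'n::finite) chart set" and g vol +
  fixes \<rho> :: "'m \<Rightarrow> real"
  assumes density: "\<rho> \<in> smooth_positive_densities A vol"
begin

abbreviation "L2 \<equiv> L2_fields A g vol \<rho>"
abbreviation "ip2 \<equiv> L2_inner g vol \<rho>"

lemma rho_pos: "\<rho> p > 0" and rho_C1: "C1_fun \<rho>"
  and rho_smooth: "smooth_fun A \<rho>" and rho_int: "(\<integral>p. \<rho> p \<partial>vol) = 1"
  using density smooth_fun_C1 by (auto simp: smooth_positive_densities_def)

lemma rho_meas [measurable]: "\<rho> \<in> borel_measurable borel"
  using C1_fun_continuous[OF rho_C1] by (rule borel_measurable_continuous_onI)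

definition meas_field :: "('m, 'n) vfield \<Rightarrow> bool" where
  "meas_field u \<longleftrightarrow> vector_field A u \<and> (\<forall>c\<in>A. (\<lambda>p. u p c) \<in> borel_measurable borel)"

lemma L2_iff: "u \<in> L2 \<longleftrightarrow> meas_field u \<and> integrable vol (\<lambda>p. \<rho> p * g p (u p) (u p))"
  by (auto simp: L2_fields_def meas_field_def)

lemma meas_field_in: "meas_field u \<Longrightarrow> u p \<in> tangent_space A p"
  by (simp add: meas_field_def vector_field_def)

lemma finite_chart_cover: obtains C where "finite C" "C \<subseteq> A" "(\<Union>c\<in>C. cdom c) = UNIV"
proof -
  have cov: "UNIV \<subseteq> (\<Union>c\<in>A. cdom c)" using chart_ex by blast
  obtain C where C: "C \<subseteq> A" "finite C" "UNIV \<subseteq> (\<Union>c\<in>C. cdom c)"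
    using compactE_image[OF compact_UNIV open_cdom cov] .
  have "(\<Union>c\<in>C. cdom c) = UNIV" using C(3) by (rule subset_antisym[OF subset_UNIV])
  with C(2,1) show thesis by (rule that)
qed

lemma measurable_g:
  assumes u: "meas_field u" and v: "meas_field v"
  shows "(\<lambda>p. g p (u p) (v p)) \<in> borel_measurable borel"
proof -
  obtain C where C: "finite C" "C \<subseteq> A" "(\<Union>c\<in>C. cdom c) = UNIV" by (rule finite_chart_cover)
  show ?thesis
  proof (rule measurable_piecewise_restrict[of "cdom ` C"])
    show "countable (cdom ` C)" using C(1) by (simp add: countable_finite)
    show "space borel \<subseteq> \<Union> (cdom ` C)" using C(3) by simp
    show "\<Omega> \<inter> space borel \<in> sets borel" if "\<Omega> \<in> cdom ` C" for \<Omega> using that open_cdom C(2) by auto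
    fix \<Omega> assume "\<Omega> \<in> cdom ` C"
    then obtain c where c: "c \<in> A" "\<Omega> = cdom c" using C(2) by blast
    have [measurable]: "(\<lambda>p. gram A g c p $ i $ j) \<in> borel_measurable (restrict_space borel \<Omega>)" for i j
      unfolding c by (intro borel_measurable_continuous_on_restrict continuous_cdomI[OF c(1)]
          C1_on_imp_continuous_on[OF gram_C1[OF c(1)]])
    have comp: "(\<lambda>p. w p c $ i) \<in> borel_measurable (restrict_space borel \<Omega>)" if "meas_field w" for w i
    proof -
      have "(\<lambda>p. w p c) \<in> borel_measurable borel" using that c by (simp add: meas_field_def)
      then have "(\<lambda>p. w p c $ i) \<in> borel_measurable borel"
        by (rule borel_measurable_continuous_on[OF linear_continuous_on[OF bounded_linear_vec_nth]])
      then show ?thesis by (rule measurable_restrict_space1)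
    qed
    note [measurable] = comp[OF u] comp[OF v]
    have "(\<lambda>p. \<Sum>i\<in>UNIV. u p c $ i * (\<Sum>j\<in>UNIV. gram A g c p $ i $ j * v p c $ j))
        \<in> borel_measurable (restrict_space borel \<Omega>)" by measurable
    then show "(\<lambda>p. g p (u p) (v p)) \<in> borel_measurable (restrict_space borel \<Omega>)"
      by (rule measurable_cong[THEN iffD1, rotated])
        (use u v c in \<open>simp add: space_restrict_space g_coord meas_field_in inner_vec_def matrix_vector_mult_def\<close>)
  qed
qed

lemma meas_field_vadd: "meas_field u \<Longrightarrow> meas_field v \<Longrightarrow> meas_field (vadd u v)"
  unfolding meas_field_def vadd_def vector_field_def
  by (auto intro!: tangent_add borel_measurable_add simp del: split_paired_All)

lemma meas_field_vscale: "meas_field u \<Longrightarrow> meas_field (vscale (\<lambda>_. a) u)"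
  unfolding meas_field_def vscale_def vector_field_def
  by (auto intro!: tangent_scale borel_measurable_scaleR)

lemma meas_field_vdiff: "meas_field u \<Longrightarrow> meas_field v \<Longrightarrow> meas_field (vdiff u v)"
  unfolding vdiff_eq by (intro meas_field_vadd meas_field_vscale)

lemma g_add_right:
  "u \<in> tangent_space A p \<Longrightarrow> v \<in> tangent_space A p \<Longrightarrow> w \<in> tangent_space A p \<Longrightarrow>
    g p w (\<lambda>c. u c + v c) = g p w u + g p w v"
  by (simp add: g_sym[of w] tangent_add g_add)

lemma g_scale_right:
  "u \<in> tangent_space A p \<Longrightarrow> w \<in> tangent_space A p \<Longrightarrow> g p w (\<lambda>c. a *\<^sub>R u c) = a * g p w u"
  by (simp add: g_sym[of w] tangent_scale g_scale)

lemma g_expand: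
  assumes "u \<in> tangent_space A p" "v \<in> tangent_space A p"
  shows "g p (\<lambda>c. u c + v c) (\<lambda>c. u c + v c) = g p u u + 2 * g p u v + g p v v"
  using g_sym[OF assms] assms by (simp add: g_add g_add_right tangent_add)

text \<open>The arithmetic-geometric form of the Cauchy--Schwarz inequality. The weight \<open>t\<close> serves to trade a
  growing factor \<open>2\<^sup>n\<close> on one side against a summable factor \<open>(1/2)\<^sup>n\<close> on the other in \<open>riesz_fischer\<close>.\<close>

lemma g_weighted_young:
  assumes u: "u \<in> tangent_space A p" and v: "v \<in> tangent_space A p" and t: "t > 0"
  shows "2 * \<bar>g p u v\<bar> \<le> t * g p u u + g p v v / t"
proof -
  have "0 \<le> t\<^sup>2 * g p u u + 2 * (a * t) * g p u v + a\<^sup>2 * g p v v" for a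
    using g_nonneg[OF tangent_add[OF tangent_scale[OF u, of t] tangent_scale[OF v, of a]]] u v
    by (simp add: g_expand tangent_scale g_scale g_scale_right power2_eq_square mult_ac)
  from this[of 1] this[of "-1"] have "2 * t * \<bar>g p u v\<bar> \<le> t\<^sup>2 * g p u u + g p v v"
    by (auto simp: abs_if)
  then show ?thesis using t by (simp add: field_simps power2_eq_square)
qed

lemma L2_integrable:
  assumes u: "u \<in> L2" and v: "v \<in> L2"
  shows "integrable vol (\<lambda>p. \<rho> p * g p (u p) (v p))"
proof (rule Bochner_Integration.integrable_bound)
  have m: "meas_field u" "meas_field v" using assms by (auto simp: L2_iff)
  show "integrable vol (\<lambda>p. \<rho> p * g p (u p) (u p) + \<rho> p * g p (v p) (v p))"
    using assms by (simp add: L2_iff)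
  show "(\<lambda>p. \<rho> p * g p (u p) (v p)) \<in> borel_measurable vol"
    using measurable_g[OF m] by measurable
  have "\<bar>\<rho> p * g p (u p) (v p)\<bar> \<le> \<rho> p * g p (u p) (u p) + \<rho> p * g p (v p) (v p)" for p
  proof -
    have "\<bar>g p (u p) (v p)\<bar> \<le> g p (u p) (u p) + g p (v p) (v p)"
      using g_weighted_young[OF meas_field_in[OF m(1)] meas_field_in[OF m(2)], of 1 p] by simp
    then have "\<rho> p * \<bar>g p (u p) (v p)\<bar> \<le> \<rho> p * (g p (u p) (u p) + g p (v p) (v p))"
      using rho_pos[of p] by (intro mult_left_mono) auto
    then show ?thesis using rho_pos[of p] by (simp add: abs_mult distrib_left)
  qed
  then show "AE p in vol. norm (\<rho> p * g p (u p) (v p)) \<le>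
      norm (\<rho> p * g p (u p) (u p) + \<rho> p * g p (v p) (v p))"
    by (intro AE_I2) (smt (verit) real_norm_def)
qed

lemma L2_vadd:
  assumes u: "u \<in> L2" and v: "v \<in> L2"
  shows "vadd u v \<in> L2"
proof -
  have m: "meas_field u" "meas_field v" using assms by (auto simp: L2_iff)
  have "integrable vol (\<lambda>p. \<rho> p * g p (u p) (u p) + 2 * (\<rho> p * g p (u p) (v p)) + \<rho> p * g p (v p) (v p))"
    using assms L2_integrable by (simp add: L2_iff)
  moreover have "\<rho> p * g p (vadd u v p) (vadd u v p) =
      \<rho> p * g p (u p) (u p) + 2 * (\<rho> p * g p (u p) (v p)) + \<rho> p * g p (v p) (v p)" for p
    using m by (simp add: vadd_def g_expand meas_field_in algebra_simps)
  ultimately show ?thesis using m by (simp add: L2_iff meas_field_vadd)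
qed

lemma cont_field_in_L2:
  assumes u: "cont_field u"
  shows "u \<in> L2"
proof -
  have vf: "vector_field A u" using u by (simp add: cont_field_def)
  have "(\<lambda>p. u p c) \<in> borel_measurable borel" if c: "c \<in> A" for c
  proof -
    have "continuous_on (cdom c) (\<lambda>p. u p c)"
      using u c by (intro continuous_cdomI[OF c]) (simp add: cont_field_def)
    then have "(\<lambda>p. indicator (cdom c) p *\<^sub>R u p c) \<in> borel_measurable borel"
      using open_cdom[OF c] by (intro borel_measurable_continuous_on_indicator) auto
    moreover have "indicator (cdom c) p *\<^sub>R u p c = u p c" for p
      using tangent_outside[OF vector_field_in[OF vf], of c p] by (cases "p \<in> cdom c") auto
    ultimately show ?thesis by simp
  qed
  then show ?thesis using vf
    by (auto simp: L2_iff meas_field_def intro!: integrable_continuous_mfd continuous_on_mult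
        C1_fun_continuous[OF rho_C1] continuous_g[OF u u])
qed

sublocale L2: semi_inner_fields L2 ip2
proof
  fix u v w a
  show "vzero \<in> L2"
    using cont_field_in_L2[of vzero] by (simp add: cont_field_def vzero_def vector_field_def tangent_zero)
  show "vadd u v \<in> L2" if "u \<in> L2" "v \<in> L2" using that by (rule L2_vadd)
  show sc: "vscale (\<lambda>_. a) u \<in> L2" if "u \<in> L2" for a :: real
  proof -
    have m: "meas_field u" using that by (auto simp: L2_iff)
    have "\<rho> p * g p (vscale (\<lambda>_. a) u p) (vscale (\<lambda>_. a) u p) = a * a * (\<rho> p * g p (u p) (u p))" for p
      using meas_field_in[OF m] by (simp add: vscale_def g_scale g_scale_right tangent_scale)
    then have eq: "(\<lambda>p. \<rho> p * g p (vscale (\<lambda>_. a) u p) (vscale (\<lambda>_. a) u p)) =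
        (\<lambda>p. a * a * (\<rho> p * g p (u p) (u p)))" by (rule ext)
    show ?thesis using that m unfolding L2_iff eq by (auto intro: meas_field_vscale)
  qed
  show "ip2 u v = ip2 v u" if "u \<in> L2" "v \<in> L2"
    unfolding L2_inner_def using that g_sym by (simp add: L2_iff meas_field_in)
  show "ip2 (vadd u v) w = ip2 u w + ip2 v w" if "u \<in> L2" "v \<in> L2" "w \<in> L2"
  proof -
    have "\<rho> p * g p (vadd u v p) (w p) = \<rho> p * g p (u p) (w p) + \<rho> p * g p (v p) (w p)" for p
      using that by (simp add: vadd_def g_add L2_iff meas_field_in distrib_left)
    then show ?thesis unfolding L2_inner_def using that by (simp add: L2_integrable)
  qed
  show "ip2 (vscale (\<lambda>_. a) u) w = a * ip2 u w" if "u \<in> L2" "w \<in> L2"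
  proof -
    have "\<rho> p * g p (vscale (\<lambda>_. a) u p) (w p) = a * (\<rho> p * g p (u p) (w p))" for p
      using that by (simp add: vscale_def g_scale L2_iff meas_field_in)
    then show ?thesis unfolding L2_inner_def by (simp only: integral_mult_right_zero)
  qed
  show "ip2 u u \<ge> 0" if "u \<in> L2"
    unfolding L2_inner_def using that rho_pos
    by (intro Bochner_Integration.integral_nonneg mult_nonneg_nonneg g_nonneg)
      (auto simp: L2_iff meas_field_in less_imp_le)
qed

lemma nn_integral_L2:
  assumes "u \<in> L2"
  shows "(\<integral>\<^sup>+p. ennreal (\<rho> p * g p (u p) (u p)) \<partial>vol) = ennreal (ip2 u u)"
  unfolding L2_inner_def using assms rho_pos
  by (intro nn_integral_eq_integral) (auto simp: L2_iff meas_field_in g_nonneg less_imp_le)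

text \<open>Membership in \<open>L\<^sup>2\<close> from a bound on the nonnegative integral, as Fatou's lemma provides it.\<close>

lemma L2I:
  assumes m: "meas_field u" and le: "(\<integral>\<^sup>+p. ennreal (\<rho> p * g p (u p) (u p)) \<partial>vol) \<le> ennreal b"
    and b: "b \<ge> 0"
  shows "u \<in> L2" "ip2 u u \<le> b"
proof -
  have nn: "0 \<le> \<rho> p * g p (u p) (u p)" for p
    using rho_pos[of p] g_nonneg[OF meas_field_in[OF m]] by (simp add: less_imp_le)
  have [measurable]: "(\<lambda>p. \<rho> p * g p (u p) (u p)) \<in> borel_measurable vol"
    using measurable_g[OF m m] by measurable
  show *: "u \<in> L2"
    using m le nn by (auto simp: L2_iff intro!: integrableI_nonneg) (metis ennreal_less_top le_less_trans)
  show "ip2 u u \<le> b" using le b by (simp add: nn_integral_L2[OF *])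
qed

text \<open>The Gram matrix is invertible, so the component functionals are represented by tangent vectors.
  Componentwise convergence can then be derived from estimates in terms of \<open>g\<close> alone.\<close>

lemma dual_vector:
  assumes c: "c \<in> A" "p \<in> cdom c"
  shows "\<exists>z\<in>tangent_space A p. \<forall>w\<in>tangent_space A p. g p w z = w c $ i"
proof -
  have "det (gram A g c p) \<noteq> 0" using det_gram_pos[OF c] by simp
  then obtain b where b: "gram A g c p *v b = axis i 1"
    using cramer[of "gram A g c p" _ "axis i 1"] by iprover
  have "g p w (tangent_of A c p b) = w c $ i" if "w \<in> tangent_space A p" for w
    using g_coord[OF c that tangent_of_in[OF c]] tangent_of_self[OF c] b by (simp add: inner_axis)
  then show ?thesis using tangent_of_in[OF c] by blast
qed

lemma continuous_g_pointwise:
  assumes s: "\<And>n. s n \<in> tangent_space A p" and v: "v \<in> tangent_space A p"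
    and lim: "\<And>c. (\<lambda>n. s n c) \<longlonglongrightarrow> v c"
  shows "(\<lambda>n. g p (s n) (s n)) \<longlonglongrightarrow> g p v v"
proof -
  obtain c where c: "c \<in> A" "p \<in> cdom c" using chart_ex by blast
  show ?thesis unfolding g_coord[OF c s s] g_coord[OF c v v]
    by (intro tendsto_inner lim bounded_linear.tendsto[OF matrix_vector_mul_bounded_linear])
qed

text \<open>The rate of the Cauchy condition makes the sequence converge almost everywhere without passing to a
  subsequence: with \<open>e n p\<close> the squared length of \<open>s (n + 1) - s n\<close> at \<open>p\<close> times \<open>2\<^sup>n\<close>, the series of the
  \<open>e n p\<close> has a finite integral, hence converges on a set \<open>N\<close> of full measure, and on \<open>N\<close> the
  components of \<open>s n\<close> have summable increments. The limit is taken pointwise on \<open>N\<close> and set to zero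
  elsewhere, so that it is a tangent vector everywhere; Fatou's lemma gives the distance to \<open>s n\<close>.\<close>

lemma riesz_fischer:
  assumes s: "\<And>n. s n \<in> L2"
    and cauchy: "\<And>i j. sqrt (ip2 (vdiff (s i) (s j)) (vdiff (s i) (s j))) \<le> (1/2)^i + (1/2)^j"
  obtains v where "v \<in> L2" "\<And>n. sqrt (ip2 (vdiff v (s n)) (vdiff v (s n))) \<le> 2 * (1/2)^n"
proof -
  define D where "D i j = vdiff (s i) (s j)" for i j
  have DL: "D i j \<in> L2" for i j unfolding D_def by (rule L2.vdiff_in[OF s s])
  have Dm: "meas_field (D i j)" for i j using DL by (simp add: L2_iff)
  have sm: "meas_field (s n)" for n using s by (simp add: L2_iff)
  have Dbound: "ip2 (D i j) (D i j) \<le> ((1/2)^i + (1/2)^j)\<^sup>2" for i j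
    using cauchy[of i j] unfolding D_def by (rule sqrt_le_D)
  define e where "e n p = 2^n * g p (D (Suc n) n p) (D (Suc n) n p)" for n p
  have e0: "e n p \<ge> 0" for n p unfolding e_def using g_nonneg[OF meas_field_in[OF Dm]] by simp
  have em [measurable]: "e n \<in> borel_measurable borel" for n
    unfolding e_def[abs_def] using measurable_g[OF Dm Dm] by measurable
  define N where "N = {p. (\<Sum>n. ennreal (e n p)) < \<infinity>}"
  have N [measurable]: "N \<in> sets borel" unfolding N_def by measurable
  have "(\<integral>\<^sup>+p. (\<Sum>n. ennreal (\<rho> p * e n p)) \<partial>vol) = (\<Sum>n. \<integral>\<^sup>+p. ennreal (\<rho> p * e n p) \<partial>vol)"
    by (rule nn_integral_suminf) simp
  \<comment> \<open>The constant comes from \<open>2\<^sup>n ((1/2)\<^bsup>n+1\<^esup> + (1/2)\<^sup>n)\<^sup>2 = (3/2)\<^sup>2 (1/2)\<^sup>n\<close>.\<close>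
  also have "\<dots> \<le> (\<Sum>n. ennreal (9/4 * (1/2)^n))"
  proof (intro suminf_le allI)
    fix n
    have "(\<integral>\<^sup>+p. ennreal (\<rho> p * e n p) \<partial>vol) =
        (\<integral>\<^sup>+p. ennreal (2^n) * ennreal (\<rho> p * g p (D (Suc n) n p) (D (Suc n) n p)) \<partial>vol)"
      using rho_pos g_nonneg[OF meas_field_in[OF Dm]]
      by (intro nn_integral_cong) (simp add: e_def ennreal_mult[symmetric] mult_ac less_imp_le)
    also have "\<dots> = ennreal (2^n) * ennreal (ip2 (D (Suc n) n) (D (Suc n) n))"
      using measurable_g[OF Dm Dm] by (subst nn_integral_cmult) (auto simp: nn_integral_L2[OF DL])
    also have "\<dots> = ennreal (2^n * ip2 (D (Suc n) n) (D (Suc n) n))"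
      using L2.nonneg[OF DL] by (simp add: ennreal_mult)
    also have "\<dots> \<le> ennreal (9/4 * (1/2)^n)"
    proof (rule ennreal_leI)
      have "2^n * ip2 (D (Suc n) n) (D (Suc n) n) \<le> 2^n * ((1/2)^Suc n + (1/2)^n)\<^sup>2"
        by (intro mult_left_mono Dbound) auto
      also have "\<dots> = 9/4 * (1/2)^n" by (simp add: field_simps power2_eq_square)
      finally show "2^n * ip2 (D (Suc n) n) (D (Suc n) n) \<le> 9/4 * (1/2)^n" .
    qed
    finally show "(\<integral>\<^sup>+p. ennreal (\<rho> p * e n p) \<partial>vol) \<le> ennreal (9/4 * (1/2)^n)" .
  qed auto
  also have "\<dots> = ennreal (\<Sum>n. 9/4 * (1/2)^n)"
    by (intro suminf_ennreal2 summable_mult summable_geometric) auto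
  also have "\<dots> < \<infinity>" by simp
  finally have "AE p in vol. (\<Sum>n. ennreal (\<rho> p * e n p)) \<noteq> \<infinity>"
    by (intro nn_integral_PInf_AE) auto
  then have AEN: "AE p in vol. p \<in> N"
  proof eventually_elim
    fix p assume *: "(\<Sum>n. ennreal (\<rho> p * e n p)) \<noteq> \<infinity>"
    have "(\<Sum>n. ennreal (\<rho> p * e n p)) = ennreal (\<rho> p) * (\<Sum>n. ennreal (e n p))"
      using rho_pos[of p] e0 by (simp add: ennreal_mult less_imp_le)
    then show "p \<in> N" using * rho_pos[of p]
      by (auto simp: N_def ennreal_mult_eq_top_iff less_top[symmetric])
  qed
  have summ: "summable (\<lambda>n. e n p)" if "p \<in> N" for p
    using that e0 by (intro summable_suminf_not_top) (auto simp: N_def)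
  have conv: "convergent (\<lambda>n. s n p c)" if p: "p \<in> N" for p c
  proof (cases "c \<in> A \<and> p \<in> cdom c")
    case False
    then have "s n p c = 0" for n using tangent_outside[OF meas_field_in[OF sm]] by blast
    then show ?thesis by (simp add: convergent_const)
  next
    case True
    have "summable (\<lambda>n. (s (Suc n) p c - s n p c) $ i)" for i
    proof -
     obtain z where z: "z \<in> tangent_space A p" "\<And>w. w \<in> tangent_space A p \<Longrightarrow> g p w z = w c $ i"
       using dual_vector[of c p i] True by blast
     show ?thesis
     proof (rule summable_comparison_test')
      show "summable (\<lambda>n. e n p + (1/2)^n * g p z z)"
        by (intro summable_add summ p summable_mult2 summable_geometric) auto
      fix n :: nat
      let ?d = "D (Suc n) n p"
      have d: "?d \<in> tangent_space A p" by (rule meas_field_in[OF Dm])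
      have "(s (Suc n) p c - s n p c) $ i = g p ?d z" using z(2)[OF d] by (simp add: D_def vdiff_def)
      moreover have "2 * \<bar>g p ?d z\<bar> \<le> 2^n * g p ?d ?d + g p z z / 2^n"
        by (rule g_weighted_young[OF d z(1)]) simp
      moreover have "g p z z / 2^n = (1/2)^n * g p z z" by (simp add: power_divide)
      ultimately show "norm ((s (Suc n) p c - s n p c) $ i) \<le> e n p + (1/2)^n * g p z z"
        unfolding e_def real_norm_def by linarith
     qed
    qed
    then have "convergent (\<lambda>n. s n p c $ i)" for i
    proof -
      have "(\<lambda>n. \<Sum>k<n. s (Suc k) p c $ i - s k p c $ i) \<longlonglongrightarrow> (\<Sum>k. s (Suc k) p c $ i - s k p c $ i)"
        using \<open>\<And>i. summable (\<lambda>n. (s (Suc n) p c - s n p c) $ i)\<close>[of i]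
        by (intro summable_LIMSEQ) simp
      then have "(\<lambda>n. (s n p c $ i - s 0 p c $ i) + s 0 p c $ i) \<longlonglongrightarrow>
          (\<Sum>k. s (Suc k) p c $ i - s k p c $ i) + s 0 p c $ i"
        unfolding sum_lessThan_telescope[of "\<lambda>k. s k p c $ i"] by (rule tendsto_add) (rule tendsto_const)
      then show ?thesis by (auto intro: convergentI)
    qed
    then obtain l where "\<And>i. (\<lambda>n. s n p c $ i) \<longlonglongrightarrow> l i" unfolding convergent_def by metis
    then have "(\<lambda>n. s n p c) \<longlonglongrightarrow> (\<chi> i. l i)" by (intro vec_tendstoI) simp
    then show ?thesis by (rule convergentI)
  qed
  define v where "v p c = (if p \<in> N then lim (\<lambda>n. s n p c) else 0)" for p c
  have vlim: "(\<lambda>n. s n p c) \<longlonglongrightarrow> v p c" if "p \<in> N" for p c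
    using conv[OF that, of c] that by (simp add: v_def convergent_LIMSEQ_iff)
  have vT: "v p \<in> tangent_space A p" for p
  proof (cases "p \<in> N")
    case True
    show ?thesis
    proof (rule tangent_spaceI)
      fix c assume "\<not> (c \<in> A \<and> p \<in> cdom c)"
      then have "s n p c = 0" for n using tangent_outside[OF meas_field_in[OF sm]] by blast
      then show "v p c = 0" using vlim[OF True, of c] by (simp add: LIMSEQ_const_iff)
    next
      fix c d assume cd: "c \<in> A" "d \<in> A" "p \<in> cdom c" "p \<in> cdom d"
      have "bounded_linear (jac c d p)" using linear_jac[OF cd] by (simp add: linear_conv_bounded_linear)
      then have "(\<lambda>n. jac c d p (s n p c)) \<longlonglongrightarrow> jac c d p (v p c)"
        using vlim[OF True] by (rule bounded_linear.tendsto)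
      moreover have "(\<lambda>n. jac c d p (s n p c)) = (\<lambda>n. s n p d)"
        using tangent_jac[OF meas_field_in[OF sm] cd] by (intro ext) (rule sym)
      ultimately show "v p d = jac c d p (v p c)" using vlim[OF True, of d] LIMSEQ_unique by metis
    qed
  next
    case False
    then show ?thesis using tangent_zero[of p] by (simp add: v_def[abs_def])
  qed
  have vm: "meas_field v"
    unfolding meas_field_def
  proof (intro conjI ballI)
    show "vector_field A v" using vT by (simp add: vector_field_def)
    fix c assume c: "c \<in> A"
    show "(\<lambda>p. v p c) \<in> borel_measurable borel"
    proof (rule borel_measurable_LIMSEQ_metric)
      show "(\<lambda>p. indicator N p *\<^sub>R s n p c) \<in> borel_measurable borel" for n
        using sm[of n] c by (intro borel_measurable_scaleR borel_measurable_indicator N)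
          (simp add: meas_field_def)
      show "(\<lambda>n. indicator N p *\<^sub>R s n p c) \<longlonglongrightarrow> v p c" for p
        using vlim[of p c] by (cases "p \<in> N") (simp_all add: v_def)
    qed
  qed
  have main: "vdiff v (s n) \<in> L2 \<and> ip2 (vdiff v (s n)) (vdiff v (s n)) \<le> (2 * (1/2)^n)\<^sup>2" for n
  proof -
    let ?w = "vdiff v (s n)"
    have wm: "meas_field ?w" by (rule meas_field_vdiff[OF vm sm])
    have "AE p in vol. ennreal (\<rho> p * g p (?w p) (?w p)) =
        liminf (\<lambda>m. ennreal (\<rho> p * g p (D m n p) (D m n p)))"
      using AEN
    proof eventually_elim
      fix p assume p: "p \<in> N"
      have "(\<lambda>m. g p (D m n p) (D m n p)) \<longlonglongrightarrow> g p (?w p) (?w p)"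
        by (rule continuous_g_pointwise[OF meas_field_in[OF Dm] meas_field_in[OF wm]])
          (auto simp: D_def vdiff_def intro!: tendsto_intros vlim p)
      then have "(\<lambda>m. ennreal (\<rho> p * g p (D m n p) (D m n p))) \<longlonglongrightarrow> ennreal (\<rho> p * g p (?w p) (?w p))"
        by (intro tendsto_ennrealI tendsto_mult tendsto_const)
      then show "ennreal (\<rho> p * g p (?w p) (?w p)) = liminf (\<lambda>m. ennreal (\<rho> p * g p (D m n p) (D m n p)))"
        by (intro lim_imp_Liminf[symmetric]) auto
    qed
    then have "(\<integral>\<^sup>+p. ennreal (\<rho> p * g p (?w p) (?w p)) \<partial>vol) =
        (\<integral>\<^sup>+p. liminf (\<lambda>m. ennreal (\<rho> p * g p (D m n p) (D m n p))) \<partial>vol)"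
      by (rule nn_integral_cong_AE)
    also have "\<dots> \<le> liminf (\<lambda>m. \<integral>\<^sup>+p. ennreal (\<rho> p * g p (D m n p) (D m n p)) \<partial>vol)"
      using measurable_g[OF Dm Dm] by (intro nn_integral_liminf) measurable
    also have "\<dots> = liminf (\<lambda>m. ennreal (ip2 (D m n) (D m n)))" by (simp add: nn_integral_L2[OF DL])
    also have "\<dots> \<le> ennreal ((2 * (1/2)^n)\<^sup>2)"
    proof (rule Liminf_le)
      show "\<forall>\<^sub>F m in sequentially. ennreal (ip2 (D m n) (D m n)) \<le> ennreal ((2 * (1/2)^n)\<^sup>2)"
        using eventually_ge_at_top[of n]
      proof eventually_elim
        fix m assume "n \<le> m"
        then have "(1/2::real)^m \<le> (1/2)^n" by (intro power_decreasing) auto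
        then have "((1/2)^m + (1/2)^n)\<^sup>2 \<le> (2 * (1/2::real)^n)\<^sup>2" by (intro power_mono) auto
        then show "ennreal (ip2 (D m n) (D m n)) \<le> ennreal ((2 * (1/2)^n)\<^sup>2)"
          using Dbound[of m n] by (intro ennreal_leI) linarith
      qed
    qed simp
    finally show ?thesis using L2I[OF wm] by simp
  qed
  show thesis
  proof (rule that)
    have "v = vadd (vdiff v (s 0)) (s 0)" by (simp add: vadd_def vdiff_def)
    then show "v \<in> L2" using L2_vadd main s by metis
    show "sqrt (ip2 (vdiff v (s n)) (vdiff v (s n))) \<le> 2 * (1/2)^n" for n
      using main[of n] by (intro real_le_lsqrt) auto
  qed
qed


section \<open>The horizontal projection\<close>

abbreviation "gradients \<equiv> {grad A g \<phi> | \<phi>. smooth_fun A \<phi>}"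

lemma cont_field_grad: "smooth_fun A \<phi> \<Longrightarrow> cont_field (grad A g \<phi>)"
  by (rule C1_imp_cont_field[OF grad_C1])

lemma grad_L2: "smooth_fun A \<phi> \<Longrightarrow> grad A g \<phi> \<in> L2"
  by (rule cont_field_in_L2[OF cont_field_grad])

lemma smooth_add_scale:
  assumes "smooth_fun A \<phi>" "smooth_fun A \<psi>"
  shows "smooth_fun A (\<lambda>p. \<phi> p + a * \<psi> p)"
  using assms open_cimg unfolding smooth_fun_def o_def by (intro ballI smooth_on_add_scale) auto

lemma grad_add_scale:
  assumes \<phi>: "smooth_fun A \<phi>" and \<psi>: "smooth_fun A \<psi>"
  shows "grad A g (\<lambda>p. \<phi> p + a * \<psi> p) = vadd (grad A g \<phi>) (vscale (\<lambda>_. a) (grad A g \<psi>))"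
proof
  fix p
  note C1 = smooth_fun_C1[OF \<phi>] smooth_fun_C1[OF \<psi>] smooth_fun_C1[OF smooth_add_scale[OF \<phi> \<psi>, of a]]
  note in_T = grad_in[OF C1(1)] grad_in[OF C1(2)] grad_in[OF C1(3)]
  show "grad A g (\<lambda>p. \<phi> p + a * \<psi> p) p = vadd (grad A g \<phi>) (vscale (\<lambda>_. a) (grad A g \<psi>)) p"
    unfolding vadd_def vscale_def
  proof (rule g_nondegenerate[OF in_T(3) tangent_add[OF in_T(1) tangent_scale[OF in_T(2)]]])
    fix w assume w: "w \<in> tangent_space A p"
    show "g p (grad A g (\<lambda>p. \<phi> p + a * \<psi> p) p) w = g p (\<lambda>c. grad A g \<phi> p c + a *\<^sub>R grad A g \<psi> p c) w"
      using w C1 in_T by (simp add: g_add g_scale tangent_scale g_grad differential_add_scale)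
  qed
qed

sublocale gradients: semi_inner_fields gradients ip2
proof
  fix u v w :: "('m, 'n) vfield" and a :: real
  have comb: "vadd u (vscale (\<lambda>_. a) v) \<in> gradients" if "u \<in> gradients" "v \<in> gradients" for u v and a :: real
  proof -
    obtain \<phi> \<psi> where *: "u = grad A g \<phi>" "smooth_fun A \<phi>" "v = grad A g \<psi>" "smooth_fun A \<psi>"
      using \<open>u \<in> gradients\<close> \<open>v \<in> gradients\<close> by blast
    have "vadd u (vscale (\<lambda>_. a) v) = grad A g (\<lambda>p. \<phi> p + a * \<psi> p)"
      unfolding * by (rule grad_add_scale[OF *(2,4), symmetric])
    then show ?thesis using smooth_add_scale[OF *(2,4)] by blast
  qed
  \<comment> \<open>Any smooth function would do to see that the set of gradients is nonempty; \<open>\<rho>\<close> is at hand.\<close>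
  have zero: "vzero = vadd (grad A g \<rho>) (vscale (\<lambda>_. -1) (grad A g \<rho>))"
    by (simp add: vzero_def vadd_def vscale_def)
  show z: "vzero \<in> gradients" unfolding zero using rho_smooth by (intro comb) blast+
  show "vadd u v \<in> gradients" if "u \<in> gradients" "v \<in> gradients"
    using comb[OF that, of 1] by (simp add: vadd_def vscale_def)
  show "vscale (\<lambda>_. a) u \<in> gradients" if "u \<in> gradients"
    using comb[OF z that, of a] by (simp add: vadd_def vscale_def vzero_def)
  have sub: "u \<in> L2" if "u \<in> gradients" for u using that grad_L2 by blast
  show "ip2 u v = ip2 v u" if "u \<in> gradients" "v \<in> gradients" using that sub L2.sym by blast
  show "ip2 (vadd u v) w = ip2 u w + ip2 v w" if "u \<in> gradients" "v \<in> gradients" "w \<in> gradients"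
    using that sub L2.add_left by blast
  show "ip2 (vscale (\<lambda>_. a) u) w = a * ip2 u w" if "u \<in> gradients" "w \<in> gradients"
    using that sub L2.scale_left by blast
  show "ip2 u u \<ge> 0" if "u \<in> gradients" using that sub L2.nonneg by blast
qed

lemma horizontal_L2: "u \<in> horizontal_space A g vol \<rho> \<Longrightarrow> u \<in> L2"
  by (simp add: horizontal_space_def)

lemma grad_horizontal:
  assumes "smooth_fun A \<phi>"
  shows "grad A g \<phi> \<in> horizontal_space A g vol \<rho>"
proof -
  let ?u = "grad A g \<phi>"
  have "ip2 (vdiff ?u ?u) (vdiff ?u ?u) = 0"
    using L2.diff_left[OF grad_L2 grad_L2 L2.vdiff_in, OF assms assms grad_L2 grad_L2, OF assms assms] by simp
  then have "sqrt (ip2 (vdiff ?u ?u) (vdiff ?u ?u)) < e" if "e > 0" for e using that by simp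
  then show ?thesis using assms grad_L2 by (auto simp: horizontal_space_def)
qed

text \<open>The approximate representing gradients \<open>s n\<close> of the functional \<open>h \<mapsto> \<langle>h, w\<rangle>\<close> converge to a field \<open>v\<close> in the
  closure of the gradients. Passing to the limit, \<open>w - v\<close> is orthogonal to all gradients, and by the
  Cauchy--Schwarz inequality to their closure.\<close>

lemma horizontal_projection_exists:
  assumes w: "w \<in> L2"
  shows "\<exists>v\<in>horizontal_space A g vol \<rho>. \<forall>h\<in>horizontal_space A g vol \<rho>. ip2 (vdiff w v) h = 0"
proof -
  have sub: "u \<in> L2" if "u \<in> gradients" for u using that grad_L2 by blast
  obtain s where s: "\<And>n. s n \<in> gradients"
    and repr: "\<And>n h. h \<in> gradients \<Longrightarrow> \<bar>ip2 (s n) h - ip2 h w\<bar> \<le> (1/2)^n * sqrt (ip2 h h)"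
    and cauchy: "\<And>i j. sqrt (ip2 (vdiff (s i) (s j)) (vdiff (s i) (s j))) \<le> (1/2)^i + (1/2)^j"
  proof (rule gradients.approximate_riesz_sequence[of "\<lambda>h. ip2 h w" "sqrt (ip2 w w)"])
    show "\<bar>ip2 u w\<bar> \<le> sqrt (ip2 w w) * sqrt (ip2 u u)" if "u \<in> gradients" for u
      using L2.cauchy_schwarz[OF sub[OF that] w] by (simp add: mult.commute)
    show "ip2 (vadd u v) w = ip2 u w + ip2 v w" if "u \<in> gradients" "v \<in> gradients" for u v
      by (rule L2.add_left[OF sub[OF that(1)] sub[OF that(2)] w])
    show "ip2 (vscale (\<lambda>_. a) u) w = a * ip2 u w" if "u \<in> gradients" for a u
      by (rule L2.scale_left[OF sub[OF that] w])
  qed blast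
  obtain v where v: "v \<in> L2" and lim: "\<And>n. sqrt (ip2 (vdiff v (s n)) (vdiff v (s n))) \<le> 2 * (1/2)^n"
    using riesz_fischer[OF sub[OF s] cauchy] by blast
  have small: "\<exists>n. K * (1/2)^n < e" if "e > 0" for e K :: real
  proof -
    have "(\<lambda>n. K * (1/2)^n) \<longlonglongrightarrow> K * 0" by (intro tendsto_intros LIMSEQ_realpow_zero) auto
    then have "\<forall>\<^sub>F n in sequentially. K * (1/2)^n < e" using that by (simp add: order_tendstoD)
    then show ?thesis by (auto simp: eventually_sequentially)
  qed
  have vh: "v \<in> horizontal_space A g vol \<rho>"
  proof -
    have "\<exists>\<phi>. smooth_fun A \<phi> \<and> sqrt (ip2 (vdiff v (grad A g \<phi>)) (vdiff v (grad A g \<phi>))) < e" if "e > 0" for e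
    proof -
      obtain n where "2 * (1/2::real)^n < e" using small[OF \<open>e > 0\<close>] by blast
      moreover obtain \<phi> where "smooth_fun A \<phi>" "s n = grad A g \<phi>" using s[of n] by blast
      ultimately show ?thesis using lim[of n] by (intro exI[of _ \<phi>]) auto
    qed
    then show ?thesis using v by (simp add: horizontal_space_def)
  qed
  have wv: "vdiff w v \<in> L2" by (rule L2.vdiff_in[OF w v])
  have orth: "ip2 (vdiff w v) h = 0" if h: "h \<in> gradients" for h
  proof (rule ccontr)
    assume ne: "ip2 (vdiff w v) h \<noteq> 0"
    have hL: "h \<in> L2" by (rule sub[OF h])
    obtain n where n: "3 * sqrt (ip2 h h) * (1/2)^n < \<bar>ip2 (vdiff w v) h\<bar>" using small ne by (meson zero_less_abs_iff)
    have "\<bar>ip2 v h - ip2 (s n) h\<bar> \<le> sqrt (ip2 (vdiff v (s n)) (vdiff v (s n))) * sqrt (ip2 h h)"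
      using L2.cauchy_schwarz[OF L2.vdiff_in[OF v sub[OF s]] hL] L2.diff_left[OF v sub[OF s] hL] by simp
    also have "\<dots> \<le> 2 * (1/2)^n * sqrt (ip2 h h)"
      using lim[of n] L2.nonneg[OF hL] by (intro mult_right_mono) auto
    finally have "\<bar>ip2 v h - ip2 (s n) h\<bar> \<le> 2 * (1/2)^n * sqrt (ip2 h h)" .
    then have "\<bar>ip2 w h - ip2 v h\<bar> \<le> 3 * sqrt (ip2 h h) * (1/2)^n"
      using repr[OF h, of n] L2.sym[OF w hL] by (simp add: mult_ac)
    then show False using n L2.diff_left[OF w v hL] by simp
  qed
  have "ip2 (vdiff w v) h = 0" if h: "h \<in> horizontal_space A g vol \<rho>" for h
  proof (rule ccontr)
    assume ne: "ip2 (vdiff w v) h \<noteq> 0"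
    have hL: "h \<in> L2" by (rule horizontal_L2[OF h])
    \<comment> \<open>The summand \<open>1\<close> keeps \<open>K\<close> positive when \<open>w - v\<close> has norm zero.\<close>
    define K where "K = sqrt (ip2 (vdiff w v) (vdiff w v)) + 1"
    have K: "K > 0" unfolding K_def using L2.nonneg[OF wv] by (simp add: add_nonneg_pos)
    have "\<bar>ip2 (vdiff w v) h\<bar> / K > 0" using ne K by simp
    then obtain \<phi> where \<phi>: "smooth_fun A \<phi>"
      "sqrt (ip2 (vdiff h (grad A g \<phi>)) (vdiff h (grad A g \<phi>))) < \<bar>ip2 (vdiff w v) h\<bar> / K"
      using h unfolding horizontal_space_def by blast
    let ?d = "vdiff h (grad A g \<phi>)"
    have gL: "grad A g \<phi> \<in> L2" by (rule grad_L2[OF \<phi>(1)])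
    have dL: "?d \<in> L2" by (rule L2.vdiff_in[OF hL gL])
    have "ip2 (vdiff w v) ?d = ip2 (vdiff w v) h - ip2 (vdiff w v) (grad A g \<phi>)"
      using L2.diff_left[OF hL gL wv] L2.sym[OF wv] hL gL dL by simp
    also have "ip2 (vdiff w v) (grad A g \<phi>) = 0" using orth \<phi>(1) by blast
    finally have "\<bar>ip2 (vdiff w v) h\<bar> \<le> sqrt (ip2 (vdiff w v) (vdiff w v)) * sqrt (ip2 ?d ?d)"
      using L2.cauchy_schwarz[OF wv dL] by simp
    also have "\<dots> \<le> K * sqrt (ip2 ?d ?d)"
      using L2.nonneg[OF dL] by (intro mult_right_mono) (auto simp: K_def)
    also have "\<dots> < \<bar>ip2 (vdiff w v) h\<bar>" using \<phi>(2) K by (simp add: pos_less_divide_eq mult.commute)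
    finally show False by simp
  qed
  then show ?thesis using vh by blast
qed

lemma horizontal_projection:
  assumes "w \<in> L2"
  shows "horizontal_projection A g vol \<rho> w \<in> horizontal_space A g vol \<rho>"
    and "h \<in> horizontal_space A g vol \<rho> \<Longrightarrow> ip2 (vdiff w (horizontal_projection A g vol \<rho> w)) h = 0"
proof -
  let ?P = "\<lambda>v. v \<in> horizontal_space A g vol \<rho> \<and> (\<forall>h\<in>horizontal_space A g vol \<rho>. ip2 (vdiff w v) h = 0)"
  have "\<exists>v. ?P v" using horizontal_projection_exists[OF assms] by blast
  from someI_ex[OF this] have "?P (horizontal_projection A g vol \<rho> w)"
    unfolding horizontal_projection_def .
  then show "horizontal_projection A g vol \<rho> w \<in> horizontal_space A g vol \<rho>"
    "h \<in> horizontal_space A g vol \<rho> \<Longrightarrow> ip2 (vdiff w (horizontal_projection A g vol \<rho> w)) h = 0" by auto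
qed

section \<open>The adjoint of the inclusion\<close>

lemma g_le_norm:
  assumes c: "c \<in> A" and S: "compact S" "S \<subseteq> cdom c"
  obtains G where "G \<ge> 0" "\<And>p v. p \<in> S \<Longrightarrow> v \<in> tangent_space A p \<Longrightarrow> g p v v \<le> G * (norm (v c))\<^sup>2"
proof -
  let ?q = "\<lambda>p. \<Sum>i\<in>UNIV. \<Sum>j\<in>UNIV. \<bar>gram A g c p $ i $ j\<bar>"
  have gc: "continuous_on (cdom c) (\<lambda>p. gram A g c p $ i $ j)" for i j
    by (intro continuous_cdomI[OF c] C1_on_imp_continuous_on[OF gram_C1[OF c]])
  have "continuous_on S ?q"
    by (intro continuous_intros continuous_on_subset[OF gc S(2)])
  from compact_imp_bounded[OF compact_continuous_image[OF this S(1)]]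
  obtain G where "\<forall>y\<in>?q ` S. norm y \<le> G" unfolding bounded_iff by blast
  then have G: "?q p \<le> \<bar>G\<bar>" if "p \<in> S" for p using that by force
  have "g p v v \<le> \<bar>G\<bar> * (norm (v c))\<^sup>2" if p: "p \<in> S" and v: "v \<in> tangent_space A p" for p v
  proof -
    have "p \<in> cdom c" using p S(2) by blast
    from g_coord[OF c this v v]
    have "g p v v = (\<Sum>i\<in>UNIV. \<Sum>j\<in>UNIV. v c $ i * (gram A g c p $ i $ j * v c $ j))"
      by (simp add: inner_vec_def matrix_vector_mult_def sum_distrib_left)
    also have "\<dots> \<le> (\<Sum>i\<in>UNIV. \<Sum>j\<in>UNIV. \<bar>gram A g c p $ i $ j\<bar> * (norm (v c))\<^sup>2)"
    proof (intro sum_mono)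
      fix i j
      have "\<bar>v c $ i\<bar> * \<bar>v c $ j\<bar> \<le> norm (v c) * norm (v c)"
        by (intro mult_mono component_le_norm_cart) auto
      then have "\<bar>gram A g c p $ i $ j\<bar> * (\<bar>v c $ i\<bar> * \<bar>v c $ j\<bar>) \<le> \<bar>gram A g c p $ i $ j\<bar> * (norm (v c))\<^sup>2"
        by (intro mult_left_mono) (auto simp: power2_eq_square)
      moreover have "v c $ i * (gram A g c p $ i $ j * v c $ j) \<le> \<bar>gram A g c p $ i $ j\<bar> * (\<bar>v c $ i\<bar> * \<bar>v c $ j\<bar>)"
        by (rule order_trans[OF abs_ge_self]) (simp add: abs_mult mult_ac)
      ultimately show "v c $ i * (gram A g c p $ i $ j * v c $ j) \<le> \<bar>gram A g c p $ i $ j\<bar> * (norm (v c))\<^sup>2"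
        by linarith
    qed
    also have "\<dots> = ?q p * (norm (v c))\<^sup>2" by (simp add: sum_distrib_right)
    also have "\<dots> \<le> \<bar>G\<bar> * (norm (v c))\<^sup>2" using G[OF p] by (intro mult_right_mono) auto
    finally show ?thesis .
  qed
  then show thesis using that[of "\<bar>G\<bar>"] by simp
qed

lemma hilbert_semi_inner:
  assumes "hilbert_space_of_fields A H ip"
  shows "semi_inner_fields H ip"
proof
  fix u v w :: "('m, 'n) vfield" and a :: real
  show z: "vzero \<in> H" using assms by (simp add: hilbert_space_of_fields_def)
  show "vadd u v \<in> H" if "u \<in> H" "v \<in> H" using that assms by (simp add: hilbert_space_of_fields_def)
  show "vscale (\<lambda>_. a) u \<in> H" if "u \<in> H" using that assms by (simp add: hilbert_space_of_fields_def)
  have bil: "ip u v = ip v u \<and> ip (vadd u v) w = ip u w + ip v w \<and> ip (vscale (\<lambda>_. a) u) w = a * ip u w"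
    if "u \<in> H" "v \<in> H" "w \<in> H" for u v w a
    using that assms unfolding hilbert_space_of_fields_def by blast
  then show "ip u v = ip v u" if "u \<in> H" "v \<in> H" using that by blast
  show "ip (vadd u v) w = ip u w + ip v w" if "u \<in> H" "v \<in> H" "w \<in> H" using that bil by blast
  show "ip (vscale (\<lambda>_. a) u) w = a * ip u w" if "u \<in> H" "w \<in> H" using that bil by blast
  show "ip u u \<ge> 0" if "u \<in> H"
  proof (cases "u = vzero")
    case True
    have "vscale (\<lambda>_. 0) vzero = (vzero :: ('m, 'n) vfield)" by (simp add: vscale_def vzero_def)
    then show ?thesis using bil[OF z z z, of 0] True by simp
  next
    case False
    then have "ip u u > 0" using that assms unfolding hilbert_space_of_fields_def by blast
    then show ?thesis by simp
  qed
qed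

text \<open>The values of a field of \<open>H\<close> are bounded by its norm, uniformly on each coordinate ball of a finite
  cover; as \<open>\<rho>\<close> has total mass \<open>1\<close>, a uniform bound is also a bound in \<open>L\<^sup>2\<close>.\<close>

lemma inclusion_bounded:
  assumes hil: "hilbert_space_of_fields A H ip" and incl: "continuously_included_in_C1 A H ip"
  obtains K where "K \<ge> 0" "\<And>h. h \<in> H \<Longrightarrow> h \<in> L2 \<and> sqrt (ip2 h h) \<le> K * sqrt (ip h h)"
proof -
  interpret H: semi_inner_fields H ip by (rule hilbert_semi_inner[OF hil])
  have C1: "C1_vector_field A h" if "h \<in> H" for h
    using incl that unfolding continuously_included_in_C1_def by blast
  have vf: "h p \<in> tangent_space A p" if "h \<in> H" for h p
    using C1[OF that] by (simp add: C1_vector_field_def vector_field_in)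
  obtain F where F: "finite F" "\<And>c a r. (c, a, r) \<in> F \<Longrightarrow> c \<in> A \<and> r > 0 \<and> cball a r \<subseteq> cimg c"
    "\<And>p. \<exists>(c, a, r)\<in>F. p \<in> cinv c ` ball a r" by (rule finite_ball_cover) blast
  let ?S = "\<lambda>(c, a, r). cinv c ` cball a r"
  have "\<forall>t\<in>F. \<exists>C. C \<ge> 0 \<and> (\<forall>h\<in>H. \<forall>p\<in>?S t. g p (h p) (h p) \<le> C * ip h h)"
  proof
    fix t assume t: "t \<in> F"
    obtain c a r where tt: "t = (c, a, r)" by (cases t)
    then have c: "c \<in> A" "cball a r \<subseteq> cimg c" using F(2) t by auto
    let ?T = "cinv c ` cball a r"
    have T: "compact ?T" "?T \<subseteq> cdom c" using c cinv_in[OF c(1)]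
      by (auto intro!: compact_continuous_image continuous_on_subset[OF cont_cinv[OF c(1)]])
    obtain G where G: "G \<ge> 0" "\<And>p v. p \<in> ?T \<Longrightarrow> v \<in> tangent_space A p \<Longrightarrow> g p v v \<le> G * (norm (v c))\<^sup>2"
      by (rule g_le_norm[OF c(1) T]) blast
    have "\<exists>C. \<forall>h\<in>H. \<forall>p\<in>?T. norm (h p c) \<le> C * sqrt (ip h h) \<and>
        (\<forall>i. norm (frechet_derivative (\<lambda>x. h (cinv c x) c) (at (coord c p)) (axis i 1)) \<le> C * sqrt (ip h h))"
      using incl c(1) T unfolding continuously_included_in_C1_def by blast
    then obtain C where C: "\<And>h p. h \<in> H \<Longrightarrow> p \<in> ?T \<Longrightarrow> norm (h p c) \<le> C * sqrt (ip h h)"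
      by blast
    have "g p (h p) (h p) \<le> G * C\<^sup>2 * ip h h" if h: "h \<in> H" and p: "p \<in> ?T" for h p
    proof -
      have "g p (h p) (h p) \<le> G * (norm (h p c))\<^sup>2" by (rule G(2)[OF p vf[OF h]])
      also have "\<dots> \<le> G * (C * sqrt (ip h h))\<^sup>2"
        using C[OF h p] by (intro mult_left_mono power_mono G(1)) auto
      finally show ?thesis using H.nonneg[OF h] by (simp add: power_mult_distrib mult.assoc)
    qed
    then show "\<exists>C. C \<ge> 0 \<and> (\<forall>h\<in>H. \<forall>p\<in>?S t. g p (h p) (h p) \<le> C * ip h h)"
      using G(1) unfolding tt by (intro exI[of _ "G * C\<^sup>2"]) auto
  qed
  then obtain C where C: "\<forall>t\<in>F. C t \<ge> 0 \<and> (\<forall>h\<in>H. \<forall>p\<in>?S t. g p (h p) (h p) \<le> C t * ip h h)"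
    by (rule bchoice[THEN exE])
  then have C0: "C t \<ge> 0" and CS: "\<And>h p. h \<in> H \<Longrightarrow> p \<in> ?S t \<Longrightarrow> g p (h p) (h p) \<le> C t * ip h h"
    if "t \<in> F" for t using that by blast+
  define K where "K = (\<Sum>t\<in>F. C t)"
  have K0: "K \<ge> 0" unfolding K_def using C0 by (rule sum_nonneg)
  have bound: "g p (h p) (h p) \<le> K * ip h h" if h: "h \<in> H" for h p
  proof -
    obtain c a r where t: "(c, a, r) \<in> F" "p \<in> cinv c ` ball a r" using F(3)[of p] by auto
    then have "p \<in> ?S (c, a, r)" using ball_subset_cball by auto
    then have "g p (h p) (h p) \<le> C (c, a, r) * ip h h" by (rule CS[OF t(1) h])
    also have "\<dots> \<le> K * ip h h" unfolding K_def
      using C0 t(1) F(1) H.nonneg[OF h] by (intro mult_right_mono member_le_sum) blast+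
    finally show ?thesis .
  qed
  have "h \<in> L2 \<and> sqrt (ip2 h h) \<le> sqrt K * sqrt (ip h h)" if h: "h \<in> H" for h
  proof -
    have L: "h \<in> L2" by (rule cont_field_in_L2[OF C1_imp_cont_field[OF C1[OF h]]])
    have int: "integrable vol \<rho>" by (rule integrable_continuous_mfd[OF C1_fun_continuous[OF rho_C1]])
    have "ip2 h h \<le> (\<integral>p. \<rho> p * (K * ip h h) \<partial>vol)"
      unfolding L2_inner_def using L2_integrable[OF L L] int bound[OF h] rho_pos
      by (intro integral_mono) (auto intro: mult_left_mono less_imp_le)
    also have "\<dots> = K * ip h h" using rho_int by simp
    finally have "sqrt (ip2 h h) \<le> sqrt (K * ip h h)" by simp
    then show ?thesis using L by (simp add: real_sqrt_mult)
  qed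
  then show thesis using K0 that[of "sqrt K"] by simp
qed

text \<open>The Riesz representation theorem in \<open>H\<close>, by which the definite description of the adjoint denotes.
  The conclusion keeps only membership in \<open>H\<close>, from which the \<open>C\<^sup>1\<close> regularity of the adjoint field
  follows.\<close>

lemma inclusion_adjoint:
  assumes hil: "hilbert_space_of_fields A H ip" and incl: "continuously_included_in_C1 A H ip"
    and u: "u \<in> L2"
  shows "inclusion_adjoint g vol H ip \<rho> u \<in> H"
proof -
  interpret H: semi_inner_fields H ip by (rule hilbert_semi_inner[OF hil])
  obtain K where K: "K \<ge> 0" "\<And>h. h \<in> H \<Longrightarrow> h \<in> L2 \<and> sqrt (ip2 h h) \<le> K * sqrt (ip h h)"
    using inclusion_bounded[OF hil incl] by blast
  obtain s where s: "\<And>n. s n \<in> H"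
    and repr: "\<And>n h. h \<in> H \<Longrightarrow> \<bar>ip (s n) h - ip2 h u\<bar> \<le> (1/2)^n * sqrt (ip h h)"
    and cauchy: "\<And>i j. sqrt (ip (vdiff (s i) (s j)) (vdiff (s i) (s j))) \<le> (1/2)^i + (1/2)^j"
  proof (rule H.approximate_riesz_sequence[of "\<lambda>h. ip2 h u" "K * sqrt (ip2 u u)"])
    show "\<bar>ip2 h u\<bar> \<le> K * sqrt (ip2 u u) * sqrt (ip h h)" if h: "h \<in> H" for h
    proof -
      have "\<bar>ip2 h u\<bar> \<le> sqrt (ip2 h h) * sqrt (ip2 u u)"
        using L2.cauchy_schwarz[OF _ u] K(2)[OF h] by blast
      also have "\<dots> \<le> (K * sqrt (ip h h)) * sqrt (ip2 u u)"
        using K(2)[OF h] L2.nonneg[OF u] by (intro mult_right_mono) auto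
      finally show ?thesis by (simp add: mult_ac)
    qed
    show "ip2 (vadd h h') u = ip2 h u + ip2 h' u" if "h \<in> H" "h' \<in> H" for h h'
      using L2.add_left[OF _ _ u] K(2)[OF that(1)] K(2)[OF that(2)] by blast
    show "ip2 (vscale (\<lambda>_. a) h) u = a * ip2 h u" if "h \<in> H" for a h
      using L2.scale_left[OF _ u] K(2)[OF that] by blast
  qed blast
  have half: "(\<lambda>n. (1/2::real)^n) \<longlonglongrightarrow> 0" by (intro LIMSEQ_realpow_zero) auto
  have "\<exists>N. \<forall>i\<ge>N. \<forall>j\<ge>N. sqrt (ip (vdiff (s i) (s j)) (vdiff (s i) (s j))) < e" if "e > 0" for e
  proof -
    have "\<forall>\<^sub>F n in sequentially. (1/2::real)^n < e/2" using order_tendstoD(2)[OF half, of "e/2"] that by simp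
    then obtain N where N: "\<And>n. n \<ge> N \<Longrightarrow> (1/2::real)^n < e/2" by (auto simp: eventually_sequentially)
    have "sqrt (ip (vdiff (s i) (s j)) (vdiff (s i) (s j))) < e" if "i \<ge> N" "j \<ge> N" for i j
      using cauchy[of i j] N[OF that(1)] N[OF that(2)] by linarith
    then show ?thesis by blast
  qed
  then obtain w where w: "w \<in> H" and lim: "(\<lambda>n. sqrt (ip (vdiff (s n) w) (vdiff (s n) w))) \<longlonglongrightarrow> 0"
    using hil s unfolding hilbert_space_of_fields_def by blast
  have w_repr: "ip w h = ip2 u h" if h: "h \<in> H" for h
  proof -
    have "(\<lambda>n. ip (s n) h) \<longlonglongrightarrow> ip w h"
    proof (rule LIM_zero_cancel, rule Lim_null_comparison)
      show "\<forall>\<^sub>F n in sequentially. norm (ip (s n) h - ip w h) \<le>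
          sqrt (ip (vdiff (s n) w) (vdiff (s n) w)) * sqrt (ip h h)"
        using H.cauchy_schwarz[OF H.vdiff_in[OF s w] h] H.diff_left[OF s w h] by simp
      show "(\<lambda>n. sqrt (ip (vdiff (s n) w) (vdiff (s n) w)) * sqrt (ip h h)) \<longlonglongrightarrow> 0"
        using tendsto_mult_right[OF lim, of "sqrt (ip h h)"] by simp
    qed
    moreover have "(\<lambda>n. ip (s n) h) \<longlonglongrightarrow> ip2 h u"
    proof (rule LIM_zero_cancel, rule Lim_null_comparison)
      show "\<forall>\<^sub>F n in sequentially. norm (ip (s n) h - ip2 h u) \<le> (1/2)^n * sqrt (ip h h)"
        using repr[OF h] by simp
      show "(\<lambda>n. (1/2)^n * sqrt (ip h h)) \<longlonglongrightarrow> 0"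
        using tendsto_mult_right[OF half, of "sqrt (ip h h)"] by simp
    qed
    ultimately have "ip w h = ip2 h u" by (rule LIMSEQ_unique)
    then show ?thesis using L2.sym[OF u] K(2)[OF h] by simp
  qed
  have "inclusion_adjoint g vol H ip \<rho> u = w"
    unfolding inclusion_adjoint_def inclusion_def
  proof (rule the_equality)
    show "w \<in> H \<and> (\<forall>h\<in>H. ip w h = ip2 u h)" using w w_repr by blast
    fix w' assume w': "w' \<in> H \<and> (\<forall>h\<in>H. ip w' h = ip2 u h)"
    let ?d = "vdiff w' w"
    have d: "?d \<in> H" using w w' H.vdiff_in by blast
    have "ip ?d ?d = 0" using H.diff_left[of w' w ?d] w w' w_repr d by simp
    then have "?d = vzero" using d hil unfolding hilbert_space_of_fields_def by (metis less_irrefl)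
    then show "w' = w" by (simp add: vdiff_def vzero_def fun_eq_iff)
  qed
  then show ?thesis using w by simp
qed

section \<open>Evolution of the moments\<close>

text \<open>The moments are affine in the density.\<close>

lemma moments_deriv_eq:
  assumes T: "\<And>i. C1_fun (T i)" and \<eta>: "continuous_on UNIV \<eta>"
  shows "moments_deriv vol T \<rho> \<eta> = (\<chi> i. \<integral>p. T i p * \<eta> p \<partial>vol)"
proof -
  have int: "integrable vol (\<lambda>p. T i p * h p)" if "continuous_on UNIV h" for i h
    by (intro integrable_continuous_mfd continuous_on_mult C1_fun_continuous T that)
  have "moments vol T (\<lambda>p. \<rho> p + t * \<eta> p) =
      (\<chi> i. \<integral>p. T i p * \<rho> p \<partial>vol) + t *\<^sub>R (\<chi> i. \<integral>p. T i p * \<eta> p \<partial>vol)" for t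
  proof -
    have "T i p * (\<rho> p + t * \<eta> p) = T i p * \<rho> p + t * (T i p * \<eta> p)" for i p
      by (simp add: algebra_simps)
    then show ?thesis
      using int[OF C1_fun_continuous[OF rho_C1]] int[OF \<eta>]
      by (simp add: moments_def vec_eq_iff)
  qed
  moreover have "((\<lambda>t. (\<chi> i. \<integral>p. T i p * \<rho> p \<partial>vol) + t *\<^sub>R (\<chi> i. \<integral>p. T i p * \<eta> p \<partial>vol))
      has_vector_derivative (\<chi> i. \<integral>p. T i p * \<eta> p \<partial>vol)) (at 0)"
    by (auto intro!: derivative_eq_intros)
  ultimately show ?thesis unfolding moments_deriv_def by (simp add: vector_derivative_at)
qed

text \<open>The formula for the moment evolution along the continuity equation with velocity \<open>X\<close>, by which both
  \<open>K_W\<close> and \<open>K_S\<close> are treated.\<close>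

lemma moments_deriv_neg_divergence:
  assumes T: "\<And>i. smooth_fun A (T i)" and X: "C1_vector_field A X"
  shows "moments_deriv vol T \<rho> (\<lambda>p. - divergence A g (vscale \<rho> X) p) = (\<chi> i. ip2 (grad A g (T i)) X)"
proof -
  have T1: "C1_fun (T i)" for i by (rule smooth_fun_C1[OF T])
  have rX: "C1_vector_field A (vscale \<rho> X)" by (rule C1_field_scale[OF rho_C1 X])
  have "moments_deriv vol T \<rho> (\<lambda>p. - divergence A g (vscale \<rho> X) p) =
      (\<chi> i. \<integral>p. T i p * - divergence A g (vscale \<rho> X) p \<partial>vol)"
    by (intro moments_deriv_eq T1 continuous_on_minus continuous_divergence rX)
  also have "\<dots> = (\<chi> i. \<integral>p. differential A (T i) p (vscale \<rho> X p) \<partial>vol)"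
    by (simp add: integration_by_parts[OF rX T1])
  also have "\<dots> = (\<chi> i. ip2 (grad A g (T i)) X)"
  proof -
    have "differential A (T i) p (vscale \<rho> X p) = \<rho> p * g p (grad A g (T i) p) (X p)" for i p
    proof -
      have "X p \<in> tangent_space A p" using X by (simp add: C1_vector_field_def vector_field_in)
      then show ?thesis using grad_in[OF T1, of i p] g_grad[OF T1 tangent_scale, of "X p" p i "\<rho> p"]
        by (simp add: vscale_def g_scale_right)
    qed
    then show ?thesis by (simp add: L2_inner_def)
  qed
  finally show ?thesis .
qed

end

theorem proposition7p5:
  fixes A :: "('m::{t2_space,second_countable_topology}, 'n::finite) chart set"
    and g :: "('m, 'n) metric"
    and vol :: "'m measure"
    and k :: "('m, 'n) kernel"
    and H :: "('m, 'n) vfield set"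
    and ip :: "('m, 'n) vfield \<Rightarrow> ('m, 'n) vfield \<Rightarrow> real"
    and \<rho> f :: "'m \<Rightarrow> real"
    and T :: "'k::finite \<Rightarrow> 'm \<Rightarrow> real"
    and R :: "real^'k \<Rightarrow> real^'k"
  assumes "closed_oriented_manifold A"
    and "riemannian_metric A g"
    and "riemannian_volume A g vol"
    and "smooth_kernel A k"
    and "positive_definite_kernel A g k"
    and "rkhs A g k H ip"
    and "continuously_included_in_C1 A H ip"
    and "\<rho> \<in> smooth_positive_densities A vol"
    and "smooth_fun A f"
    and "\<And>i. smooth_fun A (T i)"
    and "linear R"
  shows "(moments_deriv vol T \<rho> (K_S A g vol H ip \<rho> f) =
            R (moments_deriv vol T \<rho> (K_W A g \<rho> f)) \<longleftrightarrow>
          (\<forall>i. (\<integral>p. \<rho> p * g p (grad A g (T i) p) (M_op A g vol H ip \<rho> (grad A g f) p) \<partial>vol) =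
            (\<Sum>j\<in>UNIV. matrix R $ i $ j *
               (\<integral>p. \<rho> p * g p (grad A g (T j) p) (grad A g f p) \<partial>vol))))
       \<and> (moments_deriv vol T \<rho> (K_S A g vol H ip \<rho> f) =
            moments_deriv vol T \<rho> (K_W A g \<rho> f) \<longleftrightarrow>
          (\<forall>i. L2_inner g vol \<rho>
             (vdiff (M_op A g vol H ip \<rho> (grad A g f)) (grad A g f)) (grad A g (T i)) = 0))"
proof -
  interpret weighted_manifold A g vol \<rho> using assms by unfold_locales
  have hil: "hilbert_space_of_fields A H ip" using assms(6) by (simp add: rkhs_def)
  note incl = assms(7) and f = assms(9) and T = assms(10)
  have gf: "grad A g f \<in> L2" by (rule grad_L2[OF f])
  have gT: "grad A g (T i) \<in> L2" for i by (rule grad_L2[OF T])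
  define w where "w = inclusion_adjoint g vol H ip \<rho> (grad A g f)"
  have "w \<in> H" unfolding w_def by (rule inclusion_adjoint[OF hil incl gf])
  then have wC1: "C1_vector_field A w" using incl unfolding continuously_included_in_C1_def by blast
  have wL: "w \<in> L2" by (rule cont_field_in_L2[OF C1_imp_cont_field[OF wC1]])
  define m where "m = M_op A g vol H ip \<rho> (grad A g f)"
  have m: "m = horizontal_projection A g vol \<rho> w" by (simp add: m_def M_op_def inclusion_def w_def)
  have mL: "m \<in> L2" unfolding m by (rule horizontal_L2[OF horizontal_projection(1)[OF wL]])
  \<comment> \<open>As \<open>grad (T i)\<close> is horizontal, the projection drops out of its inner products.\<close>
  have proj: "ip2 m (grad A g (T i)) = ip2 w (grad A g (T i))" for i
    using horizontal_projection(2)[OF wL grad_horizontal[OF T], of i] L2.diff_left[OF wL mL gT, of i]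
    by (simp add: m)
  have S: "moments_deriv vol T \<rho> (K_S A g vol H ip \<rho> f) = (\<chi> i. ip2 (grad A g (T i)) m)"
    using moments_deriv_neg_divergence[OF T wC1] proj L2.sym[OF gT] wL mL
    by (simp add: K_S_def w_def)
  have W: "moments_deriv vol T \<rho> (K_W A g \<rho> f) = (\<chi> i. ip2 (grad A g (T i)) (grad A g f))"
    using moments_deriv_neg_divergence[OF T grad_C1[OF f]] by (simp add: K_W_def)
  have R: "R x $ i = (\<Sum>j\<in>UNIV. matrix R $ i $ j * x $ j)" for x i
  proof -
    have "R x = matrix R *v x" using matrix_vector_mul(2)[OF assms(11)] by metis
    then show ?thesis by (simp add: matrix_vector_mult_def)
  qed
  have "(moments_deriv vol T \<rho> (K_S A g vol H ip \<rho> f) = R (moments_deriv vol T \<rho> (K_W A g \<rho> f))) \<longleftrightarrow>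
      (\<forall>i. ip2 (grad A g (T i)) m = (\<Sum>j\<in>UNIV. matrix R $ i $ j * ip2 (grad A g (T j)) (grad A g f)))"
    unfolding S W by (simp add: vec_eq_iff R)
  moreover have "(moments_deriv vol T \<rho> (K_S A g vol H ip \<rho> f) = moments_deriv vol T \<rho> (K_W A g \<rho> f)) \<longleftrightarrow>
      (\<forall>i. ip2 (vdiff m (grad A g f)) (grad A g (T i)) = 0)"
    unfolding S W using L2.sym[OF gT] mL gf gT by (simp add: vec_eq_iff L2.diff_left)
  ultimately show ?thesis by (simp add: L2_inner_def m_def)
qed

end
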